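(* Let $0\le t<T$ and $k\ge 1$. Suppose that $\phi_\tau\in \mathrm{S}_2([t,T])$ and that every $\psi_l(\tau)$ $(l=1,\ldots,k)$ is a continuous nonrandom function on the interval $[t,T]$. For each $l=1,\ldots,k+1$ let either $w^{(l)}_\tau=f_\tau$ or $w^{(l)}_\tau=\tau$ for $\tau\in[t,T]$. Then the stochastic integral $\hat J[\phi,\psi^{(k)}]_{T,t}$ exists and $$J[\phi,\psi^{(k)}]_{T,t}=\hat J[\phi,\psi^{(k)}]_{T,t}\quad\text{with probability }1.$$
   Context: Setting. $(\Omega,\mathrm{F},\mathsf{P})$ is a complete probability space, $\mathsf{M}$ denotes expectation, $f_\tau$, $\tau\in[0,T]$, is a standard real Wiener process, and $\{\mathrm{F}_\tau,\ \tau\in[0,T]\}$ is a family of $\sigma$-algebras with $\mathrm{F}_s\subset\mathrm{F}_\tau\subset\mathrm{F}$ for $s<\tau$, such that $f_\tau$ is $\mathrm{F}_\tau$-measurable for all $\tau$ and $f_{\tau+\Delta}-f_\tau$ is independent of $\mathrm{F}_\tau$ for all $\tau\ge 0$, $\Delta>0$. Class $\mathrm{M}_2([t,T])$: functions $\xi:[t,T]\times\Omega\to\mathbb{R}$ that are jointly measurable, $\mathrm{F}_\tau$-measurable for each $\tau\in[t,T]$ (with $\xi(\tau,\cdot)$ independent of the increments $f_{s+\Delta}-f_s$ for $s\ge\tau$, $\Delta>0$), with $\int_t^T\mathsf{M}\{\xi(\tau,\omega)^2\}d\tau<\infty$ and $\mathsf{M}\{\xi(\tau,\omega)^2\}<\infty$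 for all $\tau\in[t,T]$. Class $\mathrm{S}_2([t,T])$: those $\xi\in\mathrm{M}_2([t,T])$ that are mean-square continuous on $[t,T]$. For $\xi\in\mathrm{M}_2$, $\int\xi_\tau df_\tau$ is the usual Ito integral, and $\int\xi_\tau d\tau$ is the mean-square limit of the sums $\sum_j\xi^{(N)}(\tau_j)(\tau_{j+1}-\tau_j)$ for step functions $\xi^{(N)}\in \mathrm{M}_2$ with $\int\mathsf{M}\{|\xi^{(N)}-\xi|^2\}d\tau\to0$. Iterated Ito integral. With $\psi^{(k)}=(\psi_1,\ldots,\psi_k)$, $$J[\phi,\psi^{(k)}]_{T,t}=\int_t^T\psi_1(t_1)\ldots\int_t^{t_{k-1}}\psi_k(t_k)\int_t^{t_k}\phi_\tau\,dw^{(k+1)}_\tau\,dw^{(k)}_{t_k}\ldots dw^{(1)}_{t_1}$$ (the innermost integral is the one with integrand $\phi$). Reversed-order integrals. All limits $\mathrm{l.i.m.}$ are mean-square limits along partitions $s=\tau_0<\tau_1<\ldots<\tau_N=T$ of the relevant interval $[s,T]$ with mesh $\max_j|\tau_{j+1}-\tau_j|\to0$ as $N\to\infty$, and $\Delta w^{(i)}_{\tau_l}=w^{(i)}_{\tau_{l+1}}-w^{(i)}_{\tau_l}$. Put $\hat I[\psi^{(0)}]_{T,s}=1$ and, recursively, for $r\ge1$ and $[s,T]\subseteq[t,T]$, $$\hat I[\psi^{(r)}]_{T,s}=\underset{N\to\infty}{\mathrm{l.i.m.}}\ \sum_{l=0}^{N-1}\psi_r(\tau_l)\,\Delta w^{(r)}_{\tau_l}\,\hat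 I[\psi^{(r-1)}]_{T,\tau_{l+1}},$$ where $\psi^{(r)}=(\psi_1,\ldots,\psi_r)$ and $\{\tau_l\}$ partitions $[s,T]$; this is the meaning of $\int_s^T\psi_r(t_r)dw^{(r)}_{t_r}\int_{t_r}^T\psi_{r-1}(t_{r-1})dw^{(r-1)}_{t_{r-1}}\ldots\int_{t_2}^T\psi_1(t_1)dw^{(1)}_{t_1}$. Then $$\hat J[\phi,\psi^{(k)}]_{T,t}=\int_t^T\phi_s\,dw^{(k+1)}_s\,\hat I[\psi^{(k)}]_{T,s}:=\underset{N\to\infty}{\mathrm{l.i.m.}}\ \sum_{l=0}^{N-1}\phi_{\tau_l}\,\Delta w^{(k+1)}_{\tau_l}\,\hat I[\psi^{(k)}]_{T,\tau_{l+1}},$$ where $\{\tau_l\}$ partitions $[t,T]$. Existence of $\hat J$ means existence of the mean-square limits in this definition. *)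

theory Defs
  imports "HOL-Probability.Probability"
begin

definition square_integrable :: "'a measure \<Rightarrow> ('a \<Rightarrow> real) \<Rightarrow> bool" where
  "square_integrable M X \<longleftrightarrow> X \<in> borel_measurable M \<and> integrable M (\<lambda>\<omega>. (X \<omega>)\<^sup>2)"

definition ms_limit :: "'a measure \<Rightarrow> (nat \<Rightarrow> 'a \<Rightarrow> real) \<Rightarrow> ('a \<Rightarrow> real) \<Rightarrow> bool" where
  "ms_limit M X Y \<longleftrightarrow> (\<forall>N. square_integrable M (X N)) \<and> square_integrable M Y \<and>
     (\<lambda>N. \<integral>\<omega>. (X N \<omega> - Y \<omega>)\<^sup>2 \<partial>M) \<longlonglongrightarrow> 0"

(* The degenerate interval a = b has exactly one partition, n = 0, and every sum over it is empty. *)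
definition interval_partition :: "real \<Rightarrow> real \<Rightarrow> nat \<Rightarrow> (nat \<Rightarrow> real) \<Rightarrow> bool" where
  "interval_partition a b n p \<longleftrightarrow> p 0 = a \<and> p n = b \<and> (\<forall>j<n. p j < p (Suc j))"

definition mesh :: "nat \<Rightarrow> (nat \<Rightarrow> real) \<Rightarrow> real" where
  "mesh n p = (if n = 0 then 0 else Max ((\<lambda>j. \<bar>p (Suc j) - p j\<bar>) ` {..<n}))"

definition standard_wiener :: "'a measure \<Rightarrow> real \<Rightarrow> (real \<Rightarrow> 'a \<Rightarrow> real) \<Rightarrow> bool" where
  "standard_wiener M T f \<longleftrightarrow>
     (\<forall>\<tau>\<in>{0..T}. f \<tau> \<in> borel_measurable M) \<and>
     (AE \<omega> in M. f 0 \<omega> = 0) \<and>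
     (AE \<omega> in M. continuous_on {0..T} (\<lambda>\<tau>. f \<tau> \<omega>)) \<and>
     (\<forall>s \<tau>. 0 \<le> s \<and> s < \<tau> \<and> \<tau> \<le> T \<longrightarrow>
        distributed M lborel (\<lambda>\<omega>. f \<tau> \<omega> - f s \<omega>) (\<lambda>x. ennreal (normal_density 0 (sqrt (\<tau> - s)) x))) \<and>
     (\<forall>n p. interval_partition 0 T n p \<longrightarrow>
        prob_space.indep_vars M (\<lambda>_. borel) (\<lambda>j \<omega>. f (p (Suc j)) \<omega> - f (p j) \<omega>) {..<n})"

definition wiener_filtration ::
  "'a measure \<Rightarrow> real \<Rightarrow> (real \<Rightarrow> 'a measure) \<Rightarrow> (real \<Rightarrow> 'a \<Rightarrow> real) \<Rightarrow> bool" where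
  "wiener_filtration M T F f \<longleftrightarrow>
     (\<forall>\<tau>\<in>{0..T}. subalgebra M (F \<tau>)) \<and>
     (\<forall>s \<tau>. 0 \<le> s \<and> s < \<tau> \<and> \<tau> \<le> T \<longrightarrow> sets (F s) \<subseteq> sets (F \<tau>)) \<and>
     (\<forall>\<tau>\<in>{0..T}. f \<tau> \<in> borel_measurable (F \<tau>)) \<and>
     (\<forall>\<tau> \<Delta>. 0 \<le> \<tau> \<and> 0 < \<Delta> \<and> \<tau> + \<Delta> \<le> T \<longrightarrow>
        prob_space.indep_set M (sets (F \<tau>))
          (sets (vimage_algebra (space M) (\<lambda>\<omega>. f (\<tau> + \<Delta>) \<omega> - f \<tau> \<omega>) borel)))"

(* T is the time horizon of the Wiener process, {a..b} the subinterval of {0..T} on which the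
   processes of the class are considered; values outside {a..b} are unconstrained. *)
definition M2_class ::
  "'a measure \<Rightarrow> real \<Rightarrow> (real \<Rightarrow> 'a measure) \<Rightarrow> (real \<Rightarrow> 'a \<Rightarrow> real) \<Rightarrow> real \<Rightarrow> real \<Rightarrow>
   (real \<Rightarrow> 'a \<Rightarrow> real) set" where
  "M2_class M T F f a b = {\<xi>.
     (\<lambda>(\<tau>, \<omega>). \<xi> \<tau> \<omega>) \<in> borel_measurable (restrict_space borel {a..b} \<Otimes>\<^sub>M M) \<and>
     (\<forall>\<tau>\<in>{a..b}. \<xi> \<tau> \<in> borel_measurable (F \<tau>)) \<and>
     (\<forall>\<tau>\<in>{a..b}. \<forall>s \<Delta>. \<tau> \<le> s \<and> 0 < \<Delta> \<and> s + \<Delta> \<le> T \<longrightarrow>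
        prob_space.indep_var M borel (\<xi> \<tau>) borel (\<lambda>\<omega>. f (s + \<Delta>) \<omega> - f s \<omega>)) \<and>
     (\<forall>\<tau>\<in>{a..b}. square_integrable M (\<xi> \<tau>)) \<and>
     set_integrable lborel {a..b} (\<lambda>\<tau>. \<integral>\<omega>. (\<xi> \<tau> \<omega>)\<^sup>2 \<partial>M)}"

definition S2_class ::
  "'a measure \<Rightarrow> real \<Rightarrow> (real \<Rightarrow> 'a measure) \<Rightarrow> (real \<Rightarrow> 'a \<Rightarrow> real) \<Rightarrow> real \<Rightarrow> real \<Rightarrow>
   (real \<Rightarrow> 'a \<Rightarrow> real) set" where
  "S2_class M T F f a b = {\<xi> \<in> M2_class M T F f a b.
     \<forall>\<tau>\<in>{a..b}. ((\<lambda>s. \<integral>\<omega>. (\<xi> s \<omega> - \<xi> \<tau> \<omega>)\<^sup>2 \<partial>M) \<longlongrightarrow> 0) (at \<tau> within {a..b})}"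

definition step_process ::
  "'a measure \<Rightarrow> nat \<Rightarrow> (nat \<Rightarrow> real) \<Rightarrow> (real \<Rightarrow> 'a \<Rightarrow> real) \<Rightarrow> bool" where
  "step_process M n p \<zeta> \<longleftrightarrow>
     (\<forall>j<n. \<forall>\<tau>\<in>{p j..<p (Suc j)}. \<forall>\<omega>\<in>space M. \<zeta> \<tau> \<omega> = \<zeta> (p j) \<omega>)"

(* X is a version of the integral of \<xi> with respect to w over [a,b]: the Ito integral if w = f,
   the mean-square integral with respect to time if w is the identity. Both are mean-square limits
   of the same sums over the same approximating step processes. *)
definition is_stochastic_integral ::
  "'a measure \<Rightarrow> real \<Rightarrow> (real \<Rightarrow> 'a measure) \<Rightarrow> (real \<Rightarrow> 'a \<Rightarrow> real) \<Rightarrow> (real \<Rightarrow> 'a \<Rightarrow> real) \<Rightarrow>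
   (real \<Rightarrow> 'a \<Rightarrow> real) \<Rightarrow> real \<Rightarrow> real \<Rightarrow> ('a \<Rightarrow> real) \<Rightarrow> bool" where
  "is_stochastic_integral M T F f w \<xi> a b X \<longleftrightarrow>
     \<xi> \<in> M2_class M T F f a b \<and>
     (\<exists>n p \<zeta>.
        (\<forall>N. interval_partition a b (n N) (p N) \<and> step_process M (n N) (p N) (\<zeta> N) \<and>
             \<zeta> N \<in> M2_class M T F f a b) \<and>
        (\<lambda>N. LINT \<tau>:{a..b}|lborel. (\<integral>\<omega>. (\<zeta> N \<tau> \<omega> - \<xi> \<tau> \<omega>)\<^sup>2 \<partial>M)) \<longlonglongrightarrow> 0 \<and>
        ms_limit M (\<lambda>N \<omega>. \<Sum>j<n N. \<zeta> N (p N j) \<omega> * (w (p N (Suc j)) \<omega> - w (p N j) \<omega>)) X)"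

(* The innermost integral, the one with integrand \<phi>, is peeled off first:
   J[\<phi>, (\<psi>_1, ..., \<psi>_{k+1})] = J[\<psi>_{k+1} * Y, (\<psi>_1, ..., \<psi>_k)],
   where Y s is the integral of \<phi> over [t,s]. Each Y s is determined only up to a null set;
   that versions are chosen such that \<psi>_{k+1} * Y is jointly measurable and adapted is enforced
   by is_stochastic_integral at the next level. *)
primrec is_iterated_ito ::
  "'a measure \<Rightarrow> real \<Rightarrow> (real \<Rightarrow> 'a measure) \<Rightarrow> (real \<Rightarrow> 'a \<Rightarrow> real) \<Rightarrow> (nat \<Rightarrow> real \<Rightarrow> 'a \<Rightarrow> real) \<Rightarrow>
   (nat \<Rightarrow> real \<Rightarrow> real) \<Rightarrow> real \<Rightarrow> nat \<Rightarrow> (real \<Rightarrow> 'a \<Rightarrow> real) \<Rightarrow> ('a \<Rightarrow> real) \<Rightarrow> bool" where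
  "is_iterated_ito M T F f w \<psi> t 0 \<phi> X \<longleftrightarrow> is_stochastic_integral M T F f (w 1) \<phi> t T X"
| "is_iterated_ito M T F f w \<psi> t (Suc k) \<phi> X \<longleftrightarrow>
     (\<exists>Y. (\<forall>s\<in>{t..T}. is_stochastic_integral M T F f (w (k + 2)) \<phi> t s (Y s)) \<and>
          is_iterated_ito M T F f w \<psi> t k (\<lambda>\<tau> \<omega>. \<psi> (Suc k) \<tau> * Y \<tau> \<omega>) X)"

(* X is the limit, along all sequences of partitions of [s,T] with mesh tending to 0, of the sums
   in which g and w are taken as for Ito sums but I at the right endpoint. *)
definition is_reversed_limit ::
  "'a measure \<Rightarrow> real \<Rightarrow> (real \<Rightarrow> 'a \<Rightarrow> real) \<Rightarrow> (real \<Rightarrow> 'a \<Rightarrow> real) \<Rightarrow> (real \<Rightarrow> 'a \<Rightarrow> real) \<Rightarrow>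
   real \<Rightarrow> ('a \<Rightarrow> real) \<Rightarrow> bool" where
  "is_reversed_limit M T w g I s X \<longleftrightarrow>
     (\<forall>n p. (\<forall>N. interval_partition s T (n N) (p N)) \<and> (\<lambda>N. mesh (n N) (p N)) \<longlonglongrightarrow> 0 \<longrightarrow>
        ms_limit M (\<lambda>N \<omega>. \<Sum>l<n N. g (p N l) \<omega> * (w (p N (Suc l)) \<omega> - w (p N l) \<omega>) * I (p N (Suc l)) \<omega>) X)"

(* I s is a version of the r-fold reversed integral over [s,T], for all s in [t,T]. *)
primrec is_reversed_inner ::
  "'a measure \<Rightarrow> real \<Rightarrow> (nat \<Rightarrow> real \<Rightarrow> 'a \<Rightarrow> real) \<Rightarrow> (nat \<Rightarrow> real \<Rightarrow> real) \<Rightarrow> real \<Rightarrow> nat \<Rightarrow>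
   (real \<Rightarrow> 'a \<Rightarrow> real) \<Rightarrow> bool" where
  "is_reversed_inner M T w \<psi> t 0 I \<longleftrightarrow> (\<forall>s\<in>{t..T}. \<forall>\<omega>\<in>space M. I s \<omega> = 1)"
| "is_reversed_inner M T w \<psi> t (Suc r) I \<longleftrightarrow>
     (\<exists>I'. is_reversed_inner M T w \<psi> t r I' \<and>
        (\<forall>s\<in>{t..T}. is_reversed_limit M T (w (Suc r)) (\<lambda>\<tau> \<omega>. \<psi> (Suc r) \<tau>) I' s (I s)))"

definition is_reversed_iterated ::
  "'a measure \<Rightarrow> real \<Rightarrow> (nat \<Rightarrow> real \<Rightarrow> 'a \<Rightarrow> real) \<Rightarrow> (nat \<Rightarrow> real \<Rightarrow> real) \<Rightarrow> real \<Rightarrow> nat \<Rightarrow>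
   (real \<Rightarrow> 'a \<Rightarrow> real) \<Rightarrow> ('a \<Rightarrow> real) \<Rightarrow> bool" where
  "is_reversed_iterated M T w \<psi> t k \<phi> X \<longleftrightarrow>
     (\<exists>I. is_reversed_inner M T w \<psi> t k I \<and> is_reversed_limit M T (w (Suc k)) \<phi> I t X)"

end

theory Submission
  imports Defs
begin

text \<open>
  Replacing all integrals by sums over one partition turns the statement into a change of the order of
  summation. To pass to the limit, the reversed sum over a partition \<open>p\<close> with the true inner integrals
  is approximated by a nested forward sum over a refinement \<open>Q\<close> of \<open>p\<close>: the inner reversed integral
  from \<open>s\<close> is itself the iterated integral over \<open>[s,T]\<close> of a deterministic integrand, so it is a limit
  of nested sums over the part of \<open>Q\<close> beyond \<open>s\<close>, and the adapted factors in front of it can be pulled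
  into these finite sums. Compared with the nested sums of the iterated integral, only the innermost
  sum differs: it is taken along \<open>p\<close> instead of \<open>Q\<close>. By the Ito isometry and the Cauchy-Schwarz
  inequality nested sums are bounded operators, uniformly in \<open>Q\<close>, so the mean-square error is bounded
  by that of the innermost sum along \<open>p\<close>; the limit in \<open>Q\<close> is taken with Fatou's lemma.
\<close>

subsection \<open>Mean-square norms\<close>

text \<open>The obstacle is the product of an integrand, an increment and an inner integral in every
  term of a reversed sum. Both the adapted part and the inner integral are only known to be square
  integrable, independence of the inner integral from the past is nowhere established, and products
  of mean-square limits need not converge in mean square. So no isometry is applied to the reversed
  sum itself. Refinements chosen with errors at most \<open>(1/2) ^ N\<close> turn mean-square
  limits into almost sure ones, which finite sums of products respect; Fatou's lemma then yields
  square integrability of the reversed sum together with the error bound. That an inner reversed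
  integral is an iterated integral is the statement itself, one order lower, on \<open>[s,T]\<close>
  and with a deterministic function in the place of \<phi>. This forces integrals with an arbitrary
  lower limit \<open>a\<close> and with general mean-square continuous integrands.\<close>

definition ms_norm :: "'a measure \<Rightarrow> ('a \<Rightarrow> real) \<Rightarrow> real" where
  "ms_norm M X = sqrt (\<integral>\<omega>. (X \<omega>)\<^sup>2 \<partial>M)"

lemma square_integrableI:
  "X \<in> borel_measurable M \<Longrightarrow> integrable M (\<lambda>\<omega>. (X \<omega>)\<^sup>2) \<Longrightarrow> square_integrable M X"
  by (simp add: square_integrable_def)

lemma square_integrable_measurable [measurable_dest]:
  "square_integrable M X \<Longrightarrow> X \<in> borel_measurable M"
  by (simp add: square_integrable_def)

lemma square_integrable_integrable_square:
  "square_integrable M X \<Longrightarrow> integrable M (\<lambda>\<omega>. (X \<omega>)\<^sup>2)"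
  by (simp add: square_integrable_def)

lemma square_integrable_mult_integrable:
  assumes "square_integrable M X" "square_integrable M Y"
  shows "integrable M (\<lambda>\<omega>. X \<omega> * Y \<omega>)"
proof (rule Bochner_Integration.integrable_bound)
  show "integrable M (\<lambda>\<omega>. (X \<omega>)\<^sup>2 + (Y \<omega>)\<^sup>2)"
    using assms by (intro Bochner_Integration.integrable_add square_integrable_integrable_square)
  show "(\<lambda>\<omega>. X \<omega> * Y \<omega>) \<in> borel_measurable M"
    using assms by (intro borel_measurable_times square_integrable_measurable)
  have "\<bar>x * y\<bar> \<le> x\<^sup>2 + y\<^sup>2" for x y :: real
  proof -
    have "2 * (\<bar>x\<bar> * \<bar>y\<bar>) \<le> x\<^sup>2 + y\<^sup>2"
      using sum_squares_bound[of "\<bar>x\<bar>" "\<bar>y\<bar>"] by (simp add: algebra_simps)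
    moreover have "0 \<le> \<bar>x\<bar> * \<bar>y\<bar>" by simp
    ultimately show ?thesis unfolding abs_mult by linarith
  qed
  then show "AE \<omega> in M. norm (X \<omega> * Y \<omega>) \<le> norm ((X \<omega>)\<^sup>2 + (Y \<omega>)\<^sup>2)"
    by simp
qed

lemma square_integrable_0 [simp]: "square_integrable M (\<lambda>\<omega>. 0)"
  by (simp add: square_integrable_def)

lemma square_integrable_add:
  assumes "square_integrable M X" "square_integrable M Y"
  shows "square_integrable M (\<lambda>\<omega>. X \<omega> + Y \<omega>)"
proof (rule square_integrableI)
  show "(\<lambda>\<omega>. X \<omega> + Y \<omega>) \<in> borel_measurable M"
    using assms by (intro borel_measurable_add square_integrable_measurable)
  show "integrable M (\<lambda>\<omega>. (X \<omega> + Y \<omega>)\<^sup>2)"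
    unfolding power2_sum mult.assoc using assms
    by (intro Bochner_Integration.integrable_add integrable_mult_right
        square_integrable_integrable_square square_integrable_mult_integrable)
qed

lemma square_integrable_cmult:
  "square_integrable M X \<Longrightarrow> square_integrable M (\<lambda>\<omega>. c * X \<omega>)"
  unfolding square_integrable_def by (auto simp: power_mult_distrib)

lemma square_integrable_diff:
  assumes "square_integrable M X" "square_integrable M Y"
  shows "square_integrable M (\<lambda>\<omega>. X \<omega> - Y \<omega>)"
  using square_integrable_add[OF assms(1) square_integrable_cmult[OF assms(2), of "- 1"]] by simp

lemma square_integrable_sum:
  "(\<And>i. i \<in> I \<Longrightarrow> square_integrable M (X i)) \<Longrightarrow> square_integrable M (\<lambda>\<omega>. \<Sum>i\<in>I. X i \<omega>)"
  by (induction I rule: infinite_finite_induct) (auto intro!: square_integrable_add)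

lemma square_integrable_cong:
  "(\<And>\<omega>. \<omega> \<in> space M \<Longrightarrow> X \<omega> = Y \<omega>) \<Longrightarrow> square_integrable M X \<longleftrightarrow> square_integrable M Y"
  unfolding square_integrable_def
  by (intro conj_cong measurable_cong Bochner_Integration.integrable_cong) auto

lemma square_integrable_cong_AE:
  assumes "square_integrable M X" "Y \<in> borel_measurable M" "AE \<omega> in M. X \<omega> = Y \<omega>"
  shows "square_integrable M Y"
proof (rule square_integrableI[OF assms(2)])
  have "integrable M (\<lambda>\<omega>. (X \<omega>)\<^sup>2) \<longleftrightarrow> integrable M (\<lambda>\<omega>. (Y \<omega>)\<^sup>2)"
    using assms by (intro integrable_cong_AE borel_measurable_power) (auto dest: square_integrable_measurable)
  then show "integrable M (\<lambda>\<omega>. (Y \<omega>)\<^sup>2)"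
    using assms(1) by (simp add: square_integrable_def)
qed

lemma ms_norm_nonneg [simp]: "0 \<le> ms_norm M X"
  by (simp add: ms_norm_def)

lemma ms_norm_square: "(ms_norm M X)\<^sup>2 = (\<integral>\<omega>. (X \<omega>)\<^sup>2 \<partial>M)"
  by (simp add: ms_norm_def)

lemma ms_norm_0 [simp]: "ms_norm M (\<lambda>\<omega>. 0) = 0"
  by (simp add: ms_norm_def)

lemma ms_norm_cong: "(\<And>\<omega>. \<omega> \<in> space M \<Longrightarrow> X \<omega> = Y \<omega>) \<Longrightarrow> ms_norm M X = ms_norm M Y"
  unfolding ms_norm_def by (intro arg_cong[where f = sqrt] Bochner_Integration.integral_cong) auto

lemma ms_norm_cong_AE:
  assumes "X \<in> borel_measurable M" "Y \<in> borel_measurable M" "AE \<omega> in M. X \<omega> = Y \<omega>"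
  shows "ms_norm M X = ms_norm M Y"
  unfolding ms_norm_def using assms
  by (intro arg_cong[where f = sqrt] integral_cong_AE borel_measurable_power) auto

abbreviation ms_dist :: "'a measure \<Rightarrow> ('a \<Rightarrow> real) \<Rightarrow> ('a \<Rightarrow> real) \<Rightarrow> real" where
  "ms_dist M X Y \<equiv> ms_norm M (\<lambda>\<omega>. X \<omega> - Y \<omega>)"

lemma ms_norm_minus_commute: "ms_dist M X Y = ms_dist M Y X"
  unfolding ms_norm_def by (simp add: power2_commute)

lemma ms_norm_cmult: "ms_norm M (\<lambda>\<omega>. c * X \<omega>) = \<bar>c\<bar> * ms_norm M X"
  by (simp add: ms_norm_def power_mult_distrib real_sqrt_mult)

lemma ms_norm_triangle:
  assumes "square_integrable M X" "square_integrable M Y"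
  shows "ms_norm M (\<lambda>\<omega>. X \<omega> + Y \<omega>) \<le> ms_norm M X + ms_norm M Y"
proof (rule field_le_epsilon)
  fix e :: real assume "e > 0"
  \<comment> \<open>Young's inequality with weights \<open>b / a\<close> and \<open>a / b\<close>
    turns the bound into the perfect square of \<open>a + b\<close>. Adding \<open>e / 2\<close>
    keeps both weights defined when a norm vanishes.\<close>
  define a b where "a = ms_norm M X + e / 2" and "b = ms_norm M Y + e / 2"
  have ab: "a > 0" "b > 0" using \<open>e > 0\<close> by (simp_all add: a_def b_def add_nonneg_pos)
  have iX: "integrable M (\<lambda>\<omega>. (X \<omega>)\<^sup>2)" and iY: "integrable M (\<lambda>\<omega>. (Y \<omega>)\<^sup>2)"
    using assms by (auto dest: square_integrable_integrable_square)
  have pt: "(x + y)\<^sup>2 \<le> (1 + b / a) * x\<^sup>2 + (1 + a / b) * y\<^sup>2" for x y :: real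
  proof -
    have "0 \<le> (b * x - a * y)\<^sup>2 / (a * b)" using ab by simp
    also have "\<dots> = (b / a) * x\<^sup>2 + (a / b) * y\<^sup>2 - 2 * x * y"
      using ab by (simp add: power2_eq_square field_simps)
    finally show ?thesis by (simp add: power2_eq_square algebra_simps)
  qed
  have "(ms_norm M (\<lambda>\<omega>. X \<omega> + Y \<omega>))\<^sup>2 \<le> (\<integral>\<omega>. (1 + b / a) * (X \<omega>)\<^sup>2 + (1 + a / b) * (Y \<omega>)\<^sup>2 \<partial>M)"
    unfolding ms_norm_square
    by (intro integral_mono pt Bochner_Integration.integrable_add integrable_mult_right iX iY
        square_integrable_integrable_square square_integrable_add assms)
  also have "\<dots> = (1 + b / a) * (ms_norm M X)\<^sup>2 + (1 + a / b) * (ms_norm M Y)\<^sup>2"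
    using iX iY by (simp add: ms_norm_square)
  also have "\<dots> \<le> (1 + b / a) * a\<^sup>2 + (1 + a / b) * b\<^sup>2"
    using ab \<open>e > 0\<close>
    by (intro add_mono mult_left_mono power_mono) (auto simp: a_def b_def)
  also have "\<dots> = (a + b)\<^sup>2"
    using ab by (simp add: power2_eq_square field_simps)
  finally have "ms_norm M (\<lambda>\<omega>. X \<omega> + Y \<omega>) \<le> a + b"
    by (rule power2_le_imp_le) (use ab in linarith)
  then show "ms_norm M (\<lambda>\<omega>. X \<omega> + Y \<omega>) \<le> ms_norm M X + ms_norm M Y + e"
    by (simp add: a_def b_def)
qed

lemma ms_norm_triangle_diff:
  assumes "square_integrable M X" "square_integrable M Y" "square_integrable M Z"
  shows "ms_dist M X Z \<le> ms_dist M X Y + ms_dist M Y Z"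
  using ms_norm_triangle[OF square_integrable_diff[OF assms(1,2)] square_integrable_diff[OF assms(2,3)]]
  by simp

lemma ms_norm_le_diff:
  assumes "square_integrable M X" "square_integrable M Y"
  shows "ms_norm M X \<le> ms_dist M X Y + ms_norm M Y"
  using ms_norm_triangle_diff[OF assms square_integrable_0] by simp

lemma ms_norm_zero_AE:
  assumes "square_integrable M X" "ms_norm M X \<le> 0"
  shows "AE \<omega> in M. X \<omega> = 0"
proof -
  have "(\<integral>\<omega>. (X \<omega>)\<^sup>2 \<partial>M) = 0"
    using assms(2) ms_norm_nonneg[of M X] by (simp add: ms_norm_square[symmetric])
  then have "AE \<omega> in M. (X \<omega>)\<^sup>2 = 0"
    using assms(1) by (subst (asm) integral_nonneg_eq_0_iff_AE)
      (auto dest: square_integrable_integrable_square)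
  then show ?thesis by simp
qed

lemma ms_limit_iff_ms_norm:
  "ms_limit M X Y \<longleftrightarrow> (\<forall>N. square_integrable M (X N)) \<and> square_integrable M Y \<and>
    (\<lambda>N. ms_dist M (X N) Y) \<longlonglongrightarrow> 0"
proof -
  have "(\<lambda>N. \<integral>\<omega>. (X N \<omega> - Y \<omega>)\<^sup>2 \<partial>M) \<longlonglongrightarrow> 0 \<longleftrightarrow> (\<lambda>N. ms_dist M (X N) Y) \<longlonglongrightarrow> 0"
  proof
    assume "(\<lambda>N. \<integral>\<omega>. (X N \<omega> - Y \<omega>)\<^sup>2 \<partial>M) \<longlonglongrightarrow> 0"
    from tendsto_real_sqrt[OF this] show "(\<lambda>N. ms_dist M (X N) Y) \<longlonglongrightarrow> 0"
      by (simp add: ms_norm_def)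
  next
    assume "(\<lambda>N. ms_dist M (X N) Y) \<longlonglongrightarrow> 0"
    from tendsto_power[OF this, of 2] show "(\<lambda>N. \<integral>\<omega>. (X N \<omega> - Y \<omega>)\<^sup>2 \<partial>M) \<longlonglongrightarrow> 0"
      by (simp add: ms_norm_square)
  qed
  then show ?thesis by (simp add: ms_limit_def)
qed

lemma ms_limit_unique:
  assumes "ms_limit M X Y" "ms_limit M X Z"
  shows "AE \<omega> in M. Y \<omega> = Z \<omega>"
proof -
  have sq: "square_integrable M Y" "square_integrable M Z" "\<And>N. square_integrable M (X N)"
    using assms by (auto simp: ms_limit_def)
  have "(\<lambda>N. ms_dist M (X N) Y + ms_dist M (X N) Z) \<longlonglongrightarrow> 0 + 0"
    using assms by (intro tendsto_add) (auto simp: ms_limit_iff_ms_norm)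
  moreover have "ms_dist M Y Z \<le> ms_dist M (X N) Y + ms_dist M (X N) Z" for N
    using ms_norm_triangle_diff[OF sq(1) sq(3)[of N] sq(2)] by (simp add: ms_norm_minus_commute[of M Y])
  ultimately have "ms_dist M Y Z \<le> 0"
    using LIMSEQ_le_const[of _ "0::real" "ms_dist M Y Z"] by auto
  from ms_norm_zero_AE[OF square_integrable_diff[OF sq(1,2)] this] show ?thesis by simp
qed

lemma ms_limit_cong_AE:
  assumes "ms_limit M X Y" "Z \<in> borel_measurable M" "AE \<omega> in M. Y \<omega> = Z \<omega>"
  shows "ms_limit M X Z"
proof -
  have [measurable]: "Y \<in> borel_measurable M" "\<And>N. X N \<in> borel_measurable M" "Z \<in> borel_measurable M"
    using assms by (auto simp: ms_limit_def square_integrable_def)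
  have eq: "ms_dist M (X N) Y = ms_dist M (X N) Z" for N
    using assms(3) by (intro ms_norm_cong_AE) auto
  have "square_integrable M Y" using assms(1) by (simp add: ms_limit_def)
  then have "square_integrable M Z" by (rule square_integrable_cong_AE) (fact assms)+
  with assms(1) show ?thesis by (simp add: ms_limit_iff_ms_norm eq)
qed

text \<open>Fatou's lemma for the squares. Square integrability of the limit is a conclusion, so the
  lemma applies to sums of products, about whose second moments nothing is known beforehand.\<close>

lemma ms_norm_Fatou:
  assumes U: "\<And>N. square_integrable M (U N)" and B: "\<And>N. ms_norm M (U N) \<le> B"
    and [measurable]: "V \<in> borel_measurable M"
    and lim: "AE \<omega> in M. (\<lambda>N. U N \<omega>) \<longlonglongrightarrow> V \<omega>"
  shows "square_integrable M V" "ms_norm M V \<le> B"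
proof -
  have [measurable]: "\<And>N. U N \<in> borel_measurable M" using U by (auto dest: square_integrable_measurable)
  have "0 \<le> B" using B[of 0] ms_norm_nonneg[of M "U 0"] by linarith
  have "(\<integral>\<^sup>+\<omega>. ennreal ((V \<omega>)\<^sup>2) \<partial>M) = (\<integral>\<^sup>+\<omega>. liminf (\<lambda>N. ennreal ((U N \<omega>)\<^sup>2)) \<partial>M)"
  proof (rule nn_integral_cong_AE)
    show "AE \<omega> in M. ennreal ((V \<omega>)\<^sup>2) = liminf (\<lambda>N. ennreal ((U N \<omega>)\<^sup>2))"
      using lim
    proof eventually_elim
      case (elim \<omega>)
      have "(\<lambda>N. ennreal ((U N \<omega>)\<^sup>2)) \<longlonglongrightarrow> ennreal ((V \<omega>)\<^sup>2)"
        by (intro tendsto_ennrealI tendsto_power elim)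
      then show ?case by (intro lim_imp_Liminf[symmetric]) auto
    qed
  qed
  also have "\<dots> \<le> liminf (\<lambda>N. \<integral>\<^sup>+\<omega>. ennreal ((U N \<omega>)\<^sup>2) \<partial>M)"
    by (rule nn_integral_liminf) simp
  also have "\<dots> \<le> ennreal (B\<^sup>2)"
  proof (rule Liminf_le)
    show "\<forall>\<^sub>F N in sequentially. (\<integral>\<^sup>+\<omega>. ennreal ((U N \<omega>)\<^sup>2) \<partial>M) \<le> ennreal (B\<^sup>2)"
    proof (rule always_eventually, rule allI)
      fix N
      have "(\<integral>\<^sup>+\<omega>. ennreal ((U N \<omega>)\<^sup>2) \<partial>M) = ennreal ((ms_norm M (U N))\<^sup>2)"
        unfolding ms_norm_square
        by (intro nn_integral_eq_integral square_integrable_integrable_square U) auto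
      also have "\<dots> \<le> ennreal (B\<^sup>2)"
        using B[of N] by (intro ennreal_leI power_mono) auto
      finally show "(\<integral>\<^sup>+\<omega>. ennreal ((U N \<omega>)\<^sup>2) \<partial>M) \<le> ennreal (B\<^sup>2)" .
    qed
  qed simp
  finally have le: "(\<integral>\<^sup>+\<omega>. ennreal ((V \<omega>)\<^sup>2) \<partial>M) \<le> ennreal (B\<^sup>2)" .
  have int: "integrable M (\<lambda>\<omega>. (V \<omega>)\<^sup>2)"
    using le_less_trans[OF le] by (intro integrableI_nonneg) auto
  then show "square_integrable M V" by (simp add: square_integrable_def)
  have "(\<integral>\<omega>. (V \<omega>)\<^sup>2 \<partial>M) \<le> B\<^sup>2"
    using le nn_integral_eq_integral[OF int] by (simp add: ennreal_le_iff)
  then show "ms_norm M V \<le> B"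
    unfolding ms_norm_def using \<open>0 \<le> B\<close> real_le_lsqrt by blast
qed

section \<open>Almost sure convergence and completeness\<close>

context prob_space
begin

lemma ms_norm_const: "ms_norm M (\<lambda>\<omega>. c) = \<bar>c\<bar>"
  by (simp add: ms_norm_def prob_space)

lemma square_integrable_const [simp]: "square_integrable M (\<lambda>\<omega>. c)"
  by (simp add: square_integrable_def)

lemma square_integrable_imp_integrable:
  "square_integrable M X \<Longrightarrow> integrable M X"
  using square_integrable_mult_integrable[of M X "\<lambda>_. 1"] by simp

text \<open>This is the nonnegativity of the variance of \<open>\<bar>X\<bar>\<close>.\<close>

lemma expectation_abs_le_ms_norm:
  assumes "square_integrable M X"
  shows "expectation (\<lambda>\<omega>. \<bar>X \<omega>\<bar>) \<le> ms_norm M X"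
proof -
  have i: "integrable M (\<lambda>\<omega>. \<bar>X \<omega>\<bar>)"
    using square_integrable_imp_integrable[OF assms] by simp
  have i2: "integrable M (\<lambda>\<omega>. \<bar>X \<omega>\<bar>\<^sup>2)"
    using assms by (simp add: square_integrable_def)
  have "0 \<le> variance (\<lambda>\<omega>. \<bar>X \<omega>\<bar>)" by simp
  also have "\<dots> = expectation (\<lambda>\<omega>. \<bar>X \<omega>\<bar>\<^sup>2) - (expectation (\<lambda>\<omega>. \<bar>X \<omega>\<bar>))\<^sup>2"
    by (rule variance_eq[OF i i2])
  finally have "(expectation (\<lambda>\<omega>. \<bar>X \<omega>\<bar>))\<^sup>2 \<le> (ms_norm M X)\<^sup>2"
    by (simp add: ms_norm_square)
  then show ?thesis by (rule power2_le_imp_le) simp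
qed

text \<open>Geometric decay of the norms makes the sum of the absolute values integrable.\<close>
lemma AE_summable_of_ms_norm:
  assumes X: "\<And>N. square_integrable M (X N)" and le: "\<And>N. ms_norm M (X N) \<le> (1/2) ^ N"
  shows "AE \<omega> in M. summable (\<lambda>N. \<bar>X N \<omega>\<bar>)"
proof -
  have [measurable]: "\<And>N. X N \<in> borel_measurable M" using X by (auto dest: square_integrable_measurable)
  have "(\<integral>\<^sup>+\<omega>. ennreal \<bar>X N \<omega>\<bar> \<partial>M) \<le> ennreal ((1/2) ^ N)" for N
  proof -
    have "(\<integral>\<^sup>+\<omega>. ennreal \<bar>X N \<omega>\<bar> \<partial>M) = ennreal (expectation (\<lambda>\<omega>. \<bar>X N \<omega>\<bar>))"
      using square_integrable_imp_integrable[OF X] by (intro nn_integral_eq_integral) auto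
    also have "\<dots> \<le> ennreal ((1/2) ^ N)"
      using expectation_abs_le_ms_norm[OF X[of N]] le[of N] by (intro ennreal_leI) linarith
    finally show ?thesis .
  qed
  then have "(\<Sum>N. \<integral>\<^sup>+\<omega>. ennreal \<bar>X N \<omega>\<bar> \<partial>M) \<le> (\<Sum>N. ennreal ((1/2) ^ N))"
    by (intro suminf_le) auto
  also have "\<dots> = ennreal (\<Sum>N. (1/2) ^ N)"
    by (intro suminf_ennreal2) auto
  also have "\<dots> < \<infinity>" by simp
  finally have "(\<integral>\<^sup>+\<omega>. (\<Sum>N. ennreal \<bar>X N \<omega>\<bar>) \<partial>M) \<noteq> \<infinity>"
    by (simp add: nn_integral_suminf)
  then have "AE \<omega> in M. (\<Sum>N. ennreal \<bar>X N \<omega>\<bar>) \<noteq> \<infinity>"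
    by (intro nn_integral_PInf_AE) auto
  then show ?thesis
  proof eventually_elim
    case (elim \<omega>)
    then show ?case by (intro summable_suminf_not_top) (auto simp: less_top)
  qed
qed

lemma AE_tendsto_of_ms_norm:
  assumes X: "\<And>N. square_integrable M (X N)" and Y: "square_integrable M Y"
    and le: "\<And>N. ms_dist M (X N) Y \<le> (1/2) ^ N"
  shows "AE \<omega> in M. (\<lambda>N. X N \<omega>) \<longlonglongrightarrow> Y \<omega>"
  using AE_summable_of_ms_norm[of "\<lambda>N \<omega>. X N \<omega> - Y \<omega>", OF square_integrable_diff[OF X Y] le]
proof eventually_elim
  case (elim \<omega>)
  from summable_LIMSEQ_zero[OF elim] have "(\<lambda>N. X N \<omega> - Y \<omega>) \<longlonglongrightarrow> 0"
    by (simp add: tendsto_rabs_zero_iff)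
  then show ?case by (simp add: LIM_zero_iff)
qed

text \<open>Riesz-Fischer with control of measurability: the limit is the pointwise
  \<open>lim\<close> of the sequence, defined everywhere, so it is measurable with respect to
  \<open>G\<close> even if \<open>G\<close> lacks null sets. This is what makes stochastic integrals
  adapted.\<close>

lemma square_integrable_complete:
  assumes G: "subalgebra M G" and XG: "\<And>N. X N \<in> borel_measurable G"
    and X: "\<And>N. square_integrable M (X N)"
    and le: "\<And>N K. N \<le> K \<Longrightarrow> ms_dist M (X N) (X K) \<le> (1/2) ^ N"
  obtains Y where "Y \<in> borel_measurable G" "ms_limit M X Y"
proof
  define Y where "Y \<omega> = lim (\<lambda>N. X N \<omega>)" for \<omega>
  show YG: "Y \<in> borel_measurable G" unfolding Y_def using XG by measurable
  have Ym [measurable]: "Y \<in> borel_measurable M" by (rule measurable_from_subalg[OF G YG])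
  have "AE \<omega> in M. summable (\<lambda>N. \<bar>X N \<omega> - X (Suc N) \<omega>\<bar>)"
    using X le by (intro AE_summable_of_ms_norm square_integrable_diff) auto
  then have lim: "AE \<omega> in M. (\<lambda>N. X N \<omega>) \<longlonglongrightarrow> Y \<omega>"
  proof eventually_elim
    case (elim \<omega>)
    have "summable (\<lambda>N. X (Suc N) \<omega> - X N \<omega>)"
      by (rule summable_rabs_cancel) (use elim in \<open>simp add: abs_minus_commute\<close>)
    then have "convergent (\<lambda>n. \<Sum>N<n. X (Suc N) \<omega> - X N \<omega>)"
      by (simp add: summable_iff_convergent)
    then have "convergent (\<lambda>n. X n \<omega> - X 0 \<omega>)"
      by (simp add: sum_lessThan_telescope[of "\<lambda>n. X n \<omega>"])
    then have "convergent (\<lambda>n. X n \<omega>)"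
      using convergent_add[OF _ convergent_const[of "X 0 \<omega>"]] by fastforce
    then show ?case unfolding Y_def by (simp add: convergent_LIMSEQ_iff)
  qed
  \<comment> \<open>Fatou with \<open>N\<close> fixed and the second index going to infinity
    transfers the Cauchy bound to the limit.\<close>
  have d: "square_integrable M (\<lambda>\<omega>. X N \<omega> - Y \<omega>)" "ms_dist M (X N) Y \<le> (1/2) ^ N" for N
  proof -
    have [measurable]: "X N \<in> borel_measurable M" by (rule square_integrable_measurable[OF X])
    have l: "AE \<omega> in M. (\<lambda>K. X N \<omega> - X (N + K) \<omega>) \<longlonglongrightarrow> X N \<omega> - Y \<omega>"
      using lim
    proof eventually_elim
      case (elim \<omega>)
      have "(\<lambda>K. X (N + K) \<omega>) \<longlonglongrightarrow> Y \<omega>"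
        using LIMSEQ_ignore_initial_segment[OF elim, of N] by (simp add: add.commute)
      then show ?case by (intro tendsto_diff tendsto_const)
    qed
    have a: "square_integrable M (\<lambda>\<omega>. X N \<omega> - X (N + K) \<omega>)" for K
      by (intro square_integrable_diff X)
    have b: "ms_dist M (X N) (X (N + K)) \<le> (1/2) ^ N" for K
      by (intro le) simp
    have m: "(\<lambda>\<omega>. X N \<omega> - Y \<omega>) \<in> borel_measurable M" by simp
    show "square_integrable M (\<lambda>\<omega>. X N \<omega> - Y \<omega>)" "ms_dist M (X N) Y \<le> (1/2) ^ N"
      using ms_norm_Fatou[OF a b m l] by auto
  qed
  have "square_integrable M Y"
    using square_integrable_diff[OF X[of 0] d(1)[of 0]] by simp
  moreover have "(\<lambda>N. ms_dist M (X N) Y) \<longlonglongrightarrow> 0"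
    by (rule tendsto_sandwich[OF _ _ tendsto_const LIMSEQ_power_zero[of "1/2::real"]])
       (use d(2) in auto)
  ultimately show "ms_limit M X Y" using X by (simp add: ms_limit_iff_ms_norm)
qed

end

subsection \<open>Partitions and step approximations\<close>

lemma nat_locate:
  fixes f :: "nat \<Rightarrow> 'b::linorder"
  assumes "f 0 \<le> x" "x < f n"
  shows "\<exists>j<n. f j \<le> x \<and> x < f (Suc j)"
  using assms(2)
proof (induction n)
  case 0
  with assms(1) show ?case by simp
next
  case (Suc n)
  show ?case
  proof (cases "x < f n")
    case True
    with Suc.IH show ?thesis using less_SucI by blast
  next
    case False
    then show ?thesis using Suc.prems by (intro exI[of _ n]) auto
  qed
qed

lemma partition_strict:
  assumes "interval_partition a b n p" "i < j" "j \<le> n"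
  shows "p i < p j"
  using assms(2,3)
proof (induction j)
  case (Suc j)
  have "p j < p (Suc j)" using assms(1) Suc.prems by (auto simp: interval_partition_def)
  then show ?case using Suc by (cases "i = j") (auto intro: less_trans)
qed simp

lemma partition_mono:
  "interval_partition a b n p \<Longrightarrow> i \<le> j \<Longrightarrow> j \<le> n \<Longrightarrow> p i \<le> p j"
  using partition_strict[of a b n p i j] by (cases "i = j") auto

lemma partition_bounds:
  assumes "interval_partition a b n p" "i \<le> n"
  shows "a \<le> p i" "p i \<le> b"
  using partition_mono[OF assms(1), of 0 i] partition_mono[OF assms(1), of i n] assms
  by (auto simp: interval_partition_def)

lemma mesh_nonneg [simp]: "0 \<le> mesh n p"
proof (cases n)
  case (Suc m)
  then have "\<bar>p (Suc 0) - p 0\<bar> \<le> mesh n p"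
    unfolding mesh_def by (auto intro!: Max_ge)
  then show ?thesis by linarith
qed (simp add: mesh_def)

lemma mesh_ge: "j < n \<Longrightarrow> p (Suc j) - p j \<le> mesh n p"
proof -
  assume "j < n"
  then have "\<bar>p (Suc j) - p j\<bar> \<le> mesh n p" unfolding mesh_def by (auto intro!: Max_ge)
  then show ?thesis by linarith
qed

lemma mesh_leI:
  assumes "interval_partition a b n p" "0 \<le> d" "\<And>j. j < n \<Longrightarrow> p (Suc j) - p j \<le> d"
  shows "mesh n p \<le> d"
proof -
  have "\<bar>p (Suc j) - p j\<bar> \<le> d" if "j < n" for j
    using assms(1) assms(3)[OF that] that by (auto simp: interval_partition_def)
  then have *: "\<forall>x\<in>(\<lambda>j. \<bar>p (Suc j) - p j\<bar>) ` {..<n}. x \<le> d" by blast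
  show ?thesis
  proof (cases "n = 0")
    case False
    then have "Max ((\<lambda>j. \<bar>p (Suc j) - p j\<bar>) ` {..<n}) \<le> d"
      using * by (subst Max_le_iff) auto
    with False show ?thesis by (simp add: mesh_def)
  qed (use assms(2) in \<open>simp add: mesh_def\<close>)
qed

lemma partition_exists:
  assumes "a \<le> b" "0 < d"
  shows "\<exists>n p. interval_partition a b n p \<and> mesh n p < d"
proof (cases "a = b")
  case True
  then show ?thesis using assms(2)
    by (intro exI[of _ 0] exI[of _ "\<lambda>_. a"]) (simp add: interval_partition_def mesh_def)
next
  case False
  with assms(1) have ab: "a < b" by simp
  obtain m where m: "(b - a) / d < real m" using reals_Archimedean2 by blast
  have m0: "m > 0" using m ab assms(2) by (cases m) (auto simp: field_simps)
  define p where "p j = a + (b - a) * (real j / real m)" for j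
  have step: "p (Suc j) - p j = (b - a) / m" for j
    using m0 by (simp add: p_def field_simps)
  have part: "interval_partition a b m p"
    using m0 ab step unfolding interval_partition_def
    by (auto simp: p_def intro!: mult_strict_left_mono divide_strict_right_mono)
  have "mesh m p \<le> (b - a) / m"
    using ab step by (intro mesh_leI[OF part]) auto
  also have "\<dots> < d" using m m0 assms(2) by (simp add: field_simps)
  finally show ?thesis using part by blast
qed

lemma partition_sequence_exists:
  assumes "a \<le> b"
  obtains n p where "\<And>N. interval_partition a b (n N) (p N)" "(\<lambda>N. mesh (n N) (p N)) \<longlonglongrightarrow> 0"
proof -
  have "\<exists>n p. interval_partition a b n p \<and> mesh n p < inverse (real (Suc N))" for N
    using partition_exists[OF assms] by simp
  then obtain n p where *: "\<And>N. interval_partition a b (n N) (p N) \<and> mesh (n N) (p N) < inverse (real (Suc N))"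
    by metis
  have "(\<lambda>N. mesh (n N) (p N)) \<longlonglongrightarrow> 0"
    by (rule tendsto_sandwich[OF _ _ tendsto_const LIMSEQ_inverse_real_of_nat])
       (use * in \<open>auto intro!: always_eventually less_imp_le\<close>)
  with * that show thesis by blast
qed

lemma partition_take:
  "interval_partition a b n p \<Longrightarrow> i \<le> n \<Longrightarrow> interval_partition a (p i) i p"
  by (auto simp: interval_partition_def)

lemma partition_drop:
  "interval_partition a b n p \<Longrightarrow> i \<le> n \<Longrightarrow> interval_partition (p i) b (n - i) (\<lambda>j. p (i + j))"
  by (auto simp: interval_partition_def)

lemma mesh_take:
  assumes "interval_partition a b n p" "i \<le> n" shows "mesh i p \<le> mesh n p"
  by (rule mesh_leI[OF partition_take[OF assms]]) (use assms in \<open>auto intro: mesh_ge\<close>)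

lemma mesh_drop:
  assumes "interval_partition a b n p" "i \<le> n" shows "mesh (n - i) (\<lambda>j. p (i + j)) \<le> mesh n p"
  by (rule mesh_leI[OF partition_drop[OF assms]]) (use assms mesh_ge[of "i + _" n p] in auto)

text \<open>The index map \<open>c\<close> is kept explicit, because sums over \<open>r\<close> are
  split into the blocks \<open>{c j..<c (Suc j)}\<close> that lie in the single intervals of
  \<open>p\<close>.\<close>

definition refinement ::
  "nat \<Rightarrow> (nat \<Rightarrow> real) \<Rightarrow> nat \<Rightarrow> (nat \<Rightarrow> real) \<Rightarrow> (nat \<Rightarrow> nat) \<Rightarrow> bool" where
  "refinement n p l r c \<longleftrightarrow>
     c 0 = 0 \<and> c n = l \<and> (\<forall>j<n. c j < c (Suc j)) \<and> (\<forall>j\<le>n. r (c j) = p j)"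

lemma refinement_mono:
  assumes "refinement n p l r c" "i \<le> j" "j \<le> n" shows "c i \<le> c j"
  using assms(2,3)
proof (induction j)
  case (Suc j)
  have "c j < c (Suc j)" using assms(1) Suc.prems by (auto simp: refinement_def)
  then show ?case using Suc by (cases "i = Suc j") auto
qed simp

lemma refinement_le:
  assumes "refinement n p l r c" "j \<le> n" shows "c j \<le> l"
  using refinement_mono[OF assms(1) assms(2)] assms(1) by (auto simp: refinement_def)

lemma refinement_locate:
  assumes "refinement n p l r c" "i < l"
  shows "\<exists>j<n. c j \<le> i \<and> i < c (Suc j)"
  using nat_locate[of c i n] assms by (auto simp: refinement_def)

lemma refinement_mesh:
  assumes p: "interval_partition a b n p" and r: "interval_partition a b l r"
    and ref: "refinement n p l r c"
  shows "mesh l r \<le> mesh n p"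
proof (rule mesh_leI[OF r])
  fix i assume "i < l"
  then obtain j where j: "j < n" "c j \<le> i" "i < c (Suc j)"
    using refinement_locate[OF ref] by blast
  have "c (Suc j) \<le> l" using refinement_le[OF ref] j(1) by auto
  then have "r (c j) \<le> r i" "r (Suc i) \<le> r (c (Suc j))"
    using j by (auto intro: partition_mono[OF r])
  moreover have "r (c j) = p j" "r (c (Suc j)) = p (Suc j)"
    using ref j(1) by (auto simp: refinement_def)
  ultimately show "r (Suc i) - r i \<le> mesh n p" using mesh_ge[OF j(1), of p] by linarith
qed simp

text \<open>The increasing enumeration of \<open>A\<close> is the partition; \<open>card A\<close>
  nodes bound one interval fewer. Since \<open>r\<close> depends on \<open>A\<close> only, two
  partitions whose nodes lie in the same \<open>A\<close> obtain the same refinement.\<close>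

lemma refinement_of_finite_set:
  assumes p: "interval_partition a b n p"
    and A: "finite A" "A \<subseteq> {a..b}" "p ` {..n} \<subseteq> A"
  shows "interval_partition a b (card A - 1) ((!) (sorted_list_of_set A)) \<and>
    (\<exists>c. refinement n p (card A - 1) ((!) (sorted_list_of_set A)) c)"
proof -
  define xs where "xs = sorted_list_of_set A"
  have xs: "set xs = A" "sorted_wrt (<) xs" "length xs = card A"
    using A(1) by (auto simp: xs_def)
  have lt: "xs ! i < xs ! j" if "i < j" "j < length xs" for i j
    using xs(2) that by (simp add: sorted_wrt_iff_nth_less)
  have aA: "a \<in> A" and bA: "b \<in> A" using A(3) p by (auto simp: interval_partition_def)
  then have pos: "0 < length xs" using A(1) by (auto simp: xs(3) card_gt_0_iff)
  have inA: "xs ! i \<in> A" if "i < length xs" for i using that xs(1) nth_mem by blast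
  have idx: "\<exists>i<length xs. xs ! i = x" if "x \<in> A" for x
    using that xs(1) by (auto simp: in_set_conv_nth)
  have r0: "xs ! 0 = a"
  proof -
    obtain i where i: "i < length xs" "xs ! i = a" using idx[OF aA] by blast
    have "a \<le> xs ! 0" using inA[OF pos] A(2) by auto
    with lt[of 0 i] i show ?thesis by (cases "i = 0") auto
  qed
  have rl: "xs ! (card A - 1) = b"
  proof -
    obtain i where i: "i < length xs" "xs ! i = b" using idx[OF bA] by blast
    have l: "card A - 1 < length xs" using pos by (simp add: xs(3))
    have "xs ! (card A - 1) \<le> b" using inA[OF l] A(2) by auto
    moreover have "i = card A - 1 \<or> i < card A - 1" using i(1) by (auto simp: xs(3))
    ultimately show ?thesis using lt[of i "card A - 1"] i l by auto
  qed
  have part: "interval_partition a b (card A - 1) ((!) xs)"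
    using r0 rl lt by (auto simp: interval_partition_def xs(3))
  have "\<exists>c. \<forall>j\<le>n. c j < length xs \<and> xs ! c j = p j"
    using idx A(3) by (intro choice) (metis atMost_iff image_subset_iff)
  then obtain c where c: "\<And>j. j \<le> n \<Longrightarrow> c j < length xs" "\<And>j. j \<le> n \<Longrightarrow> xs ! c j = p j"
    by blast
  have inj: "i = j" if "xs ! i = xs ! j" "i < length xs" "j < length xs" for i j
    using that lt by (metis less_irrefl linorder_neqE_nat)
  have "refinement n p (card A - 1) ((!) xs) c"
    unfolding refinement_def
  proof (intro conjI allI impI)
    show "c 0 = 0" using c[of 0] p r0 pos by (intro inj) (auto simp: interval_partition_def)
    show "c n = card A - 1"
      using c[of n] p rl pos by (intro inj) (auto simp: interval_partition_def xs(3))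
    fix j assume "j < n"
    then have "xs ! c j < xs ! c (Suc j)" using c p by (auto simp: interval_partition_def)
    then show "c j < c (Suc j)"
      using lt[of "c (Suc j)" "c j"] c(1)[of j] \<open>j < n\<close> by (metis less_imp_le less_asym less_irrefl linorder_neqE_nat)
  qed (use c in auto)
  with part show ?thesis unfolding xs_def by blast
qed

lemma common_refinement:
  assumes p: "interval_partition a b n p" and q: "interval_partition a b m q"
  obtains l r c e where "interval_partition a b l r" "refinement n p l r c" "refinement m q l r e"
proof -
  have "p ` {..n} \<subseteq> {a..b}" "q ` {..m} \<subseteq> {a..b}"
    using partition_bounds[OF p] partition_bounds[OF q] by auto
  then have A: "finite (p ` {..n} \<union> q ` {..m})" "p ` {..n} \<union> q ` {..m} \<subseteq> {a..b}"
    "p ` {..n} \<subseteq> p ` {..n} \<union> q ` {..m}" "q ` {..m} \<subseteq> p ` {..n} \<union> q ` {..m}" by auto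
  from refinement_of_finite_set[OF p A(1,2,3)] refinement_of_finite_set[OF q A(1,2,4)] that
  show thesis by blast
qed

lemma fine_refinement_exists:
  assumes p: "interval_partition a b n p" and "a \<le> b" "0 < d"
  obtains l r c where "interval_partition a b l r" "refinement n p l r c" "mesh l r < d"
proof -
  obtain m q where q: "interval_partition a b m q" "mesh m q < d"
    using partition_exists[OF assms(2,3)] by blast
  obtain l r c e where *: "interval_partition a b l r" "refinement n p l r c" "refinement m q l r e"
    using common_refinement[OF p q(1)] by blast
  from refinement_mesh[OF q(1) *(1,3)] q(2) have "mesh l r < d" by linarith
  with * that show thesis by blast
qed

text \<open>The number \<open>m\<close> of summands is independent of the length of the partition:
  the partial sums up to an arbitrary node are the discrete counterparts of integrals with variable
  upper limit.\<close>

definition isum ::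
  "(real \<Rightarrow> 'a \<Rightarrow> real) \<Rightarrow> (nat \<Rightarrow> real) \<Rightarrow> (nat \<Rightarrow> 'a \<Rightarrow> real) \<Rightarrow> nat \<Rightarrow> 'a \<Rightarrow> real" where
  "isum w q Z m \<omega> = (\<Sum>i<m. Z i \<omega> * (w (q (Suc i)) \<omega> - w (q i) \<omega>))"

lemma sum_refinement:
  fixes g :: "nat \<Rightarrow> real"
  assumes "refinement n p l r c" "m \<le> n"
  shows "(\<Sum>i<c m. g i) = (\<Sum>j<m. \<Sum>i\<in>{c j..<c (Suc j)}. g i)"
  using assms(2)
proof (induction m)
  case 0
  then show ?case using assms(1) by (simp add: refinement_def)
next
  case (Suc m)
  have "c m \<le> c (Suc m)" using refinement_mono[OF assms(1), of m "Suc m"] Suc.prems by simp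
  then have "{..<c (Suc m)} = {..<c m} \<union> {c m..<c (Suc m)}" by auto
  then have "(\<Sum>i<c (Suc m). g i) = (\<Sum>i<c m. g i) + (\<Sum>i\<in>{c m..<c (Suc m)}. g i)"
    by (simp add: sum.union_disjoint ivl_disj_int)
  then show ?case using Suc by simp
qed

text \<open>On each block the factor is constant and the increments telescope.\<close>

lemma isum_refinement:
  assumes ref: "refinement n p l r c" and m: "m \<le> n"
    and eq: "\<And>j i. j < m \<Longrightarrow> c j \<le> i \<Longrightarrow> i < c (Suc j) \<Longrightarrow> Z i \<omega> = W j \<omega>"
  shows "isum w r Z (c m) \<omega> = isum w p W m \<omega>"
proof -
  have "isum w r Z (c m) \<omega> =
      (\<Sum>j<m. \<Sum>i\<in>{c j..<c (Suc j)}. Z i \<omega> * (w (r (Suc i)) \<omega> - w (r i) \<omega>))"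
    unfolding isum_def by (rule sum_refinement[OF ref m])
  also have "\<dots> = (\<Sum>j<m. W j \<omega> * (w (p (Suc j)) \<omega> - w (p j) \<omega>))"
  proof (rule sum.cong[OF refl])
    fix j assume j: "j \<in> {..<m}"
    have "(\<Sum>i\<in>{c j..<c (Suc j)}. Z i \<omega> * (w (r (Suc i)) \<omega> - w (r i) \<omega>)) =
        W j \<omega> * (\<Sum>i\<in>{c j..<c (Suc j)}. w (r (Suc i)) \<omega> - w (r i) \<omega>)"
      unfolding sum_distrib_left using j eq by (intro sum.cong) auto
    also have "(\<Sum>i\<in>{c j..<c (Suc j)}. w (r (Suc i)) \<omega> - w (r i) \<omega>) = w (r (c (Suc j))) \<omega> - w (r (c j)) \<omega>"
      using refinement_mono[OF ref, of j "Suc j"] j m by (intro sum_Suc_diff') auto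
    also have "\<dots> = w (p (Suc j)) \<omega> - w (p j) \<omega>"
      using ref j m by (auto simp: refinement_def)
    finally show "(\<Sum>i\<in>{c j..<c (Suc j)}. Z i \<omega> * (w (r (Suc i)) \<omega> - w (r i) \<omega>)) =
      W j \<omega> * (w (p (Suc j)) \<omega> - w (p j) \<omega>)" .
  qed
  finally show ?thesis by (simp add: isum_def)
qed

section \<open>Step functions and step approximations\<close>

lemma sum_indicator_partition:
  fixes h :: "nat \<Rightarrow> real"
  assumes p: "interval_partition a b n p" and j: "j < n" "p j \<le> x" "x < p (Suc j)"
  shows "(\<Sum>i<n. h i * indicator {p i..<p (Suc i)} x) = h j"
proof -
  have "indicator {p i..<p (Suc i)} x = (if i = j then 1 else 0::real)" if "i < n" for i
  proof -
    consider "i < j" | "i = j" | "j < i" by linarith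
    then show ?thesis
    proof cases
      case 1
      then have "p (Suc i) \<le> p j" using j by (intro partition_mono[OF p]) auto
      then show ?thesis using 1 j by auto
    next
      case 3
      then have "p (Suc j) \<le> p i" using that by (intro partition_mono[OF p]) auto
      then show ?thesis using 3 j by auto
    qed (use j in auto)
  qed
  then have "(\<Sum>i<n. h i * indicator {p i..<p (Suc i)} x) = (\<Sum>i<n. if i = j then h i else 0)"
    by (intro sum.cong) auto
  then show ?thesis using j(1) by simp
qed

lemma sum_indicator_partition_outside:
  fixes h :: "nat \<Rightarrow> real"
  assumes p: "interval_partition a b n p" and x: "x < a \<or> b \<le> x"
  shows "(\<Sum>i<n. h i * indicator {p i..<p (Suc i)} x) = 0"
proof (rule sum.neutral, rule ballI)
  fix i assume "i \<in> {..<n}"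
  then have "a \<le> p i" "p (Suc i) \<le> b"
    using partition_bounds[OF p, of i] partition_bounds[OF p, of "Suc i"] by auto
  with x show "h i * indicator {p i..<p (Suc i)} x = 0" by (auto simp: indicator_def)
qed

lemma partition_locate:
  assumes "interval_partition a b n p" "a \<le> x" "x < b"
  shows "\<exists>j<n. p j \<le> x \<and> x < p (Suc j)"
  using nat_locate[of p x n] assms by (auto simp: interval_partition_def)

lemma step_function_integral:
  assumes p: "interval_partition a b n p" and ab: "a \<le> b"
    and g: "\<And>j x. j < n \<Longrightarrow> p j \<le> x \<Longrightarrow> x < p (Suc j) \<Longrightarrow> g x = g (p j)"
  shows "set_integrable lborel {a..b} g"
    and "(LINT x:{a..b}|lborel. g x) = (\<Sum>j<n. g (p j) * (p (Suc j) - p j))"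
proof -
  \<comment> \<open>Constancy is assumed on half-open intervals only, so the value at
    \<open>b\<close> is arbitrary; it becomes a separate term supported on a null set.\<close>
  have eq: "indicator {a..b} x *\<^sub>R g x =
      (\<Sum>i<n. g (p i) * indicator {p i..<p (Suc i)} x) + g b * indicator {b} x" for x
  proof -
    consider "x < a \<or> b < x" | "x = b" | "a \<le> x" "x < b" using ab by linarith
    then show ?thesis
    proof cases
      case 1
      then show ?thesis
        using ab by (subst sum_indicator_partition_outside[OF p]) (auto simp: indicator_def)
    next
      case 2
      then show ?thesis
        using ab by (subst sum_indicator_partition_outside[OF p]) auto
    next
      case 3
      then obtain j where j: "j < n" "p j \<le> x" "x < p (Suc j)"
        using partition_locate[OF p] by blast
      then show ?thesis
        using 3 g[OF j] by (subst sum_indicator_partition[OF p j]) (auto simp: indicator_def)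
    qed
  qed
  have i1: "integrable lborel (\<lambda>x. g (p i) * indicator {p i..<p (Suc i)} x)" for i
    by (intro integrable_mult_right integrable_real_indicator)
       (cases "p i \<le> p (Suc i)"; simp)+
  have i2: "integrable lborel (\<lambda>x. g b * indicator {b} x)"
    by (intro integrable_mult_right integrable_real_indicator) auto
  show "set_integrable lborel {a..b} g"
    unfolding set_integrable_def eq
    by (intro Bochner_Integration.integrable_add Bochner_Integration.integrable_sum i1 i2)
  have le: "p i \<le> p (Suc i)" if "i < n" for i using partition_mono[OF p] that by auto
  have "(LINT x:{a..b}|lborel. g x) =
      (\<integral>x. (\<Sum>i<n. g (p i) * indicator {p i..<p (Suc i)} x) \<partial>lborel) + (\<integral>x. g b * indicator {b} x \<partial>lborel)"
    unfolding set_lebesgue_integral_def eq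
    by (intro Bochner_Integration.integral_add Bochner_Integration.integrable_sum i1 i2)
  also have "(\<integral>x. g b * indicator {b} x \<partial>lborel) = 0" by simp
  also have "(\<integral>x. (\<Sum>i<n. g (p i) * indicator {p i..<p (Suc i)} x) \<partial>lborel) =
      (\<Sum>i<n. \<integral>x. g (p i) * indicator {p i..<p (Suc i)} x \<partial>lborel)"
    by (intro Bochner_Integration.integral_sum i1)
  also have "\<dots> = (\<Sum>i<n. g (p i) * (p (Suc i) - p i))"
    by (intro sum.cong) (auto simp: le)
  finally show "(LINT x:{a..b}|lborel. g x) = (\<Sum>j<n. g (p j) * (p (Suc j) - p j))" by simp
qed

text \<open>The last summand supplies the value at the right endpoint, where all half-open indicators vanish.\<close>
definition step_approx ::
  "nat \<Rightarrow> (nat \<Rightarrow> real) \<Rightarrow> (real \<Rightarrow> 'a \<Rightarrow> real) \<Rightarrow> real \<Rightarrow> 'a \<Rightarrow> real" where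
  "step_approx n p \<xi> \<tau> \<omega> =
     (\<Sum>i<n. \<xi> (p i) \<omega> * indicator {p i..<p (Suc i)} \<tau>) + \<xi> (p n) \<omega> * indicator {p n} \<tau>"

lemma step_approx_eq:
  assumes p: "interval_partition a b n p" and j: "j < n" "p j \<le> \<tau>" "\<tau> < p (Suc j)"
  shows "step_approx n p \<xi> \<tau> = \<xi> (p j)"
proof -
  have "p (Suc j) \<le> p n" using j by (intro partition_mono[OF p]) auto
  then show ?thesis
    using sum_indicator_partition[OF p j] j by (auto simp: step_approx_def fun_eq_iff)
qed

lemma step_approx_eq_end:
  assumes p: "interval_partition a b n p"
  shows "step_approx n p \<xi> b = \<xi> b"
proof -
  have "p n = b" using p by (simp add: interval_partition_def)
  then show ?thesis
    using sum_indicator_partition_outside[OF p, of b] by (auto simp: step_approx_def fun_eq_iff)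
qed

text \<open>Everything needed about the approximation is that its value is the process at some time
  \<open>u\<close> close to \<tau>: \<open>u \<le> \<tau>\<close> preserves adaptedness, and the
  mesh bound gives the approximation error.\<close>

lemma step_approx_point:
  assumes p: "interval_partition a b n p" and \<tau>: "\<tau> \<in> {a..b}"
  obtains u where "u \<in> {a..b}" "u \<le> \<tau>" "\<tau> - u \<le> mesh n p" "step_approx n p \<xi> \<tau> = \<xi> u"
proof (cases "\<tau> = b")
  case True
  with \<tau> step_approx_eq_end[OF p] show ?thesis by (intro that[of b]) auto
next
  case False
  then obtain j where j: "j < n" "p j \<le> \<tau>" "\<tau> < p (Suc j)"
    using partition_locate[OF p, of \<tau>] \<tau> by auto
  show ?thesis
    using step_approx_eq[OF p j] j mesh_ge[OF j(1), of p] partition_bounds[OF p, of j]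
    by (intro that[of "p j"]) auto
qed

lemma step_process_step_approx:
  assumes p: "interval_partition a b n p"
  shows "step_process M n p (step_approx n p \<xi>)"
  unfolding step_process_def
proof (intro allI impI ballI)
  fix j \<tau> \<omega> assume j: "j < n" "\<tau> \<in> {p j..<p (Suc j)}"
  then have "p j < p (Suc j)" by auto
  with j step_approx_eq[OF p, of j \<tau> \<xi>] step_approx_eq[OF p, of j "p j" \<xi>]
  show "step_approx n p \<xi> \<tau> \<omega> = step_approx n p \<xi> (p j) \<omega>" by auto
qed

subsection \<open>Sums against the Wiener process and against time\<close>

locale wiener_space = prob_space M for M :: "'a measure" +
  fixes F :: "real \<Rightarrow> 'a measure" and f :: "real \<Rightarrow> 'a \<Rightarrow> real" and t T :: real
  assumes wiener: "standard_wiener M T f"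
    and filtration: "wiener_filtration M T F f"
    and t_nonneg: "0 \<le> t" and t_le_T: "t \<le> T"
begin

definition adapted_L2 :: "real \<Rightarrow> ('a \<Rightarrow> real) \<Rightarrow> bool" where
  "adapted_L2 s X \<longleftrightarrow> X \<in> borel_measurable (F s) \<and> square_integrable M X"

definition integrator :: "(real \<Rightarrow> 'a \<Rightarrow> real) \<Rightarrow> bool" where
  "integrator w \<longleftrightarrow> (\<forall>\<tau>\<in>{t..T}. \<forall>\<omega>\<in>space M. w \<tau> \<omega> = f \<tau> \<omega>) \<or> (\<forall>\<tau>\<in>{t..T}. \<forall>\<omega>\<in>space M. w \<tau> \<omega> = \<tau>)"

section \<open>Filtration, increments and adapted variables\<close>

lemma F_subalgebra: "t \<le> s \<Longrightarrow> s \<le> T \<Longrightarrow> subalgebra M (F s)"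
  using filtration t_nonneg by (auto simp: wiener_filtration_def)

lemma space_F: "t \<le> s \<Longrightarrow> s \<le> T \<Longrightarrow> space (F s) = space M"
  using F_subalgebra by (auto simp: subalgebra_def)

lemma F_measurable_M: "t \<le> s \<Longrightarrow> s \<le> T \<Longrightarrow> X \<in> borel_measurable (F s) \<Longrightarrow> X \<in> borel_measurable M"
  using F_subalgebra measurable_from_subalg by blast

lemma sets_F_mono:
  assumes "t \<le> s" "s \<le> u" "u \<le> T"
  shows "sets (F s) \<subseteq> sets (F u)"
proof (cases "s = u")
  case False
  then have "0 \<le> s \<and> s < u \<and> u \<le> T" using assms t_nonneg by auto
  then show ?thesis using filtration unfolding wiener_filtration_def by blast
qed simp

lemma F_measurable_mono:
  assumes "t \<le> s" "s \<le> u" "u \<le> T" "X \<in> borel_measurable (F s)"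
  shows "X \<in> borel_measurable (F u)"
proof (rule measurable_from_subalg[OF _ assms(4)])
  show "subalgebra (F u) (F s)"
    using sets_F_mono[OF assms(1-3)] space_F[of s] space_F[of u] assms by (auto simp: subalgebra_def)
qed

lemma f_measurable: "t \<le> s \<Longrightarrow> s \<le> T \<Longrightarrow> f s \<in> borel_measurable (F s)"
  using filtration t_nonneg by (auto simp: wiener_filtration_def)

text \<open>The increment is independent of \<open>F u\<close>, and \<open>X\<close> is also
  measurable with respect to \<open>F u\<close> because \<open>s \<le> u\<close>. The proof
  translates this from \<sigma>-algebras to random variables.\<close>

lemma indep_increment:
  assumes s: "t \<le> s" "s \<le> u" "u < v" "v \<le> T" and X: "X \<in> borel_measurable (F s)"
  shows "indep_var borel X borel (\<lambda>\<omega>. f v \<omega> - f u \<omega>)"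
proof -
  have "0 \<le> u \<and> 0 < v - u \<and> u + (v - u) \<le> T" using s t_nonneg by auto
  then have "indep_set (sets (F u)) (sets (vimage_algebra (space M) (\<lambda>\<omega>. f (u + (v - u)) \<omega> - f u \<omega>) borel))"
    using filtration unfolding wiener_filtration_def by blast
  then have ind: "indep_set (sets (F u))
      (sigma_sets (space M) {(\<lambda>\<omega>. f v \<omega> - f u \<omega>) -` A \<inter> space M | A. A \<in> sets borel})"
    by (simp add: sets_vimage_algebra)
  have Xu: "X \<in> borel_measurable (F u)" using F_measurable_mono[OF _ _ _ X] s by auto
  have "{X -` A \<inter> space M | A. A \<in> sets borel} \<subseteq> sets (F u)"
    using measurable_sets[OF Xu] space_F[of u] s by auto
  then have sub: "sigma_sets (space M) {X -` A \<inter> space M | A. A \<in> sets borel} \<subseteq> sets (F u)"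
    using sets.sigma_sets_subset[of _ "F u"] space_F[of u] s by auto
  have "X \<in> borel_measurable M" using F_measurable_M[OF _ _ X] s by auto
  moreover have "(\<lambda>\<omega>. f v \<omega> - f u \<omega>) \<in> borel_measurable M"
    using F_measurable_M[OF _ _ f_measurable[of u]] F_measurable_M[OF _ _ f_measurable[of v]] s by auto
  moreover have "indep_set (sigma_sets (space M) {X -` A \<inter> space M | A. A \<in> sets borel})
      (sigma_sets (space M) {(\<lambda>\<omega>. f v \<omega> - f u \<omega>) -` A \<inter> space M | A. A \<in> sets borel})"
    unfolding indep_set_def
    by (rule indep_sets_mono_sets[OF ind[unfolded indep_set_def]]) (use sub in \<open>auto split: bool.split\<close>)
  ultimately show ?thesis unfolding indep_var_eq by blast
qed

lemma increment_moments:
  assumes "t \<le> s" "s < u" "u \<le> T"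
  shows "integrable M (\<lambda>\<omega>. f u \<omega> - f s \<omega>)" "integrable M (\<lambda>\<omega>. (f u \<omega> - f s \<omega>)\<^sup>2)"
    "expectation (\<lambda>\<omega>. f u \<omega> - f s \<omega>) = 0" "expectation (\<lambda>\<omega>. (f u \<omega> - f s \<omega>)\<^sup>2) = u - s"
proof -
  define \<sigma> where "\<sigma> = sqrt (u - s)"
  have \<sigma>: "0 < \<sigma>" using assms by (simp add: \<sigma>_def)
  have D: "distributed M lborel (\<lambda>\<omega>. f u \<omega> - f s \<omega>) (\<lambda>x. ennreal (normal_density 0 \<sigma> x))"
    using wiener assms t_nonneg unfolding standard_wiener_def \<sigma>_def by auto
  show e: "expectation (\<lambda>\<omega>. f u \<omega> - f s \<omega>) = 0"
    by (rule normal_distributed_expectation[OF \<sigma> D])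
  have "variance (\<lambda>\<omega>. f u \<omega> - f s \<omega>) = \<sigma>\<^sup>2"
    by (rule normal_distributed_variance[OF \<sigma> D])
  then show "expectation (\<lambda>\<omega>. (f u \<omega> - f s \<omega>)\<^sup>2) = u - s"
    using assms by (simp add: e \<sigma>_def)
  have "integrable M (\<lambda>\<omega>. (f u \<omega> - f s \<omega>) ^ k)" for k :: nat
    using distributed_integrable[OF D, of "\<lambda>x. x ^ k"] integrable_normal_moment[OF \<sigma>, of 0 k]
    by (simp add: normal_density_nonneg)
  from this[of 1] this[of 2]
  show "integrable M (\<lambda>\<omega>. f u \<omega> - f s \<omega>)" "integrable M (\<lambda>\<omega>. (f u \<omega> - f s \<omega>)\<^sup>2)" by simp_all
qed

lemma adapted_L2_sq: "adapted_L2 s X \<Longrightarrow> square_integrable M X"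
  by (simp add: adapted_L2_def)

lemma adapted_L2_meas: "adapted_L2 s X \<Longrightarrow> X \<in> borel_measurable (F s)"
  by (simp add: adapted_L2_def)

lemma adapted_L2_mono: "adapted_L2 s X \<Longrightarrow> t \<le> s \<Longrightarrow> s \<le> u \<Longrightarrow> u \<le> T \<Longrightarrow> adapted_L2 u X"
  using F_measurable_mono by (auto simp: adapted_L2_def)

lemma adapted_L2_0 [simp]: "adapted_L2 s (\<lambda>\<omega>. 0)"
  by (simp add: adapted_L2_def)

lemma adapted_L2_const [simp]: "adapted_L2 s (\<lambda>\<omega>. c)"
  by (simp add: adapted_L2_def)

lemma adapted_L2_add: "adapted_L2 s X \<Longrightarrow> adapted_L2 s Y \<Longrightarrow> adapted_L2 s (\<lambda>\<omega>. X \<omega> + Y \<omega>)"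
  by (auto simp: adapted_L2_def square_integrable_add)

lemma adapted_L2_diff: "adapted_L2 s X \<Longrightarrow> adapted_L2 s Y \<Longrightarrow> adapted_L2 s (\<lambda>\<omega>. X \<omega> - Y \<omega>)"
  by (auto simp: adapted_L2_def square_integrable_diff)

lemma adapted_L2_cmult: "adapted_L2 s X \<Longrightarrow> adapted_L2 s (\<lambda>\<omega>. c * X \<omega>)"
  by (auto simp: adapted_L2_def square_integrable_cmult)

lemma adapted_L2_sum: "(\<And>i. i \<in> I \<Longrightarrow> adapted_L2 s (X i)) \<Longrightarrow> adapted_L2 s (\<lambda>\<omega>. \<Sum>i\<in>I. X i \<omega>)"
  by (auto simp: adapted_L2_def intro!: square_integrable_sum borel_measurable_sum)

lemma adapted_L2_cong:
  assumes "t \<le> s" "s \<le> T" "\<And>\<omega>. \<omega> \<in> space M \<Longrightarrow> X \<omega> = Y \<omega>"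
  shows "adapted_L2 s X \<longleftrightarrow> adapted_L2 s Y"
  unfolding adapted_L2_def
  using square_integrable_cong[of M X Y] measurable_cong[of "F s" X Y borel] assms space_F[of s] by auto

text \<open>One step of the Ito isometry. \<open>Z\<close> is independent of the increment, hence so
  are the squares, and independence supplies both the integrability and the factorization of the
  product. For orthogonality \<open>S * Z\<close> is measurable with respect to \<open>F s\<close>
  and integrable, and the increment has mean zero.\<close>

lemma adapted_L2_mult_increment:
  assumes s: "t \<le> s" "s < u" "u \<le> T" and Z: "adapted_L2 s Z"
  shows "adapted_L2 u (\<lambda>\<omega>. Z \<omega> * (f u \<omega> - f s \<omega>))"
    and "(ms_norm M (\<lambda>\<omega>. Z \<omega> * (f u \<omega> - f s \<omega>)))\<^sup>2 = (ms_norm M Z)\<^sup>2 * (u - s)"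
    and "adapted_L2 s S \<Longrightarrow> expectation (\<lambda>\<omega>. S \<omega> * (Z \<omega> * (f u \<omega> - f s \<omega>))) = 0"
proof -
  note mom = increment_moments[OF s]
  have "indep_var borel Z borel (\<lambda>\<omega>. f u \<omega> - f s \<omega>)"
    by (rule indep_increment[OF s(1) order_refl s(2,3) adapted_L2_meas[OF Z]])
  then have "indep_var borel ((\<lambda>x. x\<^sup>2) \<circ> Z) borel ((\<lambda>x. x\<^sup>2) \<circ> (\<lambda>\<omega>. f u \<omega> - f s \<omega>))"
    by (rule indep_var_compose) simp_all
  then have ind: "indep_var borel (\<lambda>\<omega>. (Z \<omega>)\<^sup>2) borel (\<lambda>\<omega>. (f u \<omega> - f s \<omega>)\<^sup>2)"
    by (simp add: comp_def)
  have Z2: "integrable M (\<lambda>\<omega>. (Z \<omega>)\<^sup>2)"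
    using adapted_L2_sq[OF Z] by (rule square_integrable_integrable_square)
  note pr = indep_var_integrable[OF ind Z2 mom(2)] indep_var_lebesgue_integral[OF ind Z2 mom(2)]
  have meas: "(\<lambda>\<omega>. Z \<omega> * (f u \<omega> - f s \<omega>)) \<in> borel_measurable (F u)"
    using F_measurable_mono[of s u Z] F_measurable_mono[of s u "f s"] f_measurable[of s] f_measurable[of u]
      adapted_L2_meas[OF Z] s by (intro borel_measurable_times borel_measurable_diff) auto
  have "(\<lambda>\<omega>. Z \<omega> * (f u \<omega> - f s \<omega>)) \<in> borel_measurable M"
    using F_measurable_M[OF _ s(3) meas] s by auto
  then have sq: "square_integrable M (\<lambda>\<omega>. Z \<omega> * (f u \<omega> - f s \<omega>))"
    using pr(1) by (simp add: square_integrable_def power_mult_distrib)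
  show "adapted_L2 u (\<lambda>\<omega>. Z \<omega> * (f u \<omega> - f s \<omega>))" using meas sq by (simp add: adapted_L2_def)
  show "(ms_norm M (\<lambda>\<omega>. Z \<omega> * (f u \<omega> - f s \<omega>)))\<^sup>2 = (ms_norm M Z)\<^sup>2 * (u - s)"
    unfolding ms_norm_square power_mult_distrib pr(2) mom(4) ..
  assume S: "adapted_L2 s S"
  have ind2: "indep_var borel (\<lambda>\<omega>. S \<omega> * Z \<omega>) borel (\<lambda>\<omega>. f u \<omega> - f s \<omega>)"
    by (intro indep_increment[OF s(1) order_refl s(2,3)] borel_measurable_times adapted_L2_meas[OF S] adapted_L2_meas[OF Z])
  have "integrable M (\<lambda>\<omega>. S \<omega> * Z \<omega>)"
    by (intro square_integrable_mult_integrable adapted_L2_sq[OF S] adapted_L2_sq[OF Z])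
  from indep_var_lebesgue_integral[OF ind2 this mom(1)] mom(3)
  show "expectation (\<lambda>\<omega>. S \<omega> * (Z \<omega> * (f u \<omega> - f s \<omega>))) = 0" by (simp add: mult.assoc)
qed

section \<open>Mean-square bounds for sums over a partition\<close>

lemma isum_Suc: "isum w q Z (Suc m) \<omega> = isum w q Z m \<omega> + Z m \<omega> * (w (q (Suc m)) \<omega> - w (q m) \<omega>)"
  by (simp add: isum_def)

text \<open>The Ito isometry for sums. In the induction the sum up to \<open>m\<close> is adapted at
  \<open>p m\<close>, so it is orthogonal to the next summand and the squared norms add up.\<close>

lemma isum_wiener:
  assumes p: "interval_partition a b n p" and ab: "t \<le> a" "b \<le> T" and m: "m \<le> n"
    and Z: "\<And>j. j < n \<Longrightarrow> adapted_L2 (p j) (Z j)"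
  shows "adapted_L2 (p m) (isum f p Z m)"
    and "(ms_norm M (isum f p Z m))\<^sup>2 = (\<Sum>j<m. (ms_norm M (Z j))\<^sup>2 * (p (Suc j) - p j))"
proof -
  have "adapted_L2 (p m) (isum f p Z m) \<and>
    (ms_norm M (isum f p Z m))\<^sup>2 = (\<Sum>j<m. (ms_norm M (Z j))\<^sup>2 * (p (Suc j) - p j))"
    using m
  proof (induction m)
    case 0
    have "isum f p Z 0 = (\<lambda>\<omega>. 0)" by (auto simp: isum_def)
    then show ?case by simp
  next
    case (Suc m)
    have pm: "t \<le> p m" "p m < p (Suc m)" "p (Suc m) \<le> T"
      using partition_bounds[OF p, of m] partition_bounds[OF p, of "Suc m"] ab Suc.prems
        partition_strict[OF p, of m "Suc m"] by auto
    define S where "S = isum f p Z m"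
    define V where "V \<omega> = Z m \<omega> * (f (p (Suc m)) \<omega> - f (p m) \<omega>)" for \<omega>
    have S: "adapted_L2 (p m) S" "(ms_norm M S)\<^sup>2 = (\<Sum>j<m. (ms_norm M (Z j))\<^sup>2 * (p (Suc j) - p j))"
      using Suc by (auto simp: S_def)
    note Zm = Z[of m, OF Suc_le_lessD[OF Suc.prems]]
    note inc = adapted_L2_mult_increment[OF pm Zm, folded V_def]
    have eq: "isum f p Z (Suc m) = (\<lambda>\<omega>. S \<omega> + V \<omega>)"
      by (auto simp: S_def V_def isum_Suc)
    have ad: "adapted_L2 (p (Suc m)) (\<lambda>\<omega>. S \<omega> + V \<omega>)"
      using adapted_L2_mono[OF S(1)] pm inc(1) by (intro adapted_L2_add) auto
    have i: "integrable M (\<lambda>\<omega>. (S \<omega>)\<^sup>2)" "integrable M (\<lambda>\<omega>. (V \<omega>)\<^sup>2)" "integrable M (\<lambda>\<omega>. S \<omega> * V \<omega>)"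
      using adapted_L2_sq[OF S(1)] adapted_L2_sq[OF inc(1)]
      by (auto intro: square_integrable_mult_integrable square_integrable_integrable_square)
    have "(ms_norm M (\<lambda>\<omega>. S \<omega> + V \<omega>))\<^sup>2 = expectation (\<lambda>\<omega>. (S \<omega>)\<^sup>2 + (V \<omega>)\<^sup>2 + 2 * (S \<omega> * V \<omega>))"
      unfolding ms_norm_square by (simp add: power2_sum mult.assoc)
    also have "\<dots> = (ms_norm M S)\<^sup>2 + (ms_norm M V)\<^sup>2 + 2 * expectation (\<lambda>\<omega>. S \<omega> * V \<omega>)"
      unfolding ms_norm_square using i by simp
    also have "expectation (\<lambda>\<omega>. S \<omega> * V \<omega>) = 0"
      using inc(3)[OF S(1)] by (simp add: V_def)
    also have "(ms_norm M V)\<^sup>2 = (ms_norm M (Z m))\<^sup>2 * (p (Suc m) - p m)"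
      using inc(2) by (simp add: V_def[abs_def])
    finally show ?case using ad by (simp add: eq S(2))
  qed
  then show "adapted_L2 (p m) (isum f p Z m)"
    and "(ms_norm M (isum f p Z m))\<^sup>2 = (\<Sum>j<m. (ms_norm M (Z j))\<^sup>2 * (p (Suc j) - p j))" by auto
qed

text \<open>Cauchy-Schwarz after splitting each length \<open>d j\<close> into two factors
  \<open>sqrt (d j)\<close>; the factor \<open>b - a\<close> bounds the total length. Adaptedness
  replaces orthogonality nowhere here; it is only carried along.\<close>

lemma isum_time:
  assumes p: "interval_partition a b n p" and ab: "t \<le> a" "b \<le> T" and m: "m \<le> n"
    and Z: "\<And>j. j < n \<Longrightarrow> adapted_L2 (p j) (Z j)"
  shows "adapted_L2 (p m) (isum (\<lambda>\<tau> \<omega>. \<tau>) p Z m)"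
    and "(ms_norm M (isum (\<lambda>\<tau> \<omega>. \<tau>) p Z m))\<^sup>2 \<le> (b - a) * (\<Sum>j<m. (ms_norm M (Z j))\<^sup>2 * (p (Suc j) - p j))"
proof -
  have sum: "isum (\<lambda>\<tau> \<omega>. \<tau>) p Z m = (\<lambda>\<omega>. \<Sum>j<m. (p (Suc j) - p j) * Z j \<omega>)"
    by (auto simp: isum_def mult.commute)
  have "adapted_L2 (p m) (Z j)" if "j < m" for j
    using adapted_L2_mono[OF Z[of j]] partition_bounds[OF p, of j] partition_bounds[OF p, of m]
      partition_mono[OF p, of j m] ab m that by auto
  then show ad: "adapted_L2 (p m) (isum (\<lambda>\<tau> \<omega>. \<tau>) p Z m)"
    unfolding sum by (intro adapted_L2_sum adapted_L2_cmult) auto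
  define d where "d j = p (Suc j) - p j" for j
  have d: "0 \<le> d j" if "j < m" for j
    using partition_mono[OF p, of j "Suc j"] m that by (auto simp: d_def)
  have "(\<Sum>j<m. d j) = p m - p 0" unfolding d_def by (rule sum_lessThan_telescope)
  also have "\<dots> \<le> b - a"
    using partition_bounds[OF p, of m] m p by (auto simp: interval_partition_def)
  finally have dsum: "(\<Sum>j<m. d j) \<le> b - a" .
  have i: "integrable M (\<lambda>\<omega>. (Z j \<omega>)\<^sup>2)" if "j < m" for j
    using Z[of j] that m by (auto intro: square_integrable_integrable_square dest: adapted_L2_sq)
  have pt: "(\<Sum>j<m. d j * Z j \<omega>)\<^sup>2 \<le> (b - a) * (\<Sum>j<m. d j * (Z j \<omega>)\<^sup>2)" for \<omega>
  proof -
    have "(\<Sum>j<m. d j * Z j \<omega>)\<^sup>2 = (\<Sum>j<m. sqrt (d j) * (sqrt (d j) * Z j \<omega>))\<^sup>2"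
      using d by (intro arg_cong[where f = "\<lambda>x. x\<^sup>2"] sum.cong)
        (auto simp: mult.assoc[symmetric])
    also have "\<dots> \<le> (\<Sum>j<m. (sqrt (d j))\<^sup>2) * (\<Sum>j<m. (sqrt (d j) * Z j \<omega>)\<^sup>2)"
      by (rule Cauchy_Schwarz_ineq_sum)
    also have "\<dots> = (\<Sum>j<m. d j) * (\<Sum>j<m. d j * (Z j \<omega>)\<^sup>2)"
      using d by (intro arg_cong2[where f = "(*)"] sum.cong) (auto simp: power_mult_distrib)
    also have "\<dots> \<le> (b - a) * (\<Sum>j<m. d j * (Z j \<omega>)\<^sup>2)"
      using d by (intro mult_right_mono dsum sum_nonneg) auto
    finally show ?thesis .
  qed
  have "(ms_norm M (isum (\<lambda>\<tau> \<omega>. \<tau>) p Z m))\<^sup>2 \<le> expectation (\<lambda>\<omega>. (b - a) * (\<Sum>j<m. d j * (Z j \<omega>)\<^sup>2))"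
    unfolding ms_norm_square
  proof (rule integral_mono)
    show "integrable M (\<lambda>\<omega>. (isum (\<lambda>\<tau> \<omega>. \<tau>) p Z m \<omega>)\<^sup>2)"
      using ad by (auto intro: square_integrable_integrable_square dest: adapted_L2_sq)
    show "integrable M (\<lambda>\<omega>. (b - a) * (\<Sum>j<m. d j * (Z j \<omega>)\<^sup>2))"
      using i by (intro integrable_mult_right Bochner_Integration.integrable_sum) auto
    show "(isum (\<lambda>\<tau> \<omega>. \<tau>) p Z m \<omega>)\<^sup>2 \<le> (b - a) * (\<Sum>j<m. d j * (Z j \<omega>)\<^sup>2)" for \<omega>
      using pt[of \<omega>] by (simp add: sum d_def)
  qed
  also have "\<dots> = (b - a) * (\<Sum>j<m. (ms_norm M (Z j))\<^sup>2 * (p (Suc j) - p j))"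
    using i by (simp add: ms_norm_square d_def mult.commute)
  finally show "(ms_norm M (isum (\<lambda>\<tau> \<omega>. \<tau>) p Z m))\<^sup>2 \<le> (b - a) * (\<Sum>j<m. (ms_norm M (Z j))\<^sup>2 * (p (Suc j) - p j))" .
qed

lemma isum_cong_integrator:
  assumes p: "interval_partition a b n p" and ab: "t \<le> a" "b \<le> T" and m: "m \<le> n"
    and w: "\<And>\<tau> \<omega>. \<tau> \<in> {t..T} \<Longrightarrow> \<omega> \<in> space M \<Longrightarrow> w \<tau> \<omega> = w' \<tau> \<omega>" and \<omega>: "\<omega> \<in> space M"
  shows "isum w p Z m \<omega> = isum w' p Z m \<omega>"
  unfolding isum_def
proof (rule sum.cong[OF refl])
  fix j assume "j \<in> {..<m}"
  then have "p j \<in> {t..T}" "p (Suc j) \<in> {t..T}"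
    using partition_bounds[OF p, of j] partition_bounds[OF p, of "Suc j"] ab m by auto
  then show "Z j \<omega> * (w (p (Suc j)) \<omega> - w (p j) \<omega>) = Z j \<omega> * (w' (p (Suc j)) \<omega> - w' (p j) \<omega>)"
    using w \<omega> by simp
qed

text \<open>The constant \<open>1 + T\<close> covers the factor 1 of the isometry and the factor
  \<open>b - a \<le> T\<close> of Cauchy-Schwarz, so that from here on both kinds of integrator are
  treated alike.\<close>

lemma isum_integrator:
  assumes w: "integrator w"
    and p: "interval_partition a b n p" and ab: "t \<le> a" "b \<le> T" and m: "m \<le> n"
    and Z: "\<And>j. j < n \<Longrightarrow> adapted_L2 (p j) (Z j)"
  shows "adapted_L2 (p m) (isum w p Z m)"
    and "(ms_norm M (isum w p Z m))\<^sup>2 \<le> (1 + T) * (\<Sum>j<m. (ms_norm M (Z j))\<^sup>2 * (p (Suc j) - p j))"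
proof -
  let ?S = "\<Sum>j<m. (ms_norm M (Z j))\<^sup>2 * (p (Suc j) - p j)"
  have pm: "t \<le> p m" "p m \<le> T"
    using partition_bounds[OF p m] ab by auto
  have S: "0 \<le> ?S"
    using partition_mono[OF p, of _ "Suc _"] m by (intro sum_nonneg mult_nonneg_nonneg) auto
  consider "\<forall>\<tau>\<in>{t..T}. \<forall>\<omega>\<in>space M. w \<tau> \<omega> = f \<tau> \<omega>" | "\<forall>\<tau>\<in>{t..T}. \<forall>\<omega>\<in>space M. w \<tau> \<omega> = \<tau>"
    using w unfolding integrator_def by blast
  then have "adapted_L2 (p m) (isum w p Z m) \<and> (ms_norm M (isum w p Z m))\<^sup>2 \<le> (1 + T) * ?S"
  proof cases
    case 1
    then have eq: "isum w p Z m \<omega> = isum f p Z m \<omega>" if "\<omega> \<in> space M" for \<omega>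
      using that by (intro isum_cong_integrator[OF p ab m]) auto
    have "(ms_norm M (isum f p Z m))\<^sup>2 = ?S" by (rule isum_wiener(2)[OF p ab m Z])
    moreover have "1 * ?S \<le> (1 + T) * ?S"
      by (rule mult_right_mono[OF _ S]) (use t_nonneg t_le_T in linarith)
    ultimately have "(ms_norm M (isum f p Z m))\<^sup>2 \<le> (1 + T) * ?S" by linarith
    then show ?thesis
      using isum_wiener(1)[OF p ab m Z] adapted_L2_cong[OF pm eq] ms_norm_cong[OF eq, of M] by simp
  next
    case 2
    then have eq: "isum w p Z m \<omega> = isum (\<lambda>\<tau> \<omega>. \<tau>) p Z m \<omega>" if "\<omega> \<in> space M" for \<omega>
      using that by (intro isum_cong_integrator[OF p ab m]) auto
    have "(b - a) * ?S \<le> (1 + T) * ?S"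
      using S t_nonneg ab by (intro mult_right_mono) auto
    then have "(ms_norm M (isum (\<lambda>\<tau> \<omega>. \<tau>) p Z m))\<^sup>2 \<le> (1 + T) * ?S"
      using isum_time(2)[OF p ab m Z] by linarith
    then show ?thesis
      using isum_time(1)[OF p ab m Z] adapted_L2_cong[OF pm eq] ms_norm_cong[OF eq, of M] by simp
  qed
  then show "adapted_L2 (p m) (isum w p Z m)"
    and "(ms_norm M (isum w p Z m))\<^sup>2 \<le> (1 + T) * ?S" by auto
qed

lemma isum_integrator_uniform:
  assumes w: "integrator w"
    and p: "interval_partition a b n p" and ab: "t \<le> a" "b \<le> T" and m: "m \<le> n"
    and Z: "\<And>j. j < n \<Longrightarrow> adapted_L2 (p j) (Z j)"
    and B: "\<And>j. j < n \<Longrightarrow> ms_norm M (Z j) \<le> B" "0 \<le> B"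
  shows "ms_norm M (isum w p Z m) \<le> (1 + T) * B"
proof -
  have "(\<Sum>j<m. (ms_norm M (Z j))\<^sup>2 * (p (Suc j) - p j)) \<le> (\<Sum>j<m. B\<^sup>2 * (p (Suc j) - p j))"
    using partition_mono[OF p, of _ "Suc _"] m B
    by (intro sum_mono mult_right_mono power_mono) auto
  also have "\<dots> = B\<^sup>2 * (p m - p 0)"
    by (simp add: sum_distrib_left[symmetric] sum_lessThan_telescope)
  \<comment> \<open>The generous bound \<open>1 + T\<close> for the length makes the final estimate
    the square of \<open>(1 + T) * B\<close>.\<close>
  also have "\<dots> \<le> B\<^sup>2 * (1 + T)"
    using partition_bounds[OF p m] partition_bounds[OF p, of 0] ab t_nonneg
    by (intro mult_left_mono) auto
  finally have "(1 + T) * (\<Sum>j<m. (ms_norm M (Z j))\<^sup>2 * (p (Suc j) - p j)) \<le> (1 + T) * (B\<^sup>2 * (1 + T))"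
    using t_nonneg t_le_T by (intro mult_left_mono) auto
  with isum_integrator(2)[OF w p ab m Z] have "(ms_norm M (isum w p Z m))\<^sup>2 \<le> ((1 + T) * B)\<^sup>2"
    by (simp add: power2_eq_square algebra_simps)
  then show ?thesis
    by (rule power2_le_imp_le) (use B(2) t_nonneg t_le_T in auto)
qed

end

subsection \<open>Mean-square continuous processes\<close>

definition jointly_measurable :: "'a measure \<Rightarrow> real \<Rightarrow> real \<Rightarrow> (real \<Rightarrow> 'a \<Rightarrow> real) \<Rightarrow> bool" where
  "jointly_measurable M a b \<xi> \<longleftrightarrow>
     (\<lambda>(\<tau>, \<omega>). \<xi> \<tau> \<omega>) \<in> borel_measurable (restrict_space borel {a..b} \<Otimes>\<^sub>M M)"

text \<open>Square integrability is included because the integral of a non-integrable function is 0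
  by convention; without it a vanishing distance would carry no information.\<close>

definition ms_continuous :: "'a measure \<Rightarrow> real \<Rightarrow> real \<Rightarrow> (real \<Rightarrow> 'a \<Rightarrow> real) \<Rightarrow> bool" where
  "ms_continuous M a b \<xi> \<longleftrightarrow> (\<forall>\<tau>\<in>{a..b}. square_integrable M (\<xi> \<tau>) \<and>
     ((\<lambda>s. ms_dist M (\<xi> s) (\<xi> \<tau>)) \<longlongrightarrow> 0) (at \<tau> within {a..b}))"

lemma measurable_restrict_inclusion:
  "A \<subseteq> B \<Longrightarrow> (\<lambda>x. x) \<in> measurable (restrict_space borel A \<Otimes>\<^sub>M M) (restrict_space borel B \<Otimes>\<^sub>M M)"
proof -
  assume AB: "A \<subseteq> B"
  have "(\<lambda>x. x) \<in> measurable (restrict_space borel A) (restrict_space borel B)"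
    using AB by (intro measurable_restrict_space2 measurable_restrict_space1) (auto simp: space_restrict_space)
  then have "(\<lambda>x. (fst x, snd x)) \<in> measurable (restrict_space borel A \<Otimes>\<^sub>M M) (restrict_space borel B \<Otimes>\<^sub>M M)"
    by (intro measurable_Pair measurable_compose[OF measurable_fst] measurable_snd)
  then show ?thesis by simp
qed

lemma jointly_measurable_borel:
  assumes "(\<lambda>(\<tau>, \<omega>). \<xi> \<tau> \<omega>) \<in> borel_measurable (borel \<Otimes>\<^sub>M M)"
  shows "jointly_measurable M a b \<xi>"
proof -
  have "(\<lambda>x. x) \<in> measurable (restrict_space borel {a..b}) (borel :: real measure)"
    by (intro measurable_restrict_space1) auto
  then have "(\<lambda>x. (fst x, snd x)) \<in> measurable (restrict_space borel {a..b} \<Otimes>\<^sub>M M) (borel \<Otimes>\<^sub>M M)"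
    by (intro measurable_Pair measurable_compose[OF measurable_fst] measurable_snd)
  from measurable_compose[OF this assms] show ?thesis by (simp add: jointly_measurable_def split_beta')
qed

lemma jointly_measurable_subset:
  assumes "jointly_measurable M a b \<xi>" "a \<le> c" "d \<le> b"
  shows "jointly_measurable M c d \<xi>"
proof -
  have "{c..d} \<subseteq> {a..b}" using assms(2,3) by auto
  from measurable_compose[OF measurable_restrict_inclusion[OF this] assms(1)[unfolded jointly_measurable_def]]
  show ?thesis by (simp add: jointly_measurable_def)
qed

lemma jointly_measurable_diff:
  "jointly_measurable M a b \<xi> \<Longrightarrow> jointly_measurable M a b \<eta> \<Longrightarrow>
    jointly_measurable M a b (\<lambda>\<tau> \<omega>. \<xi> \<tau> \<omega> - \<eta> \<tau> \<omega>)"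
  unfolding jointly_measurable_def split_beta by (rule borel_measurable_diff)

lemma jointly_measurable_deterministic:
  assumes "continuous_on {a..b} g"
  shows "jointly_measurable M a b (\<lambda>\<tau> \<omega>. g \<tau>)"
  unfolding jointly_measurable_def split_beta
  using measurable_compose[OF measurable_fst[of _ M] borel_measurable_continuous_on_restrict[OF assms]] by simp

lemma jointly_measurable_mult:
  "jointly_measurable M a b \<xi> \<Longrightarrow> jointly_measurable M a b \<eta> \<Longrightarrow>
    jointly_measurable M a b (\<lambda>\<tau> \<omega>. \<xi> \<tau> \<omega> * \<eta> \<tau> \<omega>)"
  unfolding jointly_measurable_def split_beta by (rule borel_measurable_times)

lemma jointly_measurable_step_approx:
  assumes "interval_partition a b n p" "\<And>\<tau>. \<tau> \<in> {a..b} \<Longrightarrow> \<xi> \<tau> \<in> borel_measurable M"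
  shows "jointly_measurable M a' b' (step_approx n p \<xi>)"
proof (rule jointly_measurable_borel)
  have m: "\<xi> (p i) \<in> borel_measurable M" if "i \<le> n" for i
    using assms(2) partition_bounds[OF assms(1) that] by auto
  have 1: "(\<lambda>x. \<xi> (p i) (snd x) * indicator {p i..<p (Suc i)} (fst x)) \<in> borel_measurable (borel \<Otimes>\<^sub>M M)"
    if "i < n" for i
    using that by (intro borel_measurable_times measurable_compose[OF measurable_snd m]
        measurable_compose[OF measurable_fst borel_measurable_indicator]) auto
  have 2: "(\<lambda>x. \<xi> (p n) (snd x) * indicator {p n} (fst x)) \<in> borel_measurable (borel \<Otimes>\<^sub>M M)"
    by (intro borel_measurable_times measurable_compose[OF measurable_snd m]
        measurable_compose[OF measurable_fst borel_measurable_indicator]) auto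
  show "(\<lambda>(\<tau>, \<omega>). step_approx n p \<xi> \<tau> \<omega>) \<in> borel_measurable (borel \<Otimes>\<^sub>M M)"
    unfolding step_approx_def split_beta using 1 2
    by (intro borel_measurable_add borel_measurable_sum) auto
qed

lemma ms_continuous_square_integrable:
  "ms_continuous M a b \<xi> \<Longrightarrow> \<tau> \<in> {a..b} \<Longrightarrow> square_integrable M (\<xi> \<tau>)"
  by (simp add: ms_continuous_def)

lemma ms_continuous_subset:
  assumes "ms_continuous M a b \<xi>" "a \<le> c" "d \<le> b"
  shows "ms_continuous M c d \<xi>"
proof -
  have "{c..d} \<subseteq> {a..b}" using assms by auto
  with assms(1) show ?thesis
    unfolding ms_continuous_def by (blast intro: tendsto_within_subset)
qed

text \<open>Heine-Cantor for the pseudometric \<open>ms_dist\<close>. Random variables with this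
  distance do not form a metric space type, so the compactness argument is carried out on the time
  interval.\<close>

lemma ms_continuous_modulus:
  assumes "ms_continuous M a b \<xi>" "0 < e"
  obtains d where "0 < d" "\<And>u v. u \<in> {a..b} \<Longrightarrow> v \<in> {a..b} \<Longrightarrow> \<bar>u - v\<bar> < d \<Longrightarrow>
    ms_dist M (\<xi> u) (\<xi> v) < e"
proof -
  let ?\<rho> = "\<lambda>u v. ms_dist M (\<xi> u) (\<xi> v)"
  note sq = ms_continuous_square_integrable[OF assms(1)]
  have "\<exists>d>0. \<forall>s\<in>{a..b}. \<bar>s - \<tau>\<bar> < d \<longrightarrow> ?\<rho> s \<tau> < e / 2" if \<tau>: "\<tau> \<in> {a..b}" for \<tau>
  proof -
    have "((\<lambda>s. ?\<rho> s \<tau>) \<longlongrightarrow> 0) (at \<tau> within {a..b})"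
      using assms(1) \<tau> by (auto simp: ms_continuous_def)
    then have "\<forall>\<^sub>F s in at \<tau> within {a..b}. ?\<rho> s \<tau> < e / 2"
      using assms(2) by (intro order_tendstoD) auto
    then obtain d where "d > 0" and d: "\<And>s. s \<in> {a..b} \<Longrightarrow> s \<noteq> \<tau> \<Longrightarrow> dist s \<tau> < d \<Longrightarrow> ?\<rho> s \<tau> < e / 2"
      unfolding eventually_at by blast
    have "?\<rho> s \<tau> < e / 2" if "s \<in> {a..b}" "\<bar>s - \<tau>\<bar> < d" for s
      using d[OF that(1)] that(2) assms(2) by (cases "s = \<tau>") (auto simp: dist_real_def)
    with \<open>d > 0\<close> show ?thesis by blast
  qed
  then obtain D where D: "\<And>\<tau>. \<tau> \<in> {a..b} \<Longrightarrow> D \<tau> > 0"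
    "\<And>\<tau> s. \<tau> \<in> {a..b} \<Longrightarrow> s \<in> {a..b} \<Longrightarrow> \<bar>s - \<tau>\<bar> < D \<tau> \<Longrightarrow> ?\<rho> s \<tau> < e / 2"
    by metis
  \<comment> \<open>\<open>d\<close> is a Lebesgue number of the cover by the balls: two times
    closer than \<open>d\<close> lie in a common ball, and its centre links them at cost
    \<open>e / 2\<close> each.\<close>
  obtain d where "d > 0" and d: "\<And>x. x \<in> {a..b} \<Longrightarrow> \<exists>G\<in>(\<lambda>\<tau>. ball \<tau> (D \<tau>)) ` {a..b}. ball x d \<subseteq> G"
  proof (rule Heine_Borel_lemma[of "{a..b}" "(\<lambda>\<tau>. ball \<tau> (D \<tau>)) ` {a..b}"])
    show "{a..b} \<subseteq> \<Union> ((\<lambda>\<tau>. ball \<tau> (D \<tau>)) ` {a..b})" using D(1) by (force simp: centre_in_ball)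
  qed auto
  show thesis
  proof (rule that[OF \<open>d > 0\<close>])
    fix u v assume uv: "u \<in> {a..b}" "v \<in> {a..b}" "\<bar>u - v\<bar> < d"
    from d[OF uv(1)] obtain \<tau> where \<tau>: "\<tau> \<in> {a..b}" "ball u d \<subseteq> ball \<tau> (D \<tau>)" by blast
    have "u \<in> ball u d" "v \<in> ball u d" using \<open>d > 0\<close> uv(3) by (auto simp: dist_real_def)
    with \<tau>(2) have "u \<in> ball \<tau> (D \<tau>)" "v \<in> ball \<tau> (D \<tau>)" by blast+
    then have "?\<rho> u \<tau> < e / 2" "?\<rho> v \<tau> < e / 2"
      using D(2)[OF \<tau>(1)] uv(1,2) by (auto simp: dist_real_def abs_minus_commute)
    then show "?\<rho> u v < e"
      using ms_norm_triangle_diff[OF sq[OF uv(1)] sq[OF \<tau>(1)] sq[OF uv(2)]]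
      by (simp add: ms_norm_minus_commute[of M "\<xi> v"])
  qed
qed

lemma ms_continuous_bounded:
  assumes "ms_continuous M a b \<xi>"
  obtains B where "0 < B" "\<And>\<tau>. \<tau> \<in> {a..b} \<Longrightarrow> ms_norm M (\<xi> \<tau>) \<le> B"
proof (cases "a \<le> b")
  case True
  note sq = ms_continuous_square_integrable[OF assms]
  obtain d where d: "0 < d" "\<And>u v. u \<in> {a..b} \<Longrightarrow> v \<in> {a..b} \<Longrightarrow> \<bar>u - v\<bar> < d \<Longrightarrow>
      ms_dist M (\<xi> u) (\<xi> v) < 1"
    using ms_continuous_modulus[OF assms, of 1] by auto
  obtain n p where p: "interval_partition a b n p" "mesh n p < d"
    using partition_exists[OF True d(1)] by blast
  \<comment> \<open>Every time is close to a node with distance below 1 between the values; the sum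
    over the nodes stands in for their maximum.\<close>
  define B where "B = 1 + (\<Sum>j\<le>n. ms_norm M (\<xi> (p j)))"
  show thesis
  proof (rule that[of B])
    show "0 < B" by (auto simp: B_def intro!: add_pos_nonneg sum_nonneg)
    fix \<tau> assume \<tau>: "\<tau> \<in> {a..b}"
    have "\<exists>j\<le>n. \<bar>\<tau> - p j\<bar> < d"
    proof (cases "\<tau> = b")
      case True
      then show ?thesis using p d(1) by (intro exI[of _ n]) (auto simp: interval_partition_def)
    next
      case False
      then obtain j where j: "j < n" "p j \<le> \<tau>" "\<tau> < p (Suc j)"
        using partition_locate[OF p(1), of \<tau>] \<tau> by auto
      then show ?thesis using mesh_ge[OF j(1), of p] p(2) by (intro exI[of _ j]) auto
    qed
    then obtain j where j: "j \<le> n" "\<bar>\<tau> - p j\<bar> < d" by blast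
    have pj: "p j \<in> {a..b}" using partition_bounds[OF p(1) j(1)] by auto
    have "ms_norm M (\<xi> (p j)) \<le> (\<Sum>j\<le>n. ms_norm M (\<xi> (p j)))"
      using j(1) by (intro member_le_sum) auto
    with ms_norm_le_diff[OF sq[OF \<tau>] sq[OF pj]] d(2)[OF \<tau> pj j(2)]
    show "ms_norm M (\<xi> \<tau>) \<le> B" by (simp add: B_def)
  qed
qed (auto intro: that[of 1])

lemma (in prob_space) square_integral_borel_measurable:
  assumes "jointly_measurable M a b \<xi>"
  shows "(\<lambda>\<tau>. indicator {a..b} \<tau> *\<^sub>R (\<integral>\<omega>. (\<xi> \<tau> \<omega>)\<^sup>2 \<partial>M)) \<in> borel_measurable borel"
proof -
  have "(\<lambda>x. (case x of (\<tau>, \<omega>) \<Rightarrow> \<xi> \<tau> \<omega>)\<^sup>2) \<in> borel_measurable (restrict_space borel {a..b} \<Otimes>\<^sub>M M)"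
    using assms unfolding jointly_measurable_def by (rule borel_measurable_power)
  then have "(\<lambda>\<tau>. \<integral>\<omega>. (\<xi> \<tau> \<omega>)\<^sup>2 \<partial>M) \<in> borel_measurable (restrict_space borel {a..b})"
    by (intro borel_measurable_lebesgue_integral) (simp add: split_beta')
  then show ?thesis
    by (subst (asm) borel_measurable_restrict_space_iff) (auto simp: mult.commute)
qed

lemma (in prob_space) set_integrable_square_integral:
  assumes "jointly_measurable M a b \<xi>" "\<And>\<tau>. \<tau> \<in> {a..b} \<Longrightarrow> (\<integral>\<omega>. (\<xi> \<tau> \<omega>)\<^sup>2 \<partial>M) \<le> g \<tau>"
    "set_integrable lborel {a..b} g"
  shows "set_integrable lborel {a..b} (\<lambda>\<tau>. \<integral>\<omega>. (\<xi> \<tau> \<omega>)\<^sup>2 \<partial>M)"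
  unfolding set_integrable_def
proof (rule Bochner_Integration.integrable_bound)
  show "integrable lborel (\<lambda>x. indicator {a..b} x *\<^sub>R g x)" using assms(3) by (simp add: set_integrable_def)
  show "(\<lambda>x. indicator {a..b} x *\<^sub>R (\<integral>\<omega>. (\<xi> x \<omega>)\<^sup>2 \<partial>M)) \<in> borel_measurable lborel"
    using square_integral_borel_measurable[OF assms(1)] by simp
  have "0 \<le> g x" if "x \<in> {a..b}" for x
  proof -
    have "0 \<le> (\<integral>\<omega>. (\<xi> x \<omega>)\<^sup>2 \<partial>M)" by simp
    with assms(2)[OF that] show ?thesis by linarith
  qed
  then show "AE x in lborel. norm (indicator {a..b} x *\<^sub>R (\<integral>\<omega>. (\<xi> x \<omega>)\<^sup>2 \<partial>M)) \<le>
      norm (indicator {a..b} x *\<^sub>R g x)"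
    using assms(2) by (auto simp: indicator_def)
qed

section \<open>Step processes in the class of square integrable adapted processes\<close>

context wiener_space
begin

lemma M2_class_adapted_L2:
  assumes "\<xi> \<in> M2_class M T F f a b" "\<tau> \<in> {a..b}"
  shows "adapted_L2 \<tau> (\<xi> \<tau>)"
  using assms by (auto simp: M2_class_def adapted_L2_def)

lemma M2_class_jointly_measurable:
  "\<xi> \<in> M2_class M T F f a b \<Longrightarrow> jointly_measurable M a b \<xi>"
  by (simp add: M2_class_def jointly_measurable_def)

text \<open>Independence from later increments follows from adaptedness, and integrability of the
  second moment follows from the uniform bound, so neither has to be checked for concrete
  processes.\<close>

lemma M2_classI:
  assumes ab: "t \<le> a" "b \<le> T" and jm: "jointly_measurable M a b \<xi>"
    and ad: "\<And>\<tau>. \<tau> \<in> {a..b} \<Longrightarrow> adapted_L2 \<tau> (\<xi> \<tau>)"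
    and B: "\<And>\<tau>. \<tau> \<in> {a..b} \<Longrightarrow> ms_norm M (\<xi> \<tau>) \<le> B"
  shows "\<xi> \<in> M2_class M T F f a b"
proof -
  have "(\<integral>\<omega>. (\<xi> \<tau> \<omega>)\<^sup>2 \<partial>M) \<le> B\<^sup>2" if "\<tau> \<in> {a..b}" for \<tau>
    using B[OF that] unfolding ms_norm_square[symmetric] by (intro power_mono) auto
  moreover have "set_integrable lborel {a..b} (\<lambda>\<tau>. B\<^sup>2)"
    by (intro borel_integrable_atLeastAtMost') auto
  ultimately have "set_integrable lborel {a..b} (\<lambda>\<tau>. \<integral>\<omega>. (\<xi> \<tau> \<omega>)\<^sup>2 \<partial>M)"
    by (rule set_integrable_square_integral[OF jm])
  moreover have "indep_var borel (\<xi> \<tau>) borel (\<lambda>\<omega>. f (s + \<Delta>) \<omega> - f s \<omega>)"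
    if "\<tau> \<in> {a..b}" "\<tau> \<le> s \<and> 0 < \<Delta> \<and> s + \<Delta> \<le> T" for \<tau> s \<Delta>
    using that ab by (intro indep_increment[OF _ _ _ _ adapted_L2_meas[OF ad[OF that(1)]]]) auto
  ultimately show ?thesis
    using jm ad unfolding M2_class_def jointly_measurable_def adapted_L2_def by blast
qed

lemma M2_class_subset:
  assumes "\<xi> \<in> M2_class M T F f a b" "a \<le> c" "d \<le> b"
  shows "\<xi> \<in> M2_class M T F f c d"
proof -
  have sub: "{c..d} \<subseteq> {a..b}" using assms by auto
  have i: "set_integrable lborel {a..b} (\<lambda>\<tau>. \<integral>\<omega>. (\<xi> \<tau> \<omega>)\<^sup>2 \<partial>M)"
    using assms(1) unfolding M2_class_def by blast
  have "set_integrable lborel {c..d} (\<lambda>\<tau>. \<integral>\<omega>. (\<xi> \<tau> \<omega>)\<^sup>2 \<partial>M)"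
    by (rule set_integrable_subset[OF i _ sub]) simp
  moreover have "jointly_measurable M c d \<xi>"
    by (rule jointly_measurable_subset[OF M2_class_jointly_measurable[OF assms(1)] assms(2,3)])
  moreover have "\<tau> \<in> {a..b}" if "\<tau> \<in> {c..d}" for \<tau> using that sub by blast
  ultimately show ?thesis
    using assms(1) unfolding M2_class_def jointly_measurable_def mem_Collect_eq
    by (intro conjI ballI) (elim conjE; blast)+
qed

lemma M2_class_diff_integrable:
  assumes \<xi>: "\<xi> \<in> M2_class M T F f a b" and \<eta>: "\<eta> \<in> M2_class M T F f a b"
  shows "set_integrable lborel {a..b} (\<lambda>\<tau>. \<integral>\<omega>. (\<xi> \<tau> \<omega> - \<eta> \<tau> \<omega>)\<^sup>2 \<partial>M)"
proof (rule set_integrable_square_integral[where g = "\<lambda>\<tau>. 2 * (\<integral>\<omega>. (\<xi> \<tau> \<omega>)\<^sup>2 \<partial>M) + 2 * (\<integral>\<omega>. (\<eta> \<tau> \<omega>)\<^sup>2 \<partial>M)"])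
  show "jointly_measurable M a b (\<lambda>\<tau> \<omega>. \<xi> \<tau> \<omega> - \<eta> \<tau> \<omega>)"
    by (intro jointly_measurable_diff M2_class_jointly_measurable \<xi> \<eta>)
  show "set_integrable lborel {a..b} (\<lambda>\<tau>. 2 * (\<integral>\<omega>. (\<xi> \<tau> \<omega>)\<^sup>2 \<partial>M) + 2 * (\<integral>\<omega>. (\<eta> \<tau> \<omega>)\<^sup>2 \<partial>M))"
    using \<xi> \<eta> by (intro set_integral_add set_integrable_mult_right) (auto simp: M2_class_def)
  fix \<tau> assume \<tau>: "\<tau> \<in> {a..b}"
  have sq: "square_integrable M (\<xi> \<tau>)" "square_integrable M (\<eta> \<tau>)"
    using M2_class_adapted_L2[OF \<xi> \<tau>] M2_class_adapted_L2[OF \<eta> \<tau>] by (auto dest: adapted_L2_sq)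
  have pt: "(x - y)\<^sup>2 \<le> 2 * x\<^sup>2 + 2 * y\<^sup>2" for x y :: real
    using zero_le_power2[of "x + y"] by (simp add: power2_eq_square algebra_simps)
  have "(\<integral>\<omega>. (\<xi> \<tau> \<omega> - \<eta> \<tau> \<omega>)\<^sup>2 \<partial>M) \<le> (\<integral>\<omega>. 2 * (\<xi> \<tau> \<omega>)\<^sup>2 + 2 * (\<eta> \<tau> \<omega>)\<^sup>2 \<partial>M)"
    by (intro integral_mono pt square_integrable_integrable_square square_integrable_diff
        Bochner_Integration.integrable_add integrable_mult_right sq)
  also have "\<dots> = 2 * (\<integral>\<omega>. (\<xi> \<tau> \<omega>)\<^sup>2 \<partial>M) + 2 * (\<integral>\<omega>. (\<eta> \<tau> \<omega>)\<^sup>2 \<partial>M)"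
    using sq by (simp add: square_integrable_integrable_square)
  finally show "(\<integral>\<omega>. (\<xi> \<tau> \<omega> - \<eta> \<tau> \<omega>)\<^sup>2 \<partial>M) \<le> 2 * (\<integral>\<omega>. (\<xi> \<tau> \<omega>)\<^sup>2 \<partial>M) + 2 * (\<integral>\<omega>. (\<eta> \<tau> \<omega>)\<^sup>2 \<partial>M)" .
qed

lemma set_integral_diff_le:
  assumes "\<xi> \<in> M2_class M T F f a b" "\<eta> \<in> M2_class M T F f a b" "a \<le> b" "0 \<le> e"
    and le: "\<And>\<tau>. \<tau> \<in> {a..b} \<Longrightarrow> ms_dist M (\<xi> \<tau>) (\<eta> \<tau>) \<le> e"
  shows "(LINT \<tau>:{a..b}|lborel. (\<integral>\<omega>. (\<xi> \<tau> \<omega> - \<eta> \<tau> \<omega>)\<^sup>2 \<partial>M)) \<le> (b - a) * e\<^sup>2"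
proof -
  have "(LINT \<tau>:{a..b}|lborel. (\<integral>\<omega>. (\<xi> \<tau> \<omega> - \<eta> \<tau> \<omega>)\<^sup>2 \<partial>M)) \<le> (LINT \<tau>:{a..b}|lborel. e\<^sup>2)"
  proof (rule set_integral_mono)
    show "set_integrable lborel {a..b} (\<lambda>\<tau>. e\<^sup>2)" by (intro borel_integrable_atLeastAtMost') auto
    show "(\<integral>\<omega>. (\<xi> \<tau> \<omega> - \<eta> \<tau> \<omega>)\<^sup>2 \<partial>M) \<le> e\<^sup>2" if "\<tau> \<in> {a..b}" for \<tau>
      using le[OF that] unfolding ms_norm_square[symmetric] by (intro power_mono) auto
  qed (rule M2_class_diff_integrable[OF assms(1,2)])
  also have "\<dots> = (b - a) * e\<^sup>2"
    using assms(3) by (simp add: set_lebesgue_integral_def)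
  finally show ?thesis .
qed

lemma set_integral_diff_triangle:
  assumes "\<xi> \<in> M2_class M T F f a b" "\<eta> \<in> M2_class M T F f a b" "\<zeta> \<in> M2_class M T F f a b"
  shows "(LINT \<tau>:{a..b}|lborel. (\<integral>\<omega>. (\<xi> \<tau> \<omega> - \<zeta> \<tau> \<omega>)\<^sup>2 \<partial>M)) \<le>
    2 * (LINT \<tau>:{a..b}|lborel. (\<integral>\<omega>. (\<xi> \<tau> \<omega> - \<eta> \<tau> \<omega>)\<^sup>2 \<partial>M)) +
    2 * (LINT \<tau>:{a..b}|lborel. (\<integral>\<omega>. (\<zeta> \<tau> \<omega> - \<eta> \<tau> \<omega>)\<^sup>2 \<partial>M))"
proof -
  let ?d = "\<lambda>\<xi> \<eta> \<tau>. \<integral>\<omega>. (\<xi> \<tau> \<omega> - \<eta> \<tau> \<omega>)\<^sup>2 \<partial>M"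
  note i = M2_class_diff_integrable
  have "(LINT \<tau>:{a..b}|lborel. ?d \<xi> \<zeta> \<tau>) \<le> (LINT \<tau>:{a..b}|lborel. 2 * ?d \<xi> \<eta> \<tau> + 2 * ?d \<zeta> \<eta> \<tau>)"
  proof (rule set_integral_mono)
    show "set_integrable lborel {a..b} (?d \<xi> \<zeta>)" by (rule i[OF assms(1,3)])
    show "set_integrable lborel {a..b} (\<lambda>\<tau>. 2 * ?d \<xi> \<eta> \<tau> + 2 * ?d \<zeta> \<eta> \<tau>)"
      by (intro set_integral_add set_integrable_mult_right i assms)
    fix \<tau> assume \<tau>: "\<tau> \<in> {a..b}"
    have sq: "square_integrable M (\<xi> \<tau>)" "square_integrable M (\<eta> \<tau>)" "square_integrable M (\<zeta> \<tau>)"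
      using M2_class_adapted_L2[OF assms(1) \<tau>] M2_class_adapted_L2[OF assms(2) \<tau>] M2_class_adapted_L2[OF assms(3) \<tau>]
      by (auto dest: adapted_L2_sq)
    have "(ms_dist M (\<xi> \<tau>) (\<zeta> \<tau>))\<^sup>2 \<le>
        (ms_dist M (\<xi> \<tau>) (\<eta> \<tau>) + ms_dist M (\<zeta> \<tau>) (\<eta> \<tau>))\<^sup>2"
      using ms_norm_triangle_diff[OF sq] by (intro power_mono) (auto simp: ms_norm_minus_commute[of M "\<zeta> \<tau>"])
    also have "\<dots> \<le> 2 * (ms_dist M (\<xi> \<tau>) (\<eta> \<tau>))\<^sup>2 + 2 * (ms_dist M (\<zeta> \<tau>) (\<eta> \<tau>))\<^sup>2"
      using zero_le_power2[of "ms_dist M (\<xi> \<tau>) (\<eta> \<tau>) - ms_dist M (\<zeta> \<tau>) (\<eta> \<tau>)"]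
      by (simp add: power2_sum power2_diff)
    finally show "?d \<xi> \<zeta> \<tau> \<le> 2 * ?d \<xi> \<eta> \<tau> + 2 * ?d \<zeta> \<eta> \<tau>" by (simp add: ms_norm_square)
  qed
  also have "\<dots> = 2 * (LINT \<tau>:{a..b}|lborel. ?d \<xi> \<eta> \<tau>) + 2 * (LINT \<tau>:{a..b}|lborel. ?d \<zeta> \<eta> \<tau>)"
    by (simp add: set_integral_add set_integrable_mult_right i assms)
  finally show ?thesis .
qed

lemma step_approx_M2_class:
  assumes ab: "t \<le> a" "b \<le> T" and p: "interval_partition a b n p"
    and ad: "\<And>\<tau>. \<tau> \<in> {a..b} \<Longrightarrow> adapted_L2 \<tau> (\<xi> \<tau>)"
    and B: "\<And>\<tau>. \<tau> \<in> {a..b} \<Longrightarrow> ms_norm M (\<xi> \<tau>) \<le> B"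
  shows "step_approx n p \<xi> \<in> M2_class M T F f a b"
proof (rule M2_classI[OF ab])
  show "jointly_measurable M a b (step_approx n p \<xi>)"
    by (rule jointly_measurable_step_approx[OF p]) (use ad in \<open>auto dest: adapted_L2_sq square_integrable_measurable\<close>)
  fix \<tau> assume \<tau>: "\<tau> \<in> {a..b}"
  then obtain u where u: "u \<in> {a..b}" "u \<le> \<tau>" "step_approx n p \<xi> \<tau> = \<xi> u"
    using step_approx_point[OF p] by metis
  then show "adapted_L2 \<tau> (step_approx n p \<xi> \<tau>)" "ms_norm M (step_approx n p \<xi> \<tau>) \<le> B"
    using adapted_L2_mono[OF ad[OF u(1)]] B[OF u(1)] ab \<tau> by auto
qed

text \<open>Over a common refinement both step processes are constant on each cell, so the
  difference of the two sums is one sum over one partition. Its isometry bound is exactly the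
  integral of the step function on the right-hand side.\<close>

lemma step_sums_distance:
  assumes w: "integrator w" and ab: "t \<le> a" "b \<le> T"
    and p: "interval_partition a b n p" and q: "interval_partition a b m q"
    and \<zeta>: "step_process M n p \<zeta>" "\<And>\<tau>. \<tau> \<in> {a..b} \<Longrightarrow> adapted_L2 \<tau> (\<zeta> \<tau>)"
    and \<eta>: "step_process M m q \<eta>" "\<And>\<tau>. \<tau> \<in> {a..b} \<Longrightarrow> adapted_L2 \<tau> (\<eta> \<tau>)"
  shows "(ms_dist M (isum w p (\<lambda>j. \<zeta> (p j)) n) (isum w q (\<lambda>j. \<eta> (q j)) m))\<^sup>2 \<le>
    (1 + T) * (LINT \<tau>:{a..b}|lborel. (\<integral>\<omega>. (\<zeta> \<tau> \<omega> - \<eta> \<tau> \<omega>)\<^sup>2 \<partial>M))"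
proof -
  obtain l r c e where r: "interval_partition a b l r" "refinement n p l r c" "refinement m q l r e"
    using common_refinement[OF p q] by blast
  have le: "a \<le> b" using partition_bounds[OF r(1), of 0] by (auto)
  have rin: "r i \<in> {a..b}" if "i \<le> l" for i using partition_bounds[OF r(1) that] by auto
  have block: "x \<in> {p j..<p (Suc j)}"
    if "refinement n p l r c" "j < n" "c j \<le> i" "i < c (Suc j)" "r i \<le> x" "x < r (Suc i)"
    for n p c i j x
  proof -
    have "c (Suc j) \<le> l" using refinement_le[OF that(1), of "Suc j"] that(2) by auto
    then have "r (c j) \<le> r i" "r (Suc i) \<le> r (c (Suc j))"
      using that by (auto intro!: partition_mono[OF r(1)])
    moreover have "r (c j) = p j" "r (c (Suc j)) = p (Suc j)"
      using that by (auto simp: refinement_def)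
    ultimately show ?thesis using that by auto
  qed
  have const: "\<zeta> x \<omega> = \<zeta> (p j) \<omega>"
    if "step_process M n p \<zeta>" "refinement n p l r c" "j < n" "c j \<le> i" "i < c (Suc j)" "r i \<le> x" "x < r (Suc i)"
      "\<omega> \<in> space M"
    for n p c i j x \<zeta> \<omega>
    using that(1) block[OF that(2-7)] that(3,8) unfolding step_process_def by blast
  have ri: "r i < r (Suc i)" if "i < l" for i using partition_strict[OF r(1), of i "Suc i"] that by auto
  have E: "isum w r (\<lambda>i. \<zeta> (r i)) l \<omega> = isum w p (\<lambda>j. \<zeta> (p j)) n \<omega>"
    if "step_process M n p \<zeta>" "refinement n p l r c" "\<omega> \<in> space M" for n p \<zeta> c \<omega>
  proof -
    have "isum w r (\<lambda>i. \<zeta> (r i)) (c n) \<omega> = isum w p (\<lambda>j. \<zeta> (p j)) n \<omega>"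
    proof (rule isum_refinement[OF that(2) order_refl])
      fix j i assume ji: "j < n" "c j \<le> i" "i < c (Suc j)"
      moreover have "i < l" using ji refinement_le[OF that(2), of "Suc j"] by auto
      ultimately show "\<zeta> (r i) \<omega> = \<zeta> (p j) \<omega>"
        using const[OF that(1,2) ji, of "r i"] ri[of i] that(3) by auto
    qed
    then show ?thesis using that(2) by (simp add: refinement_def)
  qed
  let ?V = "\<lambda>i \<omega>. \<zeta> (r i) \<omega> - \<eta> (r i) \<omega>"
  have sub: "isum w r ?V l \<omega> = isum w r (\<lambda>i. \<zeta> (r i)) l \<omega> - isum w r (\<lambda>i. \<eta> (r i)) l \<omega>" for \<omega>
    by (simp add: isum_def left_diff_distrib sum_subtractf)
  have "(ms_dist M (isum w p (\<lambda>j. \<zeta> (p j)) n) (isum w q (\<lambda>j. \<eta> (q j)) m))\<^sup>2 = (ms_norm M (isum w r ?V l))\<^sup>2"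
    using E[OF \<zeta>(1) r(2)] E[OF \<eta>(1) r(3)]
    by (intro arg_cong[where f = "\<lambda>x. x\<^sup>2"] ms_norm_cong) (auto simp: sub)
  also have "\<dots> \<le> (1 + T) * (\<Sum>i<l. (ms_norm M (?V i))\<^sup>2 * (r (Suc i) - r i))"
    using rin by (intro isum_integrator(2)[OF w r(1) ab] adapted_L2_diff \<zeta>(2) \<eta>(2)) auto
  also have "(\<Sum>i<l. (ms_norm M (?V i))\<^sup>2 * (r (Suc i) - r i)) =
      (LINT \<tau>:{a..b}|lborel. (\<integral>\<omega>. (\<zeta> \<tau> \<omega> - \<eta> \<tau> \<omega>)\<^sup>2 \<partial>M))"
  proof -
    have "(\<integral>\<omega>. (\<zeta> x \<omega> - \<eta> x \<omega>)\<^sup>2 \<partial>M) = (\<integral>\<omega>. (\<zeta> (r i) \<omega> - \<eta> (r i) \<omega>)\<^sup>2 \<partial>M)"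
      if i: "i < l" "r i \<le> x" "x < r (Suc i)" for i x
    proof (rule Bochner_Integration.integral_cong[OF refl])
      fix \<omega> assume \<omega>: "\<omega> \<in> space M"
      obtain j where j: "j < n" "c j \<le> i" "i < c (Suc j)" using refinement_locate[OF r(2) i(1)] by blast
      obtain k where k: "k < m" "e k \<le> i" "i < e (Suc k)" using refinement_locate[OF r(3) i(1)] by blast
      note ri[OF i(1)]
      then have "\<zeta> x \<omega> = \<zeta> (r i) \<omega>" "\<eta> x \<omega> = \<eta> (r i) \<omega>"
        using const[OF \<zeta>(1) r(2) j i(2,3) \<omega>] const[OF \<zeta>(1) r(2) j _ _ \<omega>, of "r i"]
          const[OF \<eta>(1) r(3) k i(2,3) \<omega>] const[OF \<eta>(1) r(3) k _ _ \<omega>, of "r i"] by auto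
      then show "(\<zeta> x \<omega> - \<eta> x \<omega>)\<^sup>2 = (\<zeta> (r i) \<omega> - \<eta> (r i) \<omega>)\<^sup>2" by simp
    qed
    from step_function_integral(2)[where g = "\<lambda>\<tau>. \<integral>\<omega>. (\<zeta> \<tau> \<omega> - \<eta> \<tau> \<omega>)\<^sup>2 \<partial>M", OF r(1) le this]
    show ?thesis by (simp add: ms_norm_square)
  qed
  finally show ?thesis .
qed

end

subsection \<open>Stochastic integrals of mean-square continuous processes\<close>

text \<open>Makes both \<open>s\<close> and \<open>u\<close> nodes of one fine partition, so that
  integrals up to \<open>s\<close> and up to \<open>u\<close> can be compared through partial sums.
  Strictness of partitions forces the separate treatment of \<open>s = a\<close> and
  \<open>s = u\<close>.\<close>

lemma partition_through:
  assumes "a \<le> s" "s \<le> u" "0 < d"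
  obtains l r i where "interval_partition a u l r" "mesh l r < d" "i \<le> l" "r i = s"
proof -
  have au: "a \<le> u" using assms by simp
  show thesis
  proof (cases "a < s \<and> s < u")
    case True
    define p where "p = (\<lambda>j::nat. if j = 0 then a else if j = 1 then s else u)"
    have "interval_partition a u 2 p"
      using True by (auto simp: interval_partition_def p_def less_2_cases_iff)
    then obtain l r c where "interval_partition a u l r" "refinement 2 p l r c" "mesh l r < d"
      using fine_refinement_exists[OF _ au assms(3)] by metis
    moreover from this(2) have "r (c 1) = s" "c 1 \<le> l"
      using refinement_le[of 2 p l r c 1] by (auto simp: refinement_def p_def)
    ultimately show thesis using that by blast
  next
    case False
    obtain l r where r: "interval_partition a u l r" "mesh l r < d"
      using partition_exists[OF au assms(3)] by blast
    from False assms consider "s = a" | "s = u" by linarith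
    then show thesis
    proof cases
      case 1
      then show thesis using that[OF r, of 0] r(1) by (auto simp: interval_partition_def)
    next
      case 2
      then show thesis using that[OF r, of l] r(1) by (auto simp: interval_partition_def)
    qed
  qed
qed

lemma isum_split:
  "isum w q Z (i + m) \<omega> = isum w q Z i \<omega> + isum w (\<lambda>j. q (i + j)) (\<lambda>j. Z (i + j)) m \<omega>"
  by (induction m) (auto simp: isum_def)

lemma ms_continuous_mult:
  assumes g: "continuous_on {a..b} g" and \<xi>: "ms_continuous M a b \<xi>"
  shows "ms_continuous M a b (\<lambda>\<tau> \<omega>. g \<tau> * \<xi> \<tau> \<omega>)"
  unfolding ms_continuous_def
proof (intro ballI conjI)
  note sq = ms_continuous_square_integrable[OF \<xi>]
  fix \<tau> assume \<tau>: "\<tau> \<in> {a..b}"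
  then show "square_integrable M (\<lambda>\<omega>. g \<tau> * \<xi> \<tau> \<omega>)" by (intro square_integrable_cmult sq)
  have g': "(g \<longlongrightarrow> g \<tau>) (at \<tau> within {a..b})"
    using g \<tau> by (simp add: continuous_on)
  have \<xi>': "((\<lambda>s. ms_dist M (\<xi> s) (\<xi> \<tau>)) \<longlongrightarrow> 0) (at \<tau> within {a..b})"
    using \<xi> \<tau> by (auto simp: ms_continuous_def)
  have "((\<lambda>s. \<bar>g s\<bar> * ms_dist M (\<xi> s) (\<xi> \<tau>) + \<bar>g s - g \<tau>\<bar> * ms_norm M (\<xi> \<tau>)) \<longlongrightarrow>
      \<bar>g \<tau>\<bar> * 0 + \<bar>g \<tau> - g \<tau>\<bar> * ms_norm M (\<xi> \<tau>)) (at \<tau> within {a..b})"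
    by (intro tendsto_intros g' \<xi>')
  then have lim: "((\<lambda>s. \<bar>g s\<bar> * ms_dist M (\<xi> s) (\<xi> \<tau>) + \<bar>g s - g \<tau>\<bar> * ms_norm M (\<xi> \<tau>)) \<longlongrightarrow> 0)
      (at \<tau> within {a..b})" by simp
  have le: "ms_norm M (\<lambda>\<omega>. g s * \<xi> s \<omega> - g \<tau> * \<xi> \<tau> \<omega>) \<le>
      \<bar>g s\<bar> * ms_dist M (\<xi> s) (\<xi> \<tau>) + \<bar>g s - g \<tau>\<bar> * ms_norm M (\<xi> \<tau>)" if "s \<in> {a..b}" for s
  proof -
    have "ms_norm M (\<lambda>\<omega>. g s * (\<xi> s \<omega> - \<xi> \<tau> \<omega>) + (g s - g \<tau>) * \<xi> \<tau> \<omega>) \<le>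
        ms_norm M (\<lambda>\<omega>. g s * (\<xi> s \<omega> - \<xi> \<tau> \<omega>)) + ms_norm M (\<lambda>\<omega>. (g s - g \<tau>) * \<xi> \<tau> \<omega>)"
      by (intro ms_norm_triangle square_integrable_cmult square_integrable_diff sq that \<tau>)
    then show ?thesis unfolding ms_norm_cmult by (simp add: algebra_simps)
  qed
  show "((\<lambda>s. ms_norm M (\<lambda>\<omega>. g s * \<xi> s \<omega> - g \<tau> * \<xi> \<tau> \<omega>)) \<longlongrightarrow> 0) (at \<tau> within {a..b})"
    by (rule tendsto_sandwich[OF _ _ tendsto_const lim]) (auto simp: eventually_at_filter le)
qed

context wiener_space
begin

lemma is_stochastic_integral_isum:
  "is_stochastic_integral M T F f w \<xi> a b X \<longleftrightarrow>
     \<xi> \<in> M2_class M T F f a b \<and>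
     (\<exists>n p \<zeta>.
        (\<forall>N. interval_partition a b (n N) (p N) \<and> step_process M (n N) (p N) (\<zeta> N) \<and>
             \<zeta> N \<in> M2_class M T F f a b) \<and>
        (\<lambda>N. LINT \<tau>:{a..b}|lborel. (\<integral>\<omega>. (\<zeta> N \<tau> \<omega> - \<xi> \<tau> \<omega>)\<^sup>2 \<partial>M)) \<longlonglongrightarrow> 0 \<and>
        ms_limit M (\<lambda>N. isum w (p N) (\<lambda>j. \<zeta> N (p N j)) (n N)) X)"
  unfolding is_stochastic_integral_def isum_def[abs_def] ..

lemma is_stochastic_integral_M2_class:
  "is_stochastic_integral M T F f w \<xi> a b X \<Longrightarrow> \<xi> \<in> M2_class M T F f a b"
  by (simp add: is_stochastic_integral_def)

lemma is_stochastic_integral_square_integrable: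
  "is_stochastic_integral M T F f w \<xi> a b X \<Longrightarrow> square_integrable M X"
  by (auto simp: is_stochastic_integral_def ms_limit_def)

lemma is_stochastic_integral_cong_AE:
  assumes "is_stochastic_integral M T F f w \<xi> a b X" "Y \<in> borel_measurable M" "AE \<omega> in M. X \<omega> = Y \<omega>"
  shows "is_stochastic_integral M T F f w \<xi> a b Y"
  using assms(1) ms_limit_cong_AE[OF _ assms(2,3)] unfolding is_stochastic_integral_def by blast

lemma isum_step_approx:
  assumes "interval_partition a b n p"
  shows "isum w p (\<lambda>j. step_approx n p \<xi> (p j)) n = isum w p (\<lambda>j. \<xi> (p j)) n"
proof -
  have "step_approx n p \<xi> (p j) = \<xi> (p j)" if "j < n" for j
    using assms that by (intro step_approx_eq[OF assms that]) (auto simp: interval_partition_def)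
  then show ?thesis by (auto simp: isum_def fun_eq_iff)
qed

text \<open>The Riemann sum is the sum of the step approximation of \<xi>, which is compared with
  the sequence defining \<open>X\<close> by \<open>step_sums_distance\<close>; then the sequence
  index tends to infinity. The bound depends on the partition only through the oscillation of \<xi>
  over its mesh, which is the source of all later uniformity.\<close>

lemma riemann_sum_error:
  assumes w: "integrator w" and ab: "t \<le> a" "b \<le> T" and p: "interval_partition a b n p"
    and X: "is_stochastic_integral M T F f w \<xi> a b X"
    and B: "\<And>\<tau>. \<tau> \<in> {a..b} \<Longrightarrow> ms_norm M (\<xi> \<tau>) \<le> B"
    and e: "0 \<le> e" "\<And>u v. u \<in> {a..b} \<Longrightarrow> v \<in> {a..b} \<Longrightarrow> \<bar>u - v\<bar> \<le> mesh n p \<Longrightarrow>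
      ms_dist M (\<xi> u) (\<xi> v) \<le> e"
  shows "ms_dist M (isum w p (\<lambda>j. \<xi> (p j)) n) X \<le> 2 * (1 + T) * e"
proof -
  have le: "a \<le> b" using partition_bounds[OF p, of 0] by auto
  have T: "0 \<le> T" using t_nonneg t_le_T by simp
  note \<xi> = is_stochastic_integral_M2_class[OF X]
  note ad = M2_class_adapted_L2[OF \<xi>]
  have pin: "p j \<in> {a..b}" if "j \<le> n" for j using partition_bounds[OF p that] by auto
  obtain k q \<zeta> where \<zeta>: "\<And>N. interval_partition a b (k N) (q N)" "\<And>N. step_process M (k N) (q N) (\<zeta> N)"
      "\<And>N. \<zeta> N \<in> M2_class M T F f a b"
    and g: "(\<lambda>N. LINT \<tau>:{a..b}|lborel. (\<integral>\<omega>. (\<zeta> N \<tau> \<omega> - \<xi> \<tau> \<omega>)\<^sup>2 \<partial>M)) \<longlonglongrightarrow> 0" (is "?g \<longlonglongrightarrow> 0")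
    and lim: "ms_limit M (\<lambda>N. isum w (q N) (\<lambda>j. \<zeta> N (q N j)) (k N)) X" (is "ms_limit M ?I X")
    using X unfolding is_stochastic_integral_isum by blast
  define \<eta> where "\<eta> = step_approx n p \<xi>"
  define R where "R = isum w p (\<lambda>j. \<xi> (p j)) n"
  have \<eta>: "\<eta> \<in> M2_class M T F f a b"
    unfolding \<eta>_def by (rule step_approx_M2_class[OF ab p ad B])
  have R: "square_integrable M R"
    unfolding R_def using ad pin by (intro adapted_L2_sq[OF isum_integrator(1)[OF w p ab order_refl]]) auto
  have \<eta>\<xi>: "(LINT \<tau>:{a..b}|lborel. (\<integral>\<omega>. (\<eta> \<tau> \<omega> - \<xi> \<tau> \<omega>)\<^sup>2 \<partial>M)) \<le> (b - a) * e\<^sup>2"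
  proof (rule set_integral_diff_le[OF \<eta> \<xi> le e(1)])
    fix \<tau> assume \<tau>: "\<tau> \<in> {a..b}"
    then obtain u where "u \<in> {a..b}" "u \<le> \<tau>" "\<tau> - u \<le> mesh n p" "\<eta> \<tau> = \<xi> u"
      using step_approx_point[OF p] unfolding \<eta>_def by metis
    with e(2)[of u \<tau>] \<tau> show "ms_dist M (\<eta> \<tau>) (\<xi> \<tau>) \<le> e" by auto
  qed
  have I: "square_integrable M (?I N)" "square_integrable M X" for N
    using lim by (auto simp: ms_limit_def)
  have "ms_dist M R (?I N) \<le> sqrt ((1 + T) * (2 * ((b - a) * e\<^sup>2) + 2 * ?g N))" for N
  proof (rule real_le_rsqrt)
    have "(ms_dist M R (?I N))\<^sup>2 \<le> (1 + T) * (LINT \<tau>:{a..b}|lborel. (\<integral>\<omega>. (\<eta> \<tau> \<omega> - \<zeta> N \<tau> \<omega>)\<^sup>2 \<partial>M))"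
      using step_sums_distance[OF w ab p \<zeta>(1) _ _ \<zeta>(2), of \<eta>] step_process_step_approx[OF p, of M \<xi>]
        M2_class_adapted_L2[OF \<eta>] M2_class_adapted_L2[OF \<zeta>(3)] isum_step_approx[OF p, of w \<xi>]
      by (simp add: \<eta>_def R_def)
    also have "\<dots> \<le> (1 + T) * (2 * (LINT \<tau>:{a..b}|lborel. (\<integral>\<omega>. (\<eta> \<tau> \<omega> - \<xi> \<tau> \<omega>)\<^sup>2 \<partial>M)) + 2 * ?g N)"
      using T by (intro mult_left_mono set_integral_diff_triangle[OF \<eta> \<xi> \<zeta>(3)]) auto
    also have "\<dots> \<le> (1 + T) * (2 * ((b - a) * e\<^sup>2) + 2 * ?g N)"
      using T \<eta>\<xi> by (intro mult_left_mono add_mono) auto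
    finally show "(ms_dist M R (?I N))\<^sup>2 \<le> (1 + T) * (2 * ((b - a) * e\<^sup>2) + 2 * ?g N)" .
  qed
  then have "ms_dist M R X \<le>
      sqrt ((1 + T) * (2 * ((b - a) * e\<^sup>2) + 2 * ?g N)) + ms_dist M (?I N) X" for N
    using ms_norm_triangle_diff[OF R I(1)[of N] I(2)] by (meson add_right_mono order_trans)
  moreover have "(\<lambda>N. sqrt ((1 + T) * (2 * ((b - a) * e\<^sup>2) + 2 * ?g N)) + ms_dist M (?I N) X)
      \<longlonglongrightarrow> sqrt ((1 + T) * (2 * ((b - a) * e\<^sup>2) + 2 * 0)) + 0"
    using lim unfolding ms_limit_iff_ms_norm by (intro tendsto_intros g) auto
  ultimately have "ms_dist M R X \<le> sqrt ((1 + T) * (2 * ((b - a) * e\<^sup>2) + 2 * 0)) + 0"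
    by (intro LIMSEQ_le_const) auto
  also have "\<dots> \<le> 2 * (1 + T) * e"
  proof -
    \<comment> \<open>Replacing \<open>b - a\<close> by \<open>2 * (1 + T)\<close> completes a
      square, so that the root disappears.\<close>
    have "(1 + T) * (2 * ((b - a) * e\<^sup>2)) \<le> (1 + T) * (2 * ((2 * (1 + T)) * e\<^sup>2))"
      using T t_nonneg ab by (intro mult_left_mono mult_right_mono) auto
    also have "\<dots> = (2 * (1 + T) * e)\<^sup>2" by (simp add: power2_eq_square)
    finally have "sqrt ((1 + T) * (2 * ((b - a) * e\<^sup>2))) \<le> sqrt ((2 * (1 + T) * e)\<^sup>2)"
      by (rule real_sqrt_le_mono)
    also have "\<dots> = 2 * (1 + T) * e" using T e(1) by simp
    finally show ?thesis by simp
  qed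
  finally show ?thesis by (simp add: R_def)
qed

text \<open>The modulus of continuity of \<xi> on all of \<open>{a..b}\<close> serves every
  subinterval, hence one \<open>d\<close> works for all partitions and all end nodes at once. Nested
  sums need this because they contain every partial sum of the inner integral.\<close>

lemma riemann_sums_uniform:
  assumes w: "integrator w" and ab: "t \<le> a" "b \<le> T" and \<xi>: "ms_continuous M a b \<xi>"
    and Y: "\<And>s. s \<in> {a..b} \<Longrightarrow> is_stochastic_integral M T F f w \<xi> a s (Y s)" and e: "0 < e"
  obtains d where "0 < d" "\<And>n p i. interval_partition a b n p \<Longrightarrow> mesh n p < d \<Longrightarrow> i \<le> n \<Longrightarrow>
    ms_dist M (isum w p (\<lambda>j. \<xi> (p j)) i) (Y (p i)) < e"
proof -
  have T: "0 \<le> T" using t_nonneg t_le_T by simp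
  define e' where "e' = e / (4 * (1 + T))"
  have e': "0 < e'" using e T by (simp add: e'_def)
  obtain B where B: "\<And>\<tau>. \<tau> \<in> {a..b} \<Longrightarrow> ms_norm M (\<xi> \<tau>) \<le> B"
    using ms_continuous_bounded[OF \<xi>] by blast
  obtain d where d: "0 < d" "\<And>u v. u \<in> {a..b} \<Longrightarrow> v \<in> {a..b} \<Longrightarrow> \<bar>u - v\<bar> < d \<Longrightarrow>
      ms_dist M (\<xi> u) (\<xi> v) < e'"
    using ms_continuous_modulus[OF \<xi> e'] by blast
  show thesis
  proof (rule that[OF d(1)])
    fix n p i assume p: "interval_partition a b n p" "mesh n p < d" "i \<le> n"
    have pi: "a \<le> p i" "p i \<le> b" using partition_bounds[OF p(1,3)] by auto
    have "ms_dist M (isum w p (\<lambda>j. \<xi> (p j)) i) (Y (p i)) \<le> 2 * (1 + T) * e'"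
    proof (rule riemann_sum_error[OF w ab(1) _ partition_take[OF p(1,3)]])
      show "p i \<le> T" using pi ab by simp
      show "is_stochastic_integral M T F f w \<xi> a (p i) (Y (p i))" using Y pi by simp
      show "ms_norm M (\<xi> \<tau>) \<le> B" if "\<tau> \<in> {a..p i}" for \<tau> using B that pi by auto
      show "ms_dist M (\<xi> u) (\<xi> v) \<le> e'"
        if "u \<in> {a..p i}" "v \<in> {a..p i}" "\<bar>u - v\<bar> \<le> mesh i p" for u v
        using d(2)[of u v] that pi mesh_take[OF p(1,3)] p(2) by auto
    qed (use e' in simp)
    also have "\<dots> = e / 2" using T by (simp add: e'_def divide_simps)
    also have "\<dots> < e" using e by simp
    finally show "ms_dist M (isum w p (\<lambda>j. \<xi> (p j)) i) (Y (p i)) < e" .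
  qed
qed

text \<open>Additivity of the integral over adjacent intervals is bypassed: along a partition
  through \<open>s\<close> the difference of the two Riemann sums is a sum over
  \<open>[s,u]\<close>, to which the isometry bound applies. The approximation costs
  \<open>e / 2\<close> at each end.\<close>

lemma integral_increment_bound:
  assumes w: "integrator w" and ab: "t \<le> a" "u \<le> T" "a \<le> s" "s \<le> u" and \<xi>: "ms_continuous M a u \<xi>"
    and Y: "\<And>s. s \<in> {a..u} \<Longrightarrow> is_stochastic_integral M T F f w \<xi> a s (Y s)"
    and B: "\<And>\<tau>. \<tau> \<in> {a..u} \<Longrightarrow> ms_norm M (\<xi> \<tau>) \<le> B" "0 \<le> B"
  shows "ms_dist M (Y u) (Y s) \<le> sqrt ((1 + T) * (u - s)) * B"
proof (rule field_le_epsilon)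
  fix e :: real assume "0 < e"
  have T: "0 \<le> T" using t_nonneg t_le_T by simp
  have ad: "adapted_L2 \<tau> (\<xi> \<tau>)" if "\<tau> \<in> {a..u}" for \<tau>
    using M2_class_adapted_L2[OF is_stochastic_integral_M2_class[OF Y[of u]] that] ab by simp
  obtain d where d: "0 < d" "\<And>n p i. interval_partition a u n p \<Longrightarrow> mesh n p < d \<Longrightarrow> i \<le> n \<Longrightarrow>
      ms_dist M (isum w p (\<lambda>j. \<xi> (p j)) i) (Y (p i)) < e / 2"
    using riemann_sums_uniform[OF w ab(1,2) \<xi> Y, of "e / 2"] \<open>0 < e\<close> by auto
  obtain l r i where r: "interval_partition a u l r" "mesh l r < d" "i \<le> l" "r i = s"
    using partition_through[OF ab(3,4) d(1)] by blast
  have rl: "r l = u" using r(1) by (simp add: interval_partition_def)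
  define R where "R m = isum w r (\<lambda>j. \<xi> (r j)) m" for m
  define D where "D = isum w (\<lambda>j. r (i + j)) (\<lambda>j. \<xi> (r (i + j))) (l - i)"
  have rin: "r j \<in> {a..u}" if "j \<le> l" for j using partition_bounds[OF r(1) that] by auto
  have R: "square_integrable M (R m)" if "m \<le> l" for m
    unfolding R_def using ad rin
    by (intro adapted_L2_sq[OF isum_integrator(1)[OF w r(1) ab(1,2) that]]) auto
  have split: "R l \<omega> = R i \<omega> + D \<omega>" for \<omega>
    using isum_split[of w r "\<lambda>j. \<xi> (r j)" i "l - i" \<omega>] r(3) by (simp add: R_def D_def)
  have dr: "interval_partition s u (l - i) (\<lambda>j. r (i + j))"
    using partition_drop[OF r(1,3)] r(4) by simp
  have ts: "t \<le> s" using ab by simp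
  have adr: "adapted_L2 (r (i + j)) (\<xi> (r (i + j)))" if "j < l - i" for j
    using that rin by (intro ad) auto
  have D: "(ms_norm M D)\<^sup>2 \<le> (1 + T) * (\<Sum>j<l - i. (ms_norm M (\<xi> (r (i + j))))\<^sup>2 * (r (i + Suc j) - r (i + j)))"
    unfolding D_def by (rule isum_integrator(2)[OF w dr ts ab(2) order_refl adr])
  also have "(\<Sum>j<l - i. (ms_norm M (\<xi> (r (i + j))))\<^sup>2 * (r (i + Suc j) - r (i + j))) \<le>
      (\<Sum>j<l - i. B\<^sup>2 * (r (i + Suc j) - r (i + j)))"
    using rin B partition_mono[OF r(1), of "i + _" "i + Suc _"]
    by (intro sum_mono mult_right_mono power_mono) auto
  also have "\<dots> = B\<^sup>2 * (u - s)"
    using sum_lessThan_telescope[of "\<lambda>j. r (i + j)" "l - i"] r(3,4) rl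
    by (simp add: sum_distrib_left[symmetric])
  finally have "(ms_norm M D)\<^sup>2 \<le> (1 + T) * (B\<^sup>2 * (u - s))" using T by simp
  also have "\<dots> = (sqrt ((1 + T) * (u - s)) * B)\<^sup>2"
    using T ab by (simp add: power_mult_distrib)
  finally have Dle: "ms_norm M D \<le> sqrt ((1 + T) * (u - s)) * B"
    by (rule power2_le_imp_le) (use B(2) T ab in auto)
  have sqY: "square_integrable M (Y u)" "square_integrable M (Y s)"
    using is_stochastic_integral_square_integrable[OF Y] ab by auto
  have e1: "ms_dist M (R l) (Y u) < e / 2"
    using d(2)[OF r(1,2) order_refl] rl by (simp add: R_def)
  have e2: "ms_dist M (R i) (Y s) < e / 2"
    using d(2)[OF r(1,2,3)] r(4) by (simp add: R_def)
  have "ms_dist M (Y u) (Y s) \<le> ms_dist M (Y u) (R l) + ms_dist M (R l) (Y s)"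
    by (rule ms_norm_triangle_diff[OF sqY(1) R[OF order_refl] sqY(2)])
  also have "ms_dist M (R l) (Y s) \<le> ms_dist M (R l) (R i) + ms_dist M (R i) (Y s)"
    by (rule ms_norm_triangle_diff[OF R[OF order_refl] R[OF r(3)] sqY(2)])
  also have "ms_dist M (R l) (R i) = ms_norm M D" by (simp add: split)
  finally show "ms_dist M (Y u) (Y s) \<le> sqrt ((1 + T) * (u - s)) * B + e"
    using e1 e2 Dle ms_norm_minus_commute[of M "Y u" "R l"] by simp
qed

lemma integral_ms_continuous:
  assumes w: "integrator w" and ab: "t \<le> a" "b \<le> T" and \<xi>: "ms_continuous M a b \<xi>"
    and Y: "\<And>s. s \<in> {a..b} \<Longrightarrow> is_stochastic_integral M T F f w \<xi> a s (Y s)"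
  shows "ms_continuous M a b Y"
  unfolding ms_continuous_def
proof (intro ballI conjI)
  fix \<tau> assume \<tau>: "\<tau> \<in> {a..b}"
  show "square_integrable M (Y \<tau>)" by (rule is_stochastic_integral_square_integrable[OF Y[OF \<tau>]])
  obtain B where B: "0 < B" "\<And>\<tau>. \<tau> \<in> {a..b} \<Longrightarrow> ms_norm M (\<xi> \<tau>) \<le> B"
    using ms_continuous_bounded[OF \<xi>] by blast
  have *: "ms_dist M (Y u) (Y s) \<le> sqrt ((1 + T) * (u - s)) * B"
    if "s \<in> {a..b}" "u \<in> {a..b}" "s \<le> u" for s u
    using that ab B Y
    by (intro integral_increment_bound[OF w ab(1) _ _ _ ms_continuous_subset[OF \<xi>]]) auto
  have le: "ms_dist M (Y s) (Y \<tau>) \<le> sqrt ((1 + T) * \<bar>s - \<tau>\<bar>) * B" if "s \<in> {a..b}" for s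
  proof (cases "s \<le> \<tau>")
    case True
    then show ?thesis using *[OF that \<tau> True] by (simp add: ms_norm_minus_commute[of M "Y s"] abs_if)
  next
    case False
    then show ?thesis using *[OF \<tau> that] by simp
  qed
  have "((\<lambda>s. sqrt ((1 + T) * \<bar>s - \<tau>\<bar>) * B) \<longlongrightarrow> sqrt ((1 + T) * \<bar>\<tau> - \<tau>\<bar>) * B) (at \<tau> within {a..b})"
    by (intro tendsto_intros)
  then have lim: "((\<lambda>s. sqrt ((1 + T) * \<bar>s - \<tau>\<bar>) * B) \<longlongrightarrow> 0) (at \<tau> within {a..b})" by simp
  show "((\<lambda>s. ms_dist M (Y s) (Y \<tau>)) \<longlongrightarrow> 0) (at \<tau> within {a..b})"
    by (rule tendsto_sandwich[OF _ _ tendsto_const lim]) (auto simp: eventually_at_filter le)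
qed

text \<open>The geometric rate is the one required by \<open>AE_tendsto_of_ms_norm\<close> and
  \<open>square_integrable_complete\<close>; \<open>c\<close> makes room for the constants that
  arise before these are applied.\<close>

lemma fast_step_approximations:
  assumes ab: "a \<le> b" and \<xi>: "ms_continuous M a b \<xi>" and c: "0 < c"
  obtains n p where "\<And>N. interval_partition a b (n N) (p N)"
    "\<And>N \<tau>. \<tau> \<in> {a..b} \<Longrightarrow> ms_dist M (step_approx (n N) (p N) \<xi> \<tau>) (\<xi> \<tau>) \<le> c * (1/2) ^ N"
proof -
  have "\<exists>n p. interval_partition a b n p \<and>
      (\<forall>\<tau>\<in>{a..b}. ms_dist M (step_approx n p \<xi> \<tau>) (\<xi> \<tau>) \<le> c * (1/2) ^ N)" for N
  proof -
    have e: "0 < c * (1/2) ^ N" using c by simp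
    obtain d where d: "0 < d" "\<And>u v. u \<in> {a..b} \<Longrightarrow> v \<in> {a..b} \<Longrightarrow> \<bar>u - v\<bar> < d \<Longrightarrow>
        ms_dist M (\<xi> u) (\<xi> v) < c * (1/2) ^ N"
      using ms_continuous_modulus[OF \<xi> e] by blast
    obtain n p where p: "interval_partition a b n p" "mesh n p < d"
      using partition_exists[OF ab d(1)] by blast
    have "ms_dist M (step_approx n p \<xi> \<tau>) (\<xi> \<tau>) \<le> c * (1/2) ^ N" if \<tau>: "\<tau> \<in> {a..b}" for \<tau>
    proof -
      obtain u where u: "u \<in> {a..b}" "u \<le> \<tau>" "\<tau> - u \<le> mesh n p" "step_approx n p \<xi> \<tau> = \<xi> u"
        using step_approx_point[OF p(1) \<tau>] by metis
      have "\<bar>u - \<tau>\<bar> < d" using u(2,3) p(2) by linarith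
      from d(2)[OF u(1) \<tau> this] show ?thesis unfolding u(4) by simp
    qed
    with p show ?thesis by blast
  qed
  then obtain n p where "\<And>N. interval_partition a b (n N) (p N) \<and>
      (\<forall>\<tau>\<in>{a..b}. ms_dist M (step_approx (n N) (p N) \<xi> \<tau>) (\<xi> \<tau>) \<le> c * (1/2) ^ N)"
    by metis
  then show thesis using that[of n p] by blast
qed

lemma stochastic_integral_exists:
  assumes w: "integrator w" and ab: "t \<le> a" "a \<le> b" "b \<le> T"
    and \<xi>: "\<xi> \<in> M2_class M T F f a b" "ms_continuous M a b \<xi>"
  obtains X where "adapted_L2 b X" "is_stochastic_integral M T F f w \<xi> a b X"
proof -
  have T: "0 \<le> T" using t_nonneg t_le_T by simp
  \<comment> \<open>Two approximating processes differ by at most \<open>2 * c * (1/2) ^ N\<close>,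
    and passing to their sums costs at most the factor \<open>1 + T\<close> in norm; this
    \<open>c\<close> leaves exactly \<open>(1/2) ^ N\<close>.\<close>
  define c where "c = 1 / (2 * (1 + T))"
  have c: "0 < c" using T by (simp add: c_def)
  note ad = M2_class_adapted_L2[OF \<xi>(1)]
  obtain B where B: "\<And>\<tau>. \<tau> \<in> {a..b} \<Longrightarrow> ms_norm M (\<xi> \<tau>) \<le> B"
    using ms_continuous_bounded[OF \<xi>(2)] by blast
  obtain n p where p: "\<And>N. interval_partition a b (n N) (p N)"
    and le: "\<And>N \<tau>. \<tau> \<in> {a..b} \<Longrightarrow> ms_dist M (step_approx (n N) (p N) \<xi> \<tau>) (\<xi> \<tau>) \<le> c * (1/2) ^ N"
    using fast_step_approximations[OF ab(2) \<xi>(2) c] by blast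
  define \<zeta> where "\<zeta> N = step_approx (n N) (p N) \<xi>" for N
  define I where "I N = isum w (p N) (\<lambda>j. \<zeta> N (p N j)) (n N)" for N
  have \<zeta>: "\<zeta> N \<in> M2_class M T F f a b" for N
    unfolding \<zeta>_def by (rule step_approx_M2_class[OF ab(1,3) p ad B])
  have st: "step_process M (n N) (p N) (\<zeta> N)" for N
    unfolding \<zeta>_def by (rule step_process_step_approx[OF p])
  have pin: "p N j \<in> {a..b}" if "j \<le> n N" for N j using partition_bounds[OF p that] by auto
  have pn: "p N (n N) = b" for N using p[of N] by (simp add: interval_partition_def)
  have I: "adapted_L2 b (I N)" for N
    using isum_integrator(1)[OF w p ab(1,3) order_refl, of N "\<lambda>j. \<zeta> N (p N j)"] M2_class_adapted_L2[OF \<zeta>] pin pn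
    by (simp add: I_def)
  have dist: "ms_dist M (I N) (I K) \<le> (1/2) ^ N" if "N \<le> K" for N K
  proof -
    have "(LINT \<tau>:{a..b}|lborel. (\<integral>\<omega>. (\<zeta> N \<tau> \<omega> - \<zeta> K \<tau> \<omega>)\<^sup>2 \<partial>M)) \<le> (b - a) * (2 * (c * (1/2) ^ N))\<^sup>2"
    proof (rule set_integral_diff_le[OF \<zeta> \<zeta> ab(2)])
      fix \<tau> assume \<tau>: "\<tau> \<in> {a..b}"
      have "ms_dist M (\<zeta> N \<tau>) (\<zeta> K \<tau>) \<le>
          ms_dist M (\<zeta> N \<tau>) (\<xi> \<tau>) + ms_dist M (\<xi> \<tau>) (\<zeta> K \<tau>)"
        by (intro ms_norm_triangle_diff adapted_L2_sq[OF M2_class_adapted_L2[OF \<zeta> \<tau>]] adapted_L2_sq[OF ad[OF \<tau>]])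
      also have "\<dots> \<le> c * (1/2) ^ N + c * (1/2) ^ K"
        using le[OF \<tau>, of N] le[OF \<tau>, of K] ms_norm_minus_commute[of M "\<xi> \<tau>" "\<zeta> K \<tau>"]
        unfolding \<zeta>_def by linarith
      also have "c * (1/2) ^ K \<le> c * (1/2) ^ N"
        using c that by (intro mult_left_mono power_decreasing) auto
      finally show "ms_dist M (\<zeta> N \<tau>) (\<zeta> K \<tau>) \<le> 2 * (c * (1/2) ^ N)" by simp
    qed (use c in simp)
    also have "\<dots> \<le> (1 + T) * (2 * (c * (1/2) ^ N))\<^sup>2"
      using ab t_nonneg by (intro mult_right_mono) auto
    finally have "(1 + T) * (LINT \<tau>:{a..b}|lborel. (\<integral>\<omega>. (\<zeta> N \<tau> \<omega> - \<zeta> K \<tau> \<omega>)\<^sup>2 \<partial>M)) \<le>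
        (1 + T) * ((1 + T) * (2 * (c * (1/2) ^ N))\<^sup>2)"
      using T by (intro mult_left_mono) auto
    also have "\<dots> = (2 * (1 + T) * c * (1/2) ^ N)\<^sup>2" by (simp only: power2_eq_square algebra_simps)
    also have "2 * (1 + T) * c = 1" using T by (simp add: c_def)
    finally have "(ms_dist M (I N) (I K))\<^sup>2 \<le> (1 * (1/2) ^ N)\<^sup>2"
      using step_sums_distance[OF w ab(1,3) p p st M2_class_adapted_L2[OF \<zeta>] st M2_class_adapted_L2[OF \<zeta>], of N K]
      unfolding I_def by (rule order_trans[rotated])
    then have "ms_dist M (I N) (I K) \<le> 1 * (1/2) ^ N" by (rule power2_le_imp_le) simp
    then show ?thesis by simp
  qed
  obtain X where X: "X \<in> borel_measurable (F b)" "ms_limit M I X"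
    using square_integrable_complete[OF F_subalgebra[of b] adapted_L2_meas[OF I] adapted_L2_sq[OF I] dist] ab by auto
  have "(\<lambda>N. LINT \<tau>:{a..b}|lborel. (\<integral>\<omega>. (\<zeta> N \<tau> \<omega> - \<xi> \<tau> \<omega>)\<^sup>2 \<partial>M)) \<longlonglongrightarrow> 0"
  proof (rule tendsto_sandwich[OF _ _ tendsto_const])
    show "\<forall>\<^sub>F N in sequentially. 0 \<le> (LINT \<tau>:{a..b}|lborel. (\<integral>\<omega>. (\<zeta> N \<tau> \<omega> - \<xi> \<tau> \<omega>)\<^sup>2 \<partial>M))"
      by (intro always_eventually allI) (auto simp: set_lebesgue_integral_def intro!: Bochner_Integration.integral_nonneg)
    show "\<forall>\<^sub>F N in sequentially. (LINT \<tau>:{a..b}|lborel. (\<integral>\<omega>. (\<zeta> N \<tau> \<omega> - \<xi> \<tau> \<omega>)\<^sup>2 \<partial>M)) \<le>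
        (b - a) * (c * (1/2) ^ N)\<^sup>2"
      using c le by (intro always_eventually allI set_integral_diff_le[OF \<zeta> \<xi>(1) ab(2)]) (auto simp: \<zeta>_def)
    have "(\<lambda>N. (b - a) * (c * (1/2) ^ N)\<^sup>2) \<longlonglongrightarrow> (b - a) * (c * 0)\<^sup>2"
      by (intro tendsto_intros LIMSEQ_power_zero) auto
    then show "(\<lambda>N. (b - a) * (c * (1/2) ^ N)\<^sup>2) \<longlonglongrightarrow> 0" by simp
  qed
  then have "is_stochastic_integral M T F f w \<xi> a b X"
    unfolding is_stochastic_integral_isum using \<xi>(1) p st \<zeta> X(2)[unfolded I_def[abs_def]] by blast
  moreover have "adapted_L2 b X" using X by (simp add: adapted_L2_def ms_limit_def)
  ultimately show thesis using that by blast
qed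

text \<open>Integrals over the subintervals are only determined up to null sets;
  a jointly measurable adapted version is the pointwise limit of step approximations.\<close>
lemma integral_process_exists:
  assumes w: "integrator w" and ab: "t \<le> a" "a \<le> b" "b \<le> T"
    and \<xi>: "\<xi> \<in> M2_class M T F f a b" "ms_continuous M a b \<xi>"
  obtains Y where "\<And>s. s \<in> {a..b} \<Longrightarrow> is_stochastic_integral M T F f w \<xi> a s (Y s)"
    "\<And>s. s \<in> {a..b} \<Longrightarrow> adapted_L2 s (Y s)" "jointly_measurable M a b Y" "ms_continuous M a b Y"
proof -
  have "\<exists>X. adapted_L2 s X \<and> is_stochastic_integral M T F f w \<xi> a s X" if "s \<in> {a..b}" for s
    using stochastic_integral_exists[OF w ab(1) _ _ M2_class_subset[OF \<xi>(1)]
        ms_continuous_subset[OF \<xi>(2)], of s] that ab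
    by auto
  then obtain Z where Z: "\<And>s. s \<in> {a..b} \<Longrightarrow> adapted_L2 s (Z s)"
    "\<And>s. s \<in> {a..b} \<Longrightarrow> is_stochastic_integral M T F f w \<xi> a s (Z s)" by metis
  \<comment> \<open>Mean-square continuity does not depend on the choice of versions, so it already
    holds for the arbitrary \<open>Z\<close> and permits its approximation by step
    processes.\<close>
  have Zc: "ms_continuous M a b Z" by (rule integral_ms_continuous[OF w ab(1,3) \<xi>(2) Z(2)])
  obtain n p where p: "\<And>N. interval_partition a b (n N) (p N)"
    and le: "\<And>N \<tau>. \<tau> \<in> {a..b} \<Longrightarrow> ms_dist M (step_approx (n N) (p N) Z \<tau>) (Z \<tau>) \<le> 1 * (1/2) ^ N"
    using fast_step_approximations[OF ab(2) Zc, of 1] by auto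
  define V where "V N = step_approx (n N) (p N) Z" for N
  define Y where "Y s \<omega> = lim (\<lambda>N. V N s \<omega>)" for s \<omega>
  obtain B where B: "\<And>\<tau>. \<tau> \<in> {a..b} \<Longrightarrow> ms_norm M (Z \<tau>) \<le> B"
    using ms_continuous_bounded[OF Zc] by blast
  have V: "V N \<in> M2_class M T F f a b" for N
    unfolding V_def by (rule step_approx_M2_class[OF ab(1,3) p Z(1) B])
  have jm: "jointly_measurable M a b Y"
    using M2_class_jointly_measurable[OF V] unfolding jointly_measurable_def Y_def split_beta
    by (intro borel_measurable_lim_metric) auto
  have YF: "Y s \<in> borel_measurable (F s)" if "s \<in> {a..b}" for s
    unfolding Y_def using adapted_L2_meas[OF M2_class_adapted_L2[OF V that]] by (intro borel_measurable_lim_metric)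
  have YM: "Y s \<in> borel_measurable M" if "s \<in> {a..b}" for s
    using F_measurable_M[OF _ _ YF[OF that]] that ab by auto
  \<comment> \<open>The exceptional null set may depend on \<open>s\<close>; this suffices, since
    the integral is only required to be a version for each \<open>s\<close> separately.\<close>
  have ae: "AE \<omega> in M. Z s \<omega> = Y s \<omega>" if s: "s \<in> {a..b}" for s
  proof -
    have "AE \<omega> in M. (\<lambda>N. V N s \<omega>) \<longlonglongrightarrow> Z s \<omega>"
      using adapted_L2_sq[OF M2_class_adapted_L2[OF V s]] adapted_L2_sq[OF Z(1)[OF s]] le[OF s]
      by (intro AE_tendsto_of_ms_norm) (auto simp: V_def)
    then show ?thesis by eventually_elim (auto simp: Y_def limI)
  qed
  have int: "is_stochastic_integral M T F f w \<xi> a s (Y s)" if "s \<in> {a..b}" for s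
    by (rule is_stochastic_integral_cong_AE[OF Z(2) YM ae]) (fact that)+
  have "adapted_L2 s (Y s)" if "s \<in> {a..b}" for s
    using YF[OF that] is_stochastic_integral_square_integrable[OF int[OF that]] by (simp add: adapted_L2_def)
  with that[OF int _ jm integral_ms_continuous[OF w ab(1,3) \<xi>(2) int]] show thesis by blast
qed

end

subsection \<open>Nested sums\<close>

text \<open>The discrete counterpart of \<open>is_iterated_ito\<close>, with the same recursion and
  all sums over one partition. The inner sum stops below the index \<open>i\<close>, as the inner
  integral stops at time \<open>q i\<close>; there is one integrator more than there are weights,
  hence \<open>w (k + 2)\<close> next to \<open>\<psi> (Suc k)\<close>.\<close>

primrec nested_sum ::
  "(nat \<Rightarrow> real \<Rightarrow> 'a \<Rightarrow> real) \<Rightarrow> (nat \<Rightarrow> real \<Rightarrow> real) \<Rightarrow> (nat \<Rightarrow> real) \<Rightarrow> nat \<Rightarrow>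
   (nat \<Rightarrow> 'a \<Rightarrow> real) \<Rightarrow> nat \<Rightarrow> 'a \<Rightarrow> real" where
  "nested_sum w \<psi> q 0 Z = isum (w 1) q Z"
| "nested_sum w \<psi> q (Suc k) Z = nested_sum w \<psi> q k (\<lambda>i \<omega>. \<psi> (Suc k) (q i) * isum (w (k + 2)) q Z i \<omega>)"

lemma isum_diff: "isum w q (\<lambda>i \<omega>. Z i \<omega> - V i \<omega>) m \<omega> = isum w q Z m \<omega> - isum w q V m \<omega>"
  by (simp add: isum_def left_diff_distrib sum_subtractf)

lemma nested_sum_diff:
  "nested_sum w \<psi> q k (\<lambda>i \<omega>. Z i \<omega> - V i \<omega>) m \<omega> = nested_sum w \<psi> q k Z m \<omega> - nested_sum w \<psi> q k V m \<omega>"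
proof (induction k arbitrary: Z V)
  case (Suc k)
  show ?case using Suc by (simp add: isum_diff right_diff_distrib)
qed (simp add: isum_diff)

lemma isum_linear:
  "isum w q (\<lambda>i \<omega>. \<Sum>l\<in>L. c l \<omega> * Z l i \<omega>) m \<omega> = (\<Sum>l\<in>L. c l \<omega> * isum w q (Z l) m \<omega>)"
proof -
  have "isum w q (\<lambda>i \<omega>. \<Sum>l\<in>L. c l \<omega> * Z l i \<omega>) m \<omega> =
      (\<Sum>i<m. \<Sum>l\<in>L. c l \<omega> * (Z l i \<omega> * (w (q (Suc i)) \<omega> - w (q i) \<omega>)))"
    by (simp add: isum_def sum_distrib_right mult.assoc)
  also have "\<dots> = (\<Sum>l\<in>L. \<Sum>i<m. c l \<omega> * (Z l i \<omega> * (w (q (Suc i)) \<omega> - w (q i) \<omega>)))"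
    by (rule sum.swap)
  finally show ?thesis by (simp add: isum_def sum_distrib_left)
qed

text \<open>Pointwise algebra: the coefficients may be arbitrary functions of \<omega>, as long as
  they do not depend on the index \<open>i\<close>. This is how the factors in front of an inner
  reversed integral are pulled into its nested sum, with no adaptedness required at this
  stage.\<close>

lemma nested_sum_linear:
  "nested_sum w \<psi> q k (\<lambda>i \<omega>. \<Sum>l\<in>L. c l \<omega> * Z l i \<omega>) m \<omega> =
    (\<Sum>l\<in>L. c l \<omega> * nested_sum w \<psi> q k (Z l) m \<omega>)"
proof (induction k arbitrary: Z)
  case (Suc k)
  have "nested_sum w \<psi> q (Suc k) (\<lambda>i \<omega>. \<Sum>l\<in>L. c l \<omega> * Z l i \<omega>) m \<omega> =
      nested_sum w \<psi> q k (\<lambda>i \<omega>. \<Sum>l\<in>L. c l \<omega> * (\<psi> (Suc k) (q i) * isum (w (k + 2)) q (Z l) i \<omega>)) m \<omega>"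
    by (simp add: isum_linear sum_distrib_left mult.left_commute)
  also have "\<dots> = (\<Sum>l\<in>L. c l \<omega> * nested_sum w \<psi> q (Suc k) (Z l) m \<omega>)"
    using Suc by simp
  finally show ?case .
qed (simp add: isum_linear)

text \<open>If the innermost terms vanish below \<open>c\<close>, then so do all inner partial sums
  up to \<open>c\<close>, and every level effectively starts at \<open>c\<close>. Thus nested sums
  over different tails of a partition become nested sums over the whole of it and can be
  added.\<close>

lemma nested_sum_shift:
  assumes "\<And>i \<omega>. i < c \<Longrightarrow> Z i \<omega> = 0"
  shows "nested_sum w \<psi> q k Z (c + m) \<omega> = nested_sum w \<psi> (\<lambda>i. q (c + i)) k (\<lambda>i. Z (c + i)) m \<omega>"
  using assms
proof (induction k arbitrary: Z)
  case 0
  then have "isum (w 1) q Z c \<omega> = 0" by (simp add: isum_def)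
  then show ?case by (simp add: isum_split)
next
  case (Suc k)
  have zero: "isum (w (k + 2)) q Z i \<omega> = 0" if "i \<le> c" for i \<omega>
    using Suc.prems that by (simp add: isum_def)
  show ?case
    using zero[OF order_refl]
    by (simp add: Suc.IH[of "\<lambda>i \<omega>. \<psi> (Suc k) (q i) * isum (w (k + 2)) q Z i \<omega>"] zero
        isum_split[of _ _ _ c] del: add_2_eq_Suc')
qed

text \<open>A minimum over finitely many thresholds; \<open>x\<close> is a partition, encoded as the
  pair of its length and its nodes.\<close>

lemma finite_mesh_bound:
  assumes "\<And>l. l < (n::nat) \<Longrightarrow> \<exists>d>0::real. \<forall>x. m x < d \<longrightarrow> P l x"
  shows "\<exists>d>0. \<forall>l<n. \<forall>x. m x < d \<longrightarrow> P l x"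
  using assms
proof (induction n)
  case 0
  show ?case by (intro exI[of _ 1]) auto
next
  case (Suc n)
  then obtain d where d: "d > 0" "\<forall>l<n. \<forall>x. m x < d \<longrightarrow> P l x" by auto
  obtain d' where d': "d' > 0" "\<forall>x. m x < d' \<longrightarrow> P n x" using Suc.prems[of n] by auto
  show ?case using d d' by (intro exI[of _ "min d d'"]) (auto simp: less_Suc_eq)
qed

lemma continuous_bounded:
  fixes g :: "real \<Rightarrow> real"
  assumes "continuous_on {a..b} g"
  obtains B where "0 < B" "\<And>x. x \<in> {a..b} \<Longrightarrow> \<bar>g x\<bar> \<le> B"
proof -
  have "bounded (g ` {a..b})"
    by (intro compact_imp_bounded compact_continuous_image assms compact_Icc)
  then show thesis using that unfolding bounded_pos by auto
qed

section \<open>Uniform bounds and convergence of nested sums\<close>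

context wiener_space
begin

lemma integrator_measurable:
  assumes w: "integrator w" and s: "t \<le> s" "s \<le> T"
  shows "w s \<in> borel_measurable M"
proof -
  have "f s \<in> borel_measurable M" using F_measurable_M[OF s f_measurable[OF s]] .
  moreover have "w s \<in> borel_measurable M \<longleftrightarrow> f s \<in> borel_measurable M"
    if "\<And>\<omega>. \<omega> \<in> space M \<Longrightarrow> w s \<omega> = f s \<omega>"
    using that by (rule measurable_cong)
  moreover have "w s \<in> borel_measurable M \<longleftrightarrow> (\<lambda>\<omega>. s) \<in> borel_measurable M"
    if "\<And>\<omega>. \<omega> \<in> space M \<Longrightarrow> w s \<omega> = s"
    using that by (rule measurable_cong)
  ultimately show ?thesis using w s unfolding integrator_def by force
qed

text \<open>A uniform bound on the norms at all nodes reproduces itself: each level of summation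
  multiplies it by at most \<open>1 + T\<close>, and each weight by its supremum. So
  \<open>C\<close> depends neither on the partition nor on the integrand.\<close>

lemma nested_sum_bound_ex:
  assumes "\<And>l. l \<in> {1..k+1} \<Longrightarrow> integrator (w l)" "\<And>l. l \<in> {1..k} \<Longrightarrow> continuous_on {t..T} (\<psi> l)"
  shows "\<exists>C>0. \<forall>a b n p Z B. t \<le> a \<longrightarrow> b \<le> T \<longrightarrow> interval_partition a b n p \<longrightarrow>
    (\<forall>j<n. adapted_L2 (p j) (Z j) \<and> ms_norm M (Z j) \<le> B) \<longrightarrow> 0 \<le> B \<longrightarrow>
    square_integrable M (nested_sum w \<psi> p k Z n) \<and> ms_norm M (nested_sum w \<psi> p k Z n) \<le> C * B"
  using assms
proof (induction k)
  case 0
  have w: "integrator (w 1)" using 0 by simp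
  show ?case
  proof (intro exI[of _ "1 + T"] conjI allI impI)
    show "0 < 1 + T" using t_nonneg t_le_T by simp
    fix a b n p B and Z :: "nat \<Rightarrow> 'a \<Rightarrow> real"
    assume *: "t \<le> a" "b \<le> T" "interval_partition a b n p"
      "\<forall>j<n. adapted_L2 (p j) (Z j) \<and> ms_norm M (Z j) \<le> B" "0 \<le> B"
    show "square_integrable M (nested_sum w \<psi> p 0 Z n)"
      using adapted_L2_sq[OF isum_integrator(1)[OF w *(3,1,2) order_refl, of Z]] *(4) by simp
    show "ms_norm M (nested_sum w \<psi> p 0 Z n) \<le> (1 + T) * B"
      using isum_integrator_uniform[OF w *(3,1,2) order_refl, of Z B] *(4,5) by simp
  qed
next
  case (Suc k)
  have w: "integrator (w (k + 2))" using Suc.prems(1)[of "k + 2"] by simp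
  obtain C where C: "C > 0" "\<And>a b n p Z B. t \<le> a \<Longrightarrow> b \<le> T \<Longrightarrow> interval_partition a b n p \<Longrightarrow>
    (\<forall>j<n. adapted_L2 (p j) (Z j) \<and> ms_norm M (Z j) \<le> B) \<Longrightarrow> 0 \<le> B \<Longrightarrow>
    square_integrable M (nested_sum w \<psi> p k Z n) \<and> ms_norm M (nested_sum w \<psi> p k Z n) \<le> C * B"
    using Suc.IH Suc.prems by fastforce
  have "continuous_on {t..T} (\<psi> (Suc k))" using Suc.prems(2)[of "Suc k"] by simp
  then obtain P where P: "0 < P" "\<And>x. x \<in> {t..T} \<Longrightarrow> \<bar>\<psi> (Suc k) x\<bar> \<le> P"
    using continuous_bounded by blast
  show ?case
  proof (intro exI[of _ "C * (P * (1 + T))"] conjI allI impI)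
    show "0 < C * (P * (1 + T))" using C(1) P(1) t_nonneg t_le_T by simp
    fix a b n p B and Z :: "nat \<Rightarrow> 'a \<Rightarrow> real"
    assume *: "t \<le> a" "b \<le> T" "interval_partition a b n p"
      "\<forall>j<n. adapted_L2 (p j) (Z j) \<and> ms_norm M (Z j) \<le> B" "0 \<le> B"
    define V where "V = (\<lambda>i \<omega>. \<psi> (Suc k) (p i) * isum (w (k + 2)) p Z i \<omega>)"
    have "adapted_L2 (p j) (V j) \<and> ms_norm M (V j) \<le> P * ((1 + T) * B)" if j: "j < n" for j
    proof
      have jn: "j \<le> n" using j by simp
      show "adapted_L2 (p j) (V j)"
        unfolding V_def using *(4) by (intro adapted_L2_cmult isum_integrator(1)[OF w *(3,1,2) jn]) auto
      have "ms_norm M (V j) = \<bar>\<psi> (Suc k) (p j)\<bar> * ms_norm M (isum (w (k + 2)) p Z j)"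
        unfolding V_def by (rule ms_norm_cmult)
      also have "\<dots> \<le> P * ((1 + T) * B)"
      proof (rule mult_mono)
        show "\<bar>\<psi> (Suc k) (p j)\<bar> \<le> P" using P(2) partition_bounds[OF *(3) jn] *(1,2) by auto
        show "ms_norm M (isum (w (k + 2)) p Z j) \<le> (1 + T) * B"
          using isum_integrator_uniform[OF w *(3,1,2) jn, of Z B] *(4,5) by auto
      qed (use P(1) in auto)
      finally show "ms_norm M (V j) \<le> P * ((1 + T) * B)" .
    qed
    moreover have "0 \<le> P * ((1 + T) * B)" using P(1) *(5) t_nonneg t_le_T by simp
    ultimately have "square_integrable M (nested_sum w \<psi> p k V n) \<and>
        ms_norm M (nested_sum w \<psi> p k V n) \<le> C * (P * ((1 + T) * B))"
      using C(2)[OF *(1,2,3)] by blast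
    then show "square_integrable M (nested_sum w \<psi> p (Suc k) Z n)"
      and "ms_norm M (nested_sum w \<psi> p (Suc k) Z n) \<le> C * (P * (1 + T)) * B"
      by (simp_all add: V_def mult.assoc)
  qed
qed

lemma nested_sum_bound:
  assumes "\<And>l. l \<in> {1..k+1} \<Longrightarrow> integrator (w l)" "\<And>l. l \<in> {1..k} \<Longrightarrow> continuous_on {t..T} (\<psi> l)"
  obtains C where "C > 0" "\<And>a b n p Z B. t \<le> a \<Longrightarrow> b \<le> T \<Longrightarrow> interval_partition a b n p \<Longrightarrow>
    \<forall>j<n. adapted_L2 (p j) (Z j) \<and> ms_norm M (Z j) \<le> B \<Longrightarrow> 0 \<le> B \<Longrightarrow>
    square_integrable M (nested_sum w \<psi> p k Z n) \<and> ms_norm M (nested_sum w \<psi> p k Z n) \<le> C * B"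
proof -
  obtain C where C: "C > 0" "\<forall>a b n p Z B. t \<le> a \<longrightarrow> b \<le> T \<longrightarrow> interval_partition a b n p \<longrightarrow>
    (\<forall>j<n. adapted_L2 (p j) (Z j) \<and> ms_norm M (Z j) \<le> B) \<longrightarrow> 0 \<le> B \<longrightarrow>
    square_integrable M (nested_sum w \<psi> p k Z n) \<and> ms_norm M (nested_sum w \<psi> p k Z n) \<le> C * B"
    using nested_sum_bound_ex[where k = k and w = w and \<psi> = \<psi>] assms by blast
  show thesis by (rule that[OF C(1)]) (rule C(2)[rule_format]; blast)
qed

lemma integrand_product:
  assumes a: "t \<le> a" and g: "continuous_on {a..T} g"
    and Y: "\<And>s. s \<in> {a..T} \<Longrightarrow> adapted_L2 s (Y s)" "jointly_measurable M a T Y" "ms_continuous M a T Y"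
  shows "(\<lambda>\<tau> \<omega>. g \<tau> * Y \<tau> \<omega>) \<in> M2_class M T F f a T" "ms_continuous M a T (\<lambda>\<tau> \<omega>. g \<tau> * Y \<tau> \<omega>)"
proof -
  show c: "ms_continuous M a T (\<lambda>\<tau> \<omega>. g \<tau> * Y \<tau> \<omega>)" by (rule ms_continuous_mult[OF g Y(3)])
  obtain B where "\<And>\<tau>. \<tau> \<in> {a..T} \<Longrightarrow> ms_norm M (\<lambda>\<omega>. g \<tau> * Y \<tau> \<omega>) \<le> B"
    using ms_continuous_bounded[OF c] by blast
  then show "(\<lambda>\<tau> \<omega>. g \<tau> * Y \<tau> \<omega>) \<in> M2_class M T F f a T"
    by (intro M2_classI[OF a order_refl] jointly_measurable_mult jointly_measurable_deterministic g Y adapted_L2_cmult)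
qed

lemma deterministic_integrand:
  assumes a: "t \<le> a" and g: "continuous_on {a..T} g"
  shows "(\<lambda>\<tau> \<omega>. g \<tau>) \<in> M2_class M T F f a T" "ms_continuous M a T (\<lambda>\<tau> \<omega>. g \<tau>)"
proof -
  have "ms_continuous M a T (\<lambda>\<tau> \<omega>. 1)" by (simp add: ms_continuous_def)
  moreover have "jointly_measurable M a T (\<lambda>\<tau> \<omega>. 1)" by (simp add: jointly_measurable_def)
  ultimately show "(\<lambda>\<tau> \<omega>. g \<tau>) \<in> M2_class M T F f a T" "ms_continuous M a T (\<lambda>\<tau> \<omega>. g \<tau>)"
    using integrand_product[OF a g, of "\<lambda>\<tau> \<omega>. 1"] by auto
qed

text \<open>Integration followed by multiplication with a continuous weight stays among the
  mean-square continuous processes of the class, provided that a good version is taken, so the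
  induction runs over all such integrands. The lower limit \<open>a\<close> is free, since the inner
  reversed integrals over \<open>[s,T]\<close> will be identified with iterated integrals.\<close>

lemma iterated_ito_exists:
  assumes "\<And>l. l \<in> {1..k+1} \<Longrightarrow> integrator (w l)" "\<And>l. l \<in> {1..k} \<Longrightarrow> continuous_on {t..T} (\<psi> l)"
    and a: "t \<le> a" "a \<le> T" and \<xi>: "\<xi> \<in> M2_class M T F f a T" "ms_continuous M a T \<xi>"
  shows "\<exists>X. is_iterated_ito M T F f w \<psi> a k \<xi> X"
  using assms(1,2) \<xi>
proof (induction k arbitrary: \<xi>)
  case 0
  have w: "integrator (w 1)" using 0 by simp
  obtain X where "is_stochastic_integral M T F f (w 1) \<xi> a T X"
    using stochastic_integral_exists[OF w a(1) a(2) order_refl 0(3,4)] by blast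
  then show ?case by auto
next
  case (Suc k)
  have w: "integrator (w (k + 2))" using Suc.prems(1)[of "k + 2"] by simp
  have g: "continuous_on {a..T} (\<psi> (Suc k))"
    using Suc.prems(2)[of "Suc k"] a by (auto intro: continuous_on_subset)
  obtain Y where Y: "\<And>s. s \<in> {a..T} \<Longrightarrow> is_stochastic_integral M T F f (w (k + 2)) \<xi> a s (Y s)"
    "\<And>s. s \<in> {a..T} \<Longrightarrow> adapted_L2 s (Y s)" "jointly_measurable M a T Y" "ms_continuous M a T Y"
    using integral_process_exists[OF w a(1) a(2) order_refl Suc.prems(3,4)] by blast
  have "\<exists>X. is_iterated_ito M T F f w \<psi> a k (\<lambda>\<tau> \<omega>. \<psi> (Suc k) \<tau> * Y \<tau> \<omega>) X"
    using Suc.prems(1,2) by (intro Suc.IH integrand_product[OF a(1) g Y(2,3,4)]) auto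
  then obtain X where "is_iterated_ito M T F f w \<psi> a k (\<lambda>\<tau> \<omega>. \<psi> (Suc k) \<tau> * Y \<tau> \<omega>) X" by blast
  then show ?case
    using Y(1) by (intro exI[of _ X]) (simp only: is_iterated_ito.simps, blast)
qed

lemma is_iterated_ito_M2_class:
  assumes "is_iterated_ito M T F f w \<psi> a k \<xi> X" "a \<le> T"
  shows "\<xi> \<in> M2_class M T F f a T"
proof (cases k)
  case 0
  then show ?thesis using assms is_stochastic_integral_M2_class by auto
next
  case (Suc k')
  then obtain Y where "\<forall>s\<in>{a..T}. is_stochastic_integral M T F f (w (k' + 2)) \<xi> a s (Y s)"
    using assms(1) by auto
  then have "is_stochastic_integral M T F f (w (k' + 2)) \<xi> a T (Y T)" using assms(2) by auto
  then show ?thesis by (rule is_stochastic_integral_M2_class)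
qed

lemma is_iterated_ito_square_integrable:
  "is_iterated_ito M T F f w \<psi> a k \<xi> X \<Longrightarrow> square_integrable M X"
  by (induction k arbitrary: \<xi>) (auto dest: is_stochastic_integral_square_integrable)

text \<open>The innermost sum is replaced by the true integral \<open>Y\<close>. By
  \<open>riemann_sums_uniform\<close> the error is small at all nodes simultaneously, and the
  remaining levels amplify it by at most the partition-independent constant \<open>C\<close>; the
  induction hypothesis treats the integrand with \<open>Y\<close>.\<close>

lemma nested_sum_converges:
  assumes "\<And>l. l \<in> {1..k+1} \<Longrightarrow> integrator (w l)" "\<And>l. l \<in> {1..k} \<Longrightarrow> continuous_on {t..T} (\<psi> l)"
    and a: "t \<le> a" "a \<le> T" and "ms_continuous M a T \<xi>"
    and "is_iterated_ito M T F f w \<psi> a k \<xi> X" and "0 < e"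
  shows "\<exists>d>0. \<forall>n p. interval_partition a T n p \<longrightarrow> mesh n p < d \<longrightarrow>
    ms_dist M (nested_sum w \<psi> p k (\<lambda>i. \<xi> (p i)) n) X < e"
  using assms(1,2,5-)
proof (induction k arbitrary: \<xi> e)
  case 0
  have w: "integrator (w 1)" using 0 by simp
  have X: "is_stochastic_integral M T F f (w 1) \<xi> a T X" using 0(4) by simp
  obtain Y where Y: "\<And>s. s \<in> {a..T} \<Longrightarrow> is_stochastic_integral M T F f (w 1) \<xi> a s (Y s)"
    using integral_process_exists[OF w a(1) a(2) order_refl is_stochastic_integral_M2_class[OF X] 0(3)] by blast
  \<comment> \<open>\<open>X\<close> is an arbitrary version of the full integral; putting it in
    place of \<open>Y T\<close> makes the uniform estimate speak about \<open>X\<close>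
    itself.\<close>
  have Y': "is_stochastic_integral M T F f (w 1) \<xi> a s ((Y(T := X)) s)" if "s \<in> {a..T}" for s
    using Y[OF that] X by simp
  obtain d where "0 < d" and d: "\<And>n p i. interval_partition a T n p \<Longrightarrow> mesh n p < d \<Longrightarrow> i \<le> n \<Longrightarrow>
    ms_dist M (isum (w 1) p (\<lambda>j. \<xi> (p j)) i) ((Y(T := X)) (p i)) < e"
    using riemann_sums_uniform[OF w a(1) order_refl 0(3) Y' 0(5)] by blast
  have "ms_dist M (isum (w 1) p (\<lambda>j. \<xi> (p j)) n) X < e"
    if p: "interval_partition a T n p" "mesh n p < d" for n p
    using d[OF p order_refl] p(1) by (simp add: interval_partition_def)
  with \<open>0 < d\<close> show ?case by auto
next
  case (Suc k)
  have w: "integrator (w (k + 2))" using Suc.prems(1)[of "k + 2"] by simp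
  have W: "\<And>l. l \<in> {1..k+1} \<Longrightarrow> integrator (w l)" "\<And>l. l \<in> {1..k} \<Longrightarrow> continuous_on {t..T} (\<psi> l)"
    using Suc.prems(1,2) by auto
  have g: "continuous_on {a..T} (\<psi> (Suc k))"
    using Suc.prems(2)[of "Suc k"] a by (auto intro: continuous_on_subset)
  obtain P where P: "0 < P" "\<And>x. x \<in> {a..T} \<Longrightarrow> \<bar>\<psi> (Suc k) x\<bar> \<le> P"
    using continuous_bounded[OF g] by blast
  obtain C where C: "C > 0" "\<And>a b n p Z B. t \<le> a \<Longrightarrow> b \<le> T \<Longrightarrow> interval_partition a b n p \<Longrightarrow>
    \<forall>j<n. adapted_L2 (p j) (Z j) \<and> ms_norm M (Z j) \<le> B \<Longrightarrow> 0 \<le> B \<Longrightarrow>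
    square_integrable M (nested_sum w \<psi> p k Z n) \<and> ms_norm M (nested_sum w \<psi> p k Z n) \<le> C * B"
    using nested_sum_bound[where k = k and w = w and \<psi> = \<psi>, OF W] by blast
  obtain Y where Y: "\<And>s. s \<in> {a..T} \<Longrightarrow> is_stochastic_integral M T F f (w (k + 2)) \<xi> a s (Y s)"
    and X: "is_iterated_ito M T F f w \<psi> a k (\<lambda>\<tau> \<omega>. \<psi> (Suc k) \<tau> * Y \<tau> \<omega>) X"
    using Suc.prems(4) unfolding is_iterated_ito.simps by blast
  define \<eta> where "\<eta> = (\<lambda>\<tau> \<omega>. \<psi> (Suc k) \<tau> * Y \<tau> \<omega>)"
  have \<eta>: "ms_continuous M a T \<eta>"
    unfolding \<eta>_def
    by (intro ms_continuous_mult g integral_ms_continuous[OF w a(1) order_refl Suc.prems(3) Y])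
  have \<eta>2: "\<eta> \<in> M2_class M T F f a T"
    using is_iterated_ito_M2_class[OF X a(2)] by (simp add: \<eta>_def)
  obtain d1 where d1: "0 < d1" "\<And>n p. interval_partition a T n p \<Longrightarrow> mesh n p < d1 \<Longrightarrow>
      ms_dist M (nested_sum w \<psi> p k (\<lambda>i. \<eta> (p i)) n) X < e / 2"
    using Suc.IH[OF W \<eta> X[folded \<eta>_def], of "e / 2"] Suc.prems(5) by auto
  \<comment> \<open>The error \<open>e'\<close> of the inner sum is amplified by \<open>P\<close>
    through the weight and by \<open>C\<close> through the outer levels, which leaves
    \<open>e / 2\<close>.\<close>
  define e' where "e' = e / (2 * C * P)"
  have e': "0 < e'" using Suc.prems(5) C(1) P(1) by (simp add: e'_def)
  obtain d2 where d2: "0 < d2" "\<And>n p i. interval_partition a T n p \<Longrightarrow> mesh n p < d2 \<Longrightarrow> i \<le> n \<Longrightarrow>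
    ms_dist M (isum (w (k + 2)) p (\<lambda>j. \<xi> (p j)) i) (Y (p i)) < e'"
    using riemann_sums_uniform[OF w a(1) order_refl Suc.prems(3) Y e'] by blast
  show ?case
  proof (intro exI[of _ "min d1 d2"] conjI allI impI)
    show "0 < min d1 d2" using d1(1) d2(1) by simp
    fix n p assume p: "interval_partition a T n p" and m: "mesh n p < min d1 d2"
    define V where "V = (\<lambda>i \<omega>. \<psi> (Suc k) (p i) * isum (w (k + 2)) p (\<lambda>j. \<xi> (p j)) i \<omega>)"
    have \<xi>2: "\<xi> \<in> M2_class M T F f a T" using is_iterated_ito_M2_class[OF Suc.prems(4) a(2)] .
    have pin: "p j \<in> {a..T}" if "j \<le> n" for j using partition_bounds[OF p that] by auto
    have V: "adapted_L2 (p i) (V i)" if "i < n" for i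
      unfolding V_def using M2_class_adapted_L2[OF \<xi>2] pin that
      by (intro adapted_L2_cmult isum_integrator(1)[OF w p a(1) order_refl]) auto
    have \<eta>p: "adapted_L2 (p i) (\<eta> (p i))" if "i < n" for i using M2_class_adapted_L2[OF \<eta>2] pin that by auto
    have diff: "ms_dist M (V i) (\<eta> (p i)) \<le> P * e'" if i: "i < n" for i
    proof -
      have "ms_dist M (V i) (\<eta> (p i)) =
          \<bar>\<psi> (Suc k) (p i)\<bar> * ms_dist M (isum (w (k + 2)) p (\<lambda>j. \<xi> (p j)) i) (Y (p i))"
        unfolding V_def \<eta>_def right_diff_distrib[symmetric] by (rule ms_norm_cmult)
      also have "\<dots> \<le> P * e'"
        using P pin[of i] d2(2)[OF p, of i] m i by (intro mult_mono) auto
      finally show ?thesis .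
    qed
    have Vd: "\<forall>j<n. adapted_L2 (p j) (\<lambda>\<omega>. V j \<omega> - \<eta> (p j) \<omega>) \<and> ms_dist M (V j) (\<eta> (p j)) \<le> P * e'"
      using V \<eta>p diff adapted_L2_diff by blast
    have N1: "square_integrable M (\<lambda>\<omega>. nested_sum w \<psi> p k V n \<omega> - nested_sum w \<psi> p k (\<lambda>i. \<eta> (p i)) n \<omega>)"
      "ms_dist M (nested_sum w \<psi> p k V n) (nested_sum w \<psi> p k (\<lambda>i. \<eta> (p i)) n) \<le> C * (P * e')"
      using C(2)[OF a(1) order_refl p Vd] P(1) e' by (simp_all add: nested_sum_diff[abs_def])
    obtain B where "0 < B" and B: "\<And>\<tau>. \<tau> \<in> {a..T} \<Longrightarrow> ms_norm M (\<eta> \<tau>) \<le> B" using ms_continuous_bounded[OF \<eta>] by blast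
    have \<eta>B: "\<forall>j<n. adapted_L2 (p j) (\<eta> (p j)) \<and> ms_norm M (\<eta> (p j)) \<le> B" using \<eta>p B pin by auto
    have sq: "square_integrable M (nested_sum w \<psi> p k (\<lambda>i. \<eta> (p i)) n)"
      using C(2)[OF a(1) order_refl p \<eta>B] \<open>0 < B\<close> by simp
    have "ms_dist M (nested_sum w \<psi> p k V n) X \<le>
        ms_dist M (nested_sum w \<psi> p k V n) (nested_sum w \<psi> p k (\<lambda>i. \<eta> (p i)) n) +
        ms_dist M (nested_sum w \<psi> p k (\<lambda>i. \<eta> (p i)) n) X"
      using square_integrable_add[OF N1(1) sq]
      by (intro ms_norm_triangle_diff sq is_iterated_ito_square_integrable[OF X]) simp
    also have "\<dots> < C * (P * e') + e / 2"
      using N1(2) d1(2)[OF p] m by (intro add_le_less_mono) auto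
    also have "C * (P * e') = e / 2" using C(1) P(1) by (simp add: e'_def)
    finally show "ms_dist M (nested_sum w \<psi> p (Suc k) (\<lambda>i. \<xi> (p i)) n) X < e"
      by (simp add: V_def)
  qed
qed

end

subsection \<open>Reversing the order of integration\<close>

context wiener_space
begin

text \<open>\<open>I s\<close> is the \<open>k\<close>-fold reversed integral over \<open>[s,T]\<close>, described as the limit of the nested forward
  sums with innermost integrand \<open>\<psi> k\<close>.\<close>
definition inner_limit ::
  "(nat \<Rightarrow> real \<Rightarrow> 'a \<Rightarrow> real) \<Rightarrow> (nat \<Rightarrow> real \<Rightarrow> real) \<Rightarrow> nat \<Rightarrow> (real \<Rightarrow> 'a \<Rightarrow> real) \<Rightarrow> bool" where
  "inner_limit w \<psi> k I \<longleftrightarrow> (case k of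
     0 \<Rightarrow> \<forall>s\<in>{t..T}. \<forall>\<omega>\<in>space M. I s \<omega> = 1
   | Suc m \<Rightarrow> \<forall>s\<in>{t..T}. square_integrable M (I s) \<and> (\<forall>e>0. \<exists>d>0. \<forall>n p.
       interval_partition s T n p \<longrightarrow> mesh n p < d \<longrightarrow>
       ms_dist M (nested_sum w \<psi> p m (\<lambda>i \<omega>. \<psi> k (p i)) n) (I s) < e))"

definition reversed_sum ::
  "(real \<Rightarrow> 'a \<Rightarrow> real) \<Rightarrow> (real \<Rightarrow> 'a \<Rightarrow> real) \<Rightarrow> (real \<Rightarrow> 'a \<Rightarrow> real) \<Rightarrow> nat \<Rightarrow> (nat \<Rightarrow> real) \<Rightarrow> 'a \<Rightarrow> real" where
  "reversed_sum w g I n p \<omega> = (\<Sum>l<n. g (p l) \<omega> * (w (p (Suc l)) \<omega> - w (p l) \<omega>) * I (p (Suc l)) \<omega>)"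

text \<open>For a refinement \<open>Q\<close> of \<open>p\<close>, replacing each \<open>I (p (Suc l))\<close> by its nested sum over the part of
  \<open>Q\<close> beyond \<open>p (Suc l)\<close> turns the reversed sum into a forward nested sum over \<open>Q\<close>. Its innermost
  integral is frozen on the intervals of \<open>p\<close>, so the distance to the iterated integral is controlled
  by the oscillation of the innermost integral along \<open>p\<close>; then \<open>Q\<close> gets fine.\<close>
lemma reversed_sum_distance:
  assumes W: "\<And>l. l \<in> {1..Suc m + 1} \<Longrightarrow> integrator (w l)"
    and g: "\<And>l. l \<in> {1..Suc m} \<Longrightarrow> continuous_on {t..T} (\<psi> l)"
    and a: "t \<le> a" "a \<le> T" and \<xi>: "\<xi> \<in> M2_class M T F f a T" "ms_continuous M a T \<xi>"
    and Y: "\<And>s. s \<in> {a..T} \<Longrightarrow> is_stochastic_integral M T F f (w (m + 2)) \<xi> a s (Y s)"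
      "\<And>s. s \<in> {a..T} \<Longrightarrow> adapted_L2 s (Y s)"
    and X: "is_iterated_ito M T F f w \<psi> a (Suc m) \<xi> X"
    and I: "inner_limit w \<psi> (Suc m) I"
    and p: "interval_partition a T n p" and B: "0 < B"
      "\<And>l u. l < n \<Longrightarrow> p l \<le> u \<Longrightarrow> u \<le> p (Suc l) \<Longrightarrow>
        ms_dist M (isum (w (m + 2)) p (\<lambda>j. \<xi> (p j)) l) (Y u) \<le> B"
    and C: "C > 0" "\<And>a b n p Z B. t \<le> a \<Longrightarrow> b \<le> T \<Longrightarrow> interval_partition a b n p \<Longrightarrow>
      \<forall>j<n. adapted_L2 (p j) (Z j) \<and> ms_norm M (Z j) \<le> B \<Longrightarrow> 0 \<le> B \<Longrightarrow>
      square_integrable M (nested_sum w \<psi> p m Z n) \<and> ms_norm M (nested_sum w \<psi> p m Z n) \<le> C * B"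
    and P: "0 < P" "\<And>x. x \<in> {t..T} \<Longrightarrow> \<bar>\<psi> (Suc m) x\<bar> \<le> P"
  shows "square_integrable M (reversed_sum (w (m + 2)) \<xi> I n p)"
    and "ms_dist M (reversed_sum (w (m + 2)) \<xi> I n p) X \<le> C * (P * (2 * B))"
proof -
  define v where "v = w (m + 2)"
  have v: "integrator v" using W[of "m + 2"] by (simp add: v_def)
  note ad = M2_class_adapted_L2[OF \<xi>(1)]
  have sqX: "square_integrable M X" by (rule is_iterated_ito_square_integrable[OF X])
  have pin: "p j \<in> {a..T}" if "j \<le> n" for j using partition_bounds[OF p that] by auto
  have pt: "p j \<in> {t..T}" if "j \<le> n" for j using pin[OF that] a by auto
  have Isq: "square_integrable M (I s)" if "s \<in> {t..T}" for s using I that by (simp add: inner_limit_def)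
  have Ilim: "\<exists>d>0. \<forall>n' p'. interval_partition s T n' p' \<longrightarrow> mesh n' p' < d \<longrightarrow>
       ms_dist M (nested_sum w \<psi> p' m (\<lambda>i \<omega>. \<psi> (Suc m) (p' i)) n') (I s) < e"
    if "s \<in> {t..T}" "0 < e" for s e using I that by (simp add: inner_limit_def)
  \<comment> \<open>Requirements on the refinement number \<open>N\<close>. Closeness to
    \<open>Y\<close> within the fixed \<open>B\<close> suffices, as it only enters the norm bound;
    the other two errors carry the rate \<open>(1/2) ^ N\<close> that yields almost sure
    convergence. The last clause covers all fine partitions of \<open>[p (Suc l), T]\<close>, in
    particular the tail of \<open>Q\<close>.\<close>
  define adm where "adm N L Q c \<longleftrightarrow> interval_partition a T L Q \<and> refinement n p L Q c \<and>
      (\<forall>i\<le>L. ms_dist M (isum v Q (\<lambda>j. \<xi> (Q j)) i) (Y (Q i)) < B) \<and>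
      ms_dist M (nested_sum w \<psi> Q (Suc m) (\<lambda>i. \<xi> (Q i)) L) X < (1/2) ^ N \<and>
      (\<forall>l<n. \<forall>n' p'. interval_partition (p (Suc l)) T n' p' \<longrightarrow> mesh n' p' \<le> mesh L Q \<longrightarrow>
        ms_dist M (nested_sum w \<psi> p' m (\<lambda>i \<omega>. \<psi> (Suc m) (p' i)) n') (I (p (Suc l))) < (1/2) ^ N)"
    for N L Q c
  have "\<exists>L Q c. adm N L Q c" for N
  proof -
    have e: "0 < (1/2::real) ^ N" by simp
    obtain d1 where d1: "0 < d1" "\<And>L Q i. interval_partition a T L Q \<Longrightarrow> mesh L Q < d1 \<Longrightarrow> i \<le> L \<Longrightarrow>
        ms_dist M (isum v Q (\<lambda>j. \<xi> (Q j)) i) (Y (Q i)) < B"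
      using riemann_sums_uniform[OF v a(1) order_refl \<xi>(2) Y(1)[folded v_def] B(1)] by blast
    obtain d2 where d2: "0 < d2" "\<And>L Q. interval_partition a T L Q \<Longrightarrow> mesh L Q < d2 \<Longrightarrow>
        ms_dist M (nested_sum w \<psi> Q (Suc m) (\<lambda>i. \<xi> (Q i)) L) X < (1/2) ^ N"
      using nested_sum_converges[OF W g a \<xi>(2) X e] by blast
    have "\<exists>d>0. \<forall>l<n. \<forall>x. mesh (fst x) (snd x) < d \<longrightarrow> interval_partition (p (Suc l)) T (fst x) (snd x) \<longrightarrow>
        ms_dist M (nested_sum w \<psi> (snd x) m (\<lambda>i \<omega>. \<psi> (Suc m) (snd x i)) (fst x)) (I (p (Suc l))) < (1/2) ^ N"
    proof (rule finite_mesh_bound)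
      fix l assume "l < n"
      then have "p (Suc l) \<in> {t..T}" using pt by auto
      from Ilim[OF this e] show "\<exists>d>0. \<forall>x. mesh (fst x) (snd x) < d \<longrightarrow> interval_partition (p (Suc l)) T (fst x) (snd x) \<longrightarrow>
        ms_dist M (nested_sum w \<psi> (snd x) m (\<lambda>i \<omega>. \<psi> (Suc m) (snd x i)) (fst x)) (I (p (Suc l))) < (1/2) ^ N"
        by auto
    qed
    then obtain d3 where d3: "0 < d3" "\<And>l n' p'. l < n \<Longrightarrow> mesh n' p' < d3 \<Longrightarrow> interval_partition (p (Suc l)) T n' p' \<Longrightarrow>
        ms_dist M (nested_sum w \<psi> p' m (\<lambda>i \<omega>. \<psi> (Suc m) (p' i)) n') (I (p (Suc l))) < (1/2) ^ N"
      by auto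
    have "0 < min d1 (min d2 d3)" using d1(1) d2(1) d3(1) by simp
    from fine_refinement_exists[OF p a(2) this] obtain L Q c where
      Q: "interval_partition a T L Q" "refinement n p L Q c" "mesh L Q < min d1 (min d2 d3)" by blast
    show ?thesis
      unfolding adm_def using Q d1(2)[OF Q(1)] d2(2)[OF Q(1)] d3(2) by (intro exI[of _ L] exI[of _ Q] exI[of _ c]) auto
  qed
  then obtain L Q c where adm: "\<And>N. adm N (L N) (Q N) (c N)" by metis
  have Q: "interval_partition a T (L N) (Q N)" and ref: "refinement n p (L N) (Q N) (c N)"
    and QX: "ms_dist M (nested_sum w \<psi> (Q N) (Suc m) (\<lambda>i. \<xi> (Q N i)) (L N)) X < (1/2) ^ N" for N
    using adm[of N] unfolding adm_def by blast+
  have QY: "ms_dist M (isum v (Q N) (\<lambda>j. \<xi> (Q N j)) i) (Y (Q N i)) < B" if "i \<le> L N" for N i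
    using adm[of N] that unfolding adm_def by blast
  have QI: "ms_dist M (nested_sum w \<psi> p' m (\<lambda>i \<omega>. \<psi> (Suc m) (p' i)) n') (I (p (Suc l))) < (1/2) ^ N"
    if "l < n" "interval_partition (p (Suc l)) T n' p'" "mesh n' p' \<le> mesh (L N) (Q N)" for N l n' p'
    using adm[of N] that unfolding adm_def by blast
  \<comment> \<open>\<open>V N l\<close> stands in for the inner integral
    \<open>I (p (Suc l))\<close>.\<close>
  define V where "V N l = nested_sum w \<psi> (\<lambda>i. Q N (c N (Suc l) + i)) m
      (\<lambda>i \<omega>. \<psi> (Suc m) (Q N (c N (Suc l) + i))) (L N - c N (Suc l))" for N l
  define G where "G N = nested_sum w \<psi> (Q N) (Suc m) (\<lambda>i. \<xi> (Q N i)) (L N)" for N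
  define \<delta> where "\<delta> l \<omega> = \<xi> (p l) \<omega> * (v (p (Suc l)) \<omega> - v (p l) \<omega>)" for l \<omega>
  \<comment> \<open>\<open>U N\<close> is the approximation of \<open>S - X\<close>: almost sure
    limits are taken in both parts, while its norm is bounded uniformly in \<open>N\<close>.\<close>
  define U where "U N \<omega> = (\<Sum>l<n. \<delta> l \<omega> * V N l \<omega>) - G N \<omega>" for N \<omega>
  define S where "S = reversed_sum v \<xi> I n p"
  have S: "S \<omega> = (\<Sum>l<n. \<delta> l \<omega> * I (p (Suc l)) \<omega>)" for \<omega> by (simp add: S_def reversed_sum_def \<delta>_def)
  have Qin: "Q N i \<in> {a..T}" if "i \<le> L N" for N i using partition_bounds[OF Q that] by auto
  have Zad: "adapted_L2 (Q N i) (\<lambda>\<omega>. \<psi> (Suc m) (Q N i) * isum v (Q N) (\<lambda>j. \<xi> (Q N j)) i \<omega>)" if "i < L N" for N i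
    using that Qin ad by (intro adapted_L2_cmult isum_integrator(1)[OF v Q a(1) order_refl]) auto
  have drop: "interval_partition (p (Suc l)) T (L N - c N (Suc l)) (\<lambda>i. Q N (c N (Suc l) + i))"
    "mesh (L N - c N (Suc l)) (\<lambda>i. Q N (c N (Suc l) + i)) \<le> mesh (L N) (Q N)" if l: "l < n" for N l
  proof -
    have cl: "c N (Suc l) \<le> L N" using refinement_le[OF ref] l by auto
    have "Q N (c N (Suc l)) = p (Suc l)" using ref l by (auto simp: refinement_def)
    then show "interval_partition (p (Suc l)) T (L N - c N (Suc l)) (\<lambda>i. Q N (c N (Suc l) + i))"
      using partition_drop[OF Q cl] by simp
    show "mesh (L N - c N (Suc l)) (\<lambda>i. Q N (c N (Suc l) + i)) \<le> mesh (L N) (Q N)"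
      by (rule mesh_drop[OF Q cl])
  qed
  have Vsq: "square_integrable M (V N l)" if l: "l < n" for N l
  proof -
    have r: "t \<le> p (Suc l)" using pt[of "Suc l"] l by simp
    have "\<forall>j<L N - c N (Suc l). adapted_L2 (Q N (c N (Suc l) + j)) (\<lambda>\<omega>. \<psi> (Suc m) (Q N (c N (Suc l) + j))) \<and>
        ms_norm M (\<lambda>\<omega>. \<psi> (Suc m) (Q N (c N (Suc l) + j))) \<le> P"
    proof (intro allI impI conjI)
      fix j assume "j < L N - c N (Suc l)"
      then have "c N (Suc l) + j \<le> L N" by simp
      from Qin[OF this] have "Q N (c N (Suc l) + j) \<in> {t..T}" using a by auto
      then show "ms_norm M (\<lambda>\<omega>. \<psi> (Suc m) (Q N (c N (Suc l) + j))) \<le> P"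
        using P(2) by (simp add: ms_norm_const)
    qed simp
    from C(2)[OF r order_refl drop(1)[OF l] this] P(1) show ?thesis by (simp add: V_def)
  qed
  have Vlim: "AE \<omega> in M. (\<lambda>N. V N l \<omega>) \<longlonglongrightarrow> I (p (Suc l)) \<omega>" if l: "l < n" for l
  proof (rule AE_tendsto_of_ms_norm[OF Vsq[OF l] Isq])
    show "p (Suc l) \<in> {t..T}" using pt l by auto
    show "ms_dist M (V N l) (I (p (Suc l))) \<le> (1/2) ^ N" for N
      using QI[OF l drop[OF l], of N] by (simp add: V_def)
  qed
  obtain By where By: "0 < By" "\<And>\<tau>. \<tau> \<in> {a..T} \<Longrightarrow> ms_norm M (\<xi> \<tau>) \<le> By" using ms_continuous_bounded[OF \<xi>(2)] by blast
  have Gsq: "square_integrable M (G N)" for N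
  proof -
    have "\<forall>j<L N. adapted_L2 (Q N j) (\<lambda>\<omega>. \<psi> (Suc m) (Q N j) * isum v (Q N) (\<lambda>j. \<xi> (Q N j)) j \<omega>) \<and>
       ms_norm M (\<lambda>\<omega>. \<psi> (Suc m) (Q N j) * isum v (Q N) (\<lambda>j. \<xi> (Q N j)) j \<omega>) \<le> P * ((1 + T) * By)"
    proof (intro allI impI conjI)
      fix j assume j: "j < L N"
      show "ms_norm M (\<lambda>\<omega>. \<psi> (Suc m) (Q N j) * isum v (Q N) (\<lambda>j. \<xi> (Q N j)) j \<omega>) \<le> P * ((1 + T) * By)"
        unfolding ms_norm_cmult
      proof (rule mult_mono)
        show "\<bar>\<psi> (Suc m) (Q N j)\<bar> \<le> P" using P(2) Qin[of j N] j a by auto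
        show "ms_norm M (isum v (Q N) (\<lambda>j. \<xi> (Q N j)) j) \<le> (1 + T) * By"
          using j Qin ad By by (intro isum_integrator_uniform[OF v Q a(1) order_refl]) auto
      qed (use P(1) in auto)
    qed (rule Zad)
    moreover have "0 \<le> P * ((1 + T) * By)" using P(1) By(1) t_nonneg t_le_T by simp
    ultimately have "square_integrable M (nested_sum w \<psi> (Q N) m
        (\<lambda>j \<omega>. \<psi> (Suc m) (Q N j) * isum v (Q N) (\<lambda>j. \<xi> (Q N j)) j \<omega>) (L N))"
      by (rule C(2)[OF a(1) order_refl Q, THEN conjunct1])
    then show ?thesis by (simp add: G_def v_def)
  qed
  have Glim: "AE \<omega> in M. (\<lambda>N. G N \<omega>) \<longlonglongrightarrow> X \<omega>"
    using QX by (intro AE_tendsto_of_ms_norm[OF Gsq sqX]) (simp add: G_def less_imp_le)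
  have "AE \<omega> in M. \<forall>l\<in>{..<n}. (\<lambda>N. V N l \<omega>) \<longlonglongrightarrow> I (p (Suc l)) \<omega>"
    using Vlim by (intro AE_finite_allI) auto
  with Glim have Ulim: "AE \<omega> in M. (\<lambda>N. U N \<omega>) \<longlonglongrightarrow> S \<omega> - X \<omega>"
  proof eventually_elim
    case (elim \<omega>)
    then show ?case unfolding U_def S by (intro tendsto_diff tendsto_sum tendsto_mult tendsto_const) auto
  qed
  have U: "square_integrable M (U N) \<and> ms_norm M (U N) \<le> C * (P * (2 * B))" for N
  proof -
    define q where "q = Q N"
    define d where "d = c N"
    \<comment> \<open>\<open>U N\<close> becomes a single nested sum with integrand
      \<open>Z\<close>. The cut-off \<open>d (Suc l) \<le> i\<close> admits an increment of
      \<open>p\<close> only once its interval has ended by \<open>q i\<close>; this also restores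
      adaptedness, since \<delta> is known only at the right end of its interval.\<close>
    define Z where "Z = (\<lambda>i \<omega>. (\<Sum>l<n. \<delta> l \<omega> * (if d (Suc l) \<le> i then \<psi> (Suc m) (q i) else 0)) -
        \<psi> (Suc m) (q i) * isum v q (\<lambda>j. \<xi> (q j)) i \<omega>)"
    \<comment> \<open>The cut-off makes the innermost terms vanish before the tail begins, as
      \<open>nested_sum_shift\<close> requires.\<close>
    have V': "V N l \<omega> = nested_sum w \<psi> q m (\<lambda>i \<omega>. if d (Suc l) \<le> i then \<psi> (Suc m) (q i) else 0) (L N) \<omega>"
      if l: "l < n" for l \<omega>
    proof -
      have "d (Suc l) \<le> L N" using refinement_le[OF ref, of "Suc l" N] l by (simp add: d_def)
      then have eq: "L N = d (Suc l) + (L N - d (Suc l))" by simp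
      show ?thesis
        by (subst eq, subst nested_sum_shift) (simp_all add: V_def q_def d_def)
    qed
    have "U N \<omega> = nested_sum w \<psi> q m Z (L N) \<omega>" for \<omega>
      unfolding Z_def nested_sum_diff nested_sum_linear U_def G_def
      by (simp add: V' q_def v_def)
    then have UZ: "U N = nested_sum w \<psi> q m Z (L N)" by (rule ext)
    have "adapted_L2 (q i) (Z i) \<and> ms_norm M (Z i) \<le> P * (2 * B)" if i: "i < L N" for i
    proof -
      obtain l0 where l0: "l0 < n" "d l0 \<le> i" "i < d (Suc l0)"
        using refinement_locate[OF ref i] unfolding d_def by blast
      have iff: "d (Suc l) \<le> i \<longleftrightarrow> l < l0" if "l < n" for l
      proof
        assume "d (Suc l) \<le> i"
        show "l < l0"
        proof (rule ccontr)
          assume "\<not> l < l0"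
          then have "d (Suc l0) \<le> d (Suc l)" using refinement_mono[OF ref, of "Suc l0" "Suc l" N] that by (simp add: d_def)
          with \<open>d (Suc l) \<le> i\<close> l0(3) show False by simp
        qed
      next
        assume "l < l0"
        then have "d (Suc l) \<le> d l0" using refinement_mono[OF ref, of "Suc l" l0 N] l0(1) by (simp add: d_def)
        with l0(2) show "d (Suc l) \<le> i" by simp
      qed
      have "(\<Sum>l<n. \<delta> l \<omega> * (if d (Suc l) \<le> i then \<psi> (Suc m) (q i) else 0)) =
          \<psi> (Suc m) (q i) * isum v p (\<lambda>j. \<xi> (p j)) l0 \<omega>" for \<omega>
      proof -
        have "(\<Sum>l<n. \<delta> l \<omega> * (if d (Suc l) \<le> i then \<psi> (Suc m) (q i) else 0)) =
            (\<Sum>l\<in>{..<n}. if l < l0 then \<delta> l \<omega> * \<psi> (Suc m) (q i) else 0)"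
          using iff by (intro sum.cong) auto
        also have "\<dots> = (\<Sum>l<l0. \<delta> l \<omega> * \<psi> (Suc m) (q i))"
          using l0(1) by (intro sum.mono_neutral_cong_right) auto
        finally show ?thesis by (simp add: isum_def \<delta>_def sum_distrib_left mult.commute)
      qed
      then have Zi: "Z i = (\<lambda>\<omega>. \<psi> (Suc m) (q i) * (isum v p (\<lambda>j. \<xi> (p j)) l0 \<omega> - isum v q (\<lambda>j. \<xi> (q j)) i \<omega>))"
        by (simp add: Z_def right_diff_distrib)
      have ql: "q (d l0) = p l0" "q (d (Suc l0)) = p (Suc l0)"
        using ref[of N] l0(1) by (auto simp: refinement_def q_def d_def)
      have "d (Suc l0) \<le> L N" using refinement_le[OF ref, of "Suc l0" N] l0(1) by (simp add: d_def)
      then have pq: "p l0 \<le> q i" "q i \<le> p (Suc l0)"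
        using partition_mono[OF Q, of "d l0" i N] partition_mono[OF Q, of i "d (Suc l0)" N] l0 ql i
        by (auto simp: q_def)
      have qi: "q i \<in> {a..T}" using Qin i by (simp add: q_def)
      have ad1: "adapted_L2 (p l0) (isum v p (\<lambda>j. \<xi> (p j)) l0)"
        using l0(1) pin ad by (intro isum_integrator(1)[OF v p a(1) order_refl]) auto
      then have ad1': "adapted_L2 (q i) (isum v p (\<lambda>j. \<xi> (p j)) l0)"
        using pq qi pt[of l0] l0(1) by (intro adapted_L2_mono[OF ad1]) auto
      have ad2: "adapted_L2 (q i) (isum v q (\<lambda>j. \<xi> (q j)) i)"
        using i Qin ad unfolding q_def by (intro isum_integrator(1)[OF v Q a(1) order_refl]) auto
      have "adapted_L2 (q i) (Z i)" unfolding Zi by (intro adapted_L2_cmult adapted_L2_diff ad1' ad2)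
      moreover have "ms_norm M (Z i) \<le> P * (2 * B)"
        unfolding Zi ms_norm_cmult
      proof (rule mult_mono)
        show "\<bar>\<psi> (Suc m) (q i)\<bar> \<le> P" using P(2) qi a by auto
        have "ms_dist M (isum v p (\<lambda>j. \<xi> (p j)) l0) (isum v q (\<lambda>j. \<xi> (q j)) i) \<le>
            ms_dist M (isum v p (\<lambda>j. \<xi> (p j)) l0) (Y (q i)) +
            ms_dist M (Y (q i)) (isum v q (\<lambda>j. \<xi> (q j)) i)"
          by (intro ms_norm_triangle_diff adapted_L2_sq[OF ad1] adapted_L2_sq[OF ad2] adapted_L2_sq[OF Y(2)[OF qi]])
        also have "\<dots> \<le> B + B"
        proof (rule add_mono)
          show "ms_dist M (isum v p (\<lambda>j. \<xi> (p j)) l0) (Y (q i)) \<le> B"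
            using B(2)[OF l0(1) pq] by (simp add: v_def)
          show "ms_dist M (Y (q i)) (isum v q (\<lambda>j. \<xi> (q j)) i) \<le> B"
            unfolding q_def
            by (subst ms_norm_minus_commute) (use QY[of i N] i in \<open>simp add: less_imp_le\<close>)
        qed
        finally show "ms_dist M (isum v p (\<lambda>j. \<xi> (p j)) l0) (isum v q (\<lambda>j. \<xi> (q j)) i) \<le> 2 * B"
          by simp
      qed (use P(1) in auto)
      ultimately show ?thesis by blast
    qed
    moreover have "0 \<le> P * (2 * B)" using P(1) B(1) by simp
    ultimately show ?thesis unfolding UZ using C(2)[OF a(1) order_refl Q[of N, folded q_def]] by blast
  qed
  have "\<delta> l \<in> borel_measurable M" if "l < n" for l
    unfolding \<delta>_def using integrator_measurable[OF v] pt[of l] pt[of "Suc l"] that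
      square_integrable_measurable[OF adapted_L2_sq[OF ad[OF pin[of l]]]]
    by (intro borel_measurable_times borel_measurable_diff) auto
  moreover have "I (p (Suc l)) \<in> borel_measurable M" if "l < n" for l
    using square_integrable_measurable[OF Isq] pt[of "Suc l"] that by auto
  ultimately have "S \<in> borel_measurable M"
    unfolding S[abs_def] by (intro borel_measurable_sum borel_measurable_times) auto
  then have "(\<lambda>\<omega>. S \<omega> - X \<omega>) \<in> borel_measurable M"
    using square_integrable_measurable[OF sqX] by (rule borel_measurable_diff)
  \<comment> \<open>Only measurability of \<open>S\<close> is known so far; that
    \<open>S - X\<close> is square integrable comes out of Fatou's lemma.\<close>
  note fatou = ms_norm_Fatou[OF conjunct1[OF U] conjunct2[OF U] this Ulim]
  show "ms_dist M (reversed_sum (w (m + 2)) \<xi> I n p) X \<le> C * (P * (2 * B))"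
    using fatou(2) by (simp add: S_def v_def)
  show "square_integrable M (reversed_sum (w (m + 2)) \<xi> I n p)"
    using square_integrable_add[OF fatou(1) sqX] by (simp add: S_def v_def)
qed

text \<open>For \<open>k = 0\<close> the inner factor is 1 and the reversed sum is an ordinary
  Riemann sum. Otherwise \<open>reversed_sum_distance\<close> is applied twice: with a crude
  \<open>B\<close> for an arbitrary partition, which gives square integrability, and with a small
  \<open>B\<close> for a fine one, where the sum along \<open>p\<close> is close to
  \<open>Y (p l)\<close> and \<open>Y\<close> varies little on the interval.\<close>

lemma reversed_sum_converges:
  assumes W: "\<And>l. l \<in> {1..k+1} \<Longrightarrow> integrator (w l)"
    and g: "\<And>l. l \<in> {1..k} \<Longrightarrow> continuous_on {t..T} (\<psi> l)"
    and a: "t \<le> a" "a \<le> T" and \<xi>: "\<xi> \<in> M2_class M T F f a T" "ms_continuous M a T \<xi>"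
    and X: "is_iterated_ito M T F f w \<psi> a k \<xi> X"
    and I: "inner_limit w \<psi> k I"
  shows "interval_partition a T n p \<Longrightarrow> square_integrable M (reversed_sum (w (Suc k)) \<xi> I n p)"
    and "0 < e \<Longrightarrow> \<exists>d>0. \<forall>n p. interval_partition a T n p \<longrightarrow> mesh n p < d \<longrightarrow>
      ms_dist M (reversed_sum (w (Suc k)) \<xi> I n p) X < e"
proof -
  note ad = M2_class_adapted_L2[OF \<xi>(1)]
  have "(\<forall>n p. interval_partition a T n p \<longrightarrow> square_integrable M (reversed_sum (w (Suc k)) \<xi> I n p)) \<and>
    (\<forall>e>0. \<exists>d>0. \<forall>n p. interval_partition a T n p \<longrightarrow> mesh n p < d \<longrightarrow>
      ms_dist M (reversed_sum (w (Suc k)) \<xi> I n p) X < e)"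
  proof (cases k)
    case 0
    have w: "integrator (w 1)" using W by simp
    have eq: "reversed_sum (w (Suc k)) \<xi> I n p \<omega> = nested_sum w \<psi> p k (\<lambda>i. \<xi> (p i)) n \<omega>"
      if "interval_partition a T n p" "\<omega> \<in> space M" for n p \<omega>
    proof -
      have "I (p (Suc l)) \<omega> = 1" if "l < n" for l
        using I partition_bounds[OF \<open>interval_partition a T n p\<close>, of "Suc l"] that \<open>\<omega> \<in> space M\<close> a
        by (simp add: inner_limit_def 0)
      then show ?thesis by (simp add: reversed_sum_def isum_def 0)
    qed
    have sq: "square_integrable M (nested_sum w \<psi> p k (\<lambda>i. \<xi> (p i)) n)"
      if p: "interval_partition a T n p" for n p
    proof -
      have "adapted_L2 (p j) (\<xi> (p j))" if "j < n" for j
        using partition_bounds[OF p, of j] that ad by simp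
      then show ?thesis
        using adapted_L2_sq[OF isum_integrator(1)[OF w p a(1) order_refl order_refl, of "\<lambda>i. \<xi> (p i)"]]
        by (simp add: 0)
    qed
    show ?thesis
    proof (intro conjI allI impI)
      fix n p assume p: "interval_partition a T n p"
      show "square_integrable M (reversed_sum (w (Suc k)) \<xi> I n p)"
        using sq[OF p] square_integrable_cong[OF eq[OF p], of M] by simp
    next
      fix e :: real assume e: "0 < e"
      have "ms_dist M (reversed_sum (w (Suc k)) \<xi> I n p) X =
          ms_dist M (nested_sum w \<psi> p k (\<lambda>i. \<xi> (p i)) n) X" if "interval_partition a T n p" for n p
        using eq[OF that] by (intro ms_norm_cong) simp
      then show "\<exists>d>0. \<forall>n p. interval_partition a T n p \<longrightarrow> mesh n p < d \<longrightarrow>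
          ms_dist M (reversed_sum (w (Suc k)) \<xi> I n p) X < e"
        using nested_sum_converges[where k = k and w = w and \<psi> = \<psi>, OF W g a \<xi>(2) X e] by simp
    qed
  next
    case (Suc m)
    have W': "\<And>l. l \<in> {1..Suc m + 1} \<Longrightarrow> integrator (w l)"
      and g': "\<And>l. l \<in> {1..Suc m} \<Longrightarrow> continuous_on {t..T} (\<psi> l)"
      and X': "is_iterated_ito M T F f w \<psi> a (Suc m) \<xi> X" and I': "inner_limit w \<psi> (Suc m) I"
      using W g X I by (simp_all add: Suc)
    have w: "integrator (w (m + 2))" using W'[of "m + 2"] by simp
    obtain Y where Y: "\<And>s. s \<in> {a..T} \<Longrightarrow> is_stochastic_integral M T F f (w (m + 2)) \<xi> a s (Y s)"
        "\<And>s. s \<in> {a..T} \<Longrightarrow> adapted_L2 s (Y s)" "jointly_measurable M a T Y" "ms_continuous M a T Y"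
      using integral_process_exists[OF w a(1) a(2) order_refl \<xi>] by blast
    have "\<And>l. l \<in> {1..m+1} \<Longrightarrow> integrator (w l)" "\<And>l. l \<in> {1..m} \<Longrightarrow> continuous_on {t..T} (\<psi> l)"
      using W' g' by simp_all
    then obtain C where C: "C > 0" "\<And>a b n p Z B. t \<le> a \<Longrightarrow> b \<le> T \<Longrightarrow> interval_partition a b n p \<Longrightarrow>
      \<forall>j<n. adapted_L2 (p j) (Z j) \<and> ms_norm M (Z j) \<le> B \<Longrightarrow> 0 \<le> B \<Longrightarrow>
      square_integrable M (nested_sum w \<psi> p m Z n) \<and> ms_norm M (nested_sum w \<psi> p m Z n) \<le> C * B"
      using nested_sum_bound[where k = m and w = w and \<psi> = \<psi>] by blast
    obtain P where P: "0 < P" "\<And>x. x \<in> {t..T} \<Longrightarrow> \<bar>\<psi> (Suc m) x\<bar> \<le> P"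
      using continuous_bounded[OF g'[of "Suc m"]] by auto
    have distance: "square_integrable M (reversed_sum (w (m + 2)) \<xi> I n p) \<and>
        ms_dist M (reversed_sum (w (m + 2)) \<xi> I n p) X \<le> C * (P * (2 * B))"
      if "interval_partition a T n p" "0 < B" "\<And>l u. l < n \<Longrightarrow> p l \<le> u \<Longrightarrow> u \<le> p (Suc l) \<Longrightarrow>
        ms_dist M (isum (w (m + 2)) p (\<lambda>j. \<xi> (p j)) l) (Y u) \<le> B" for n p B
      by (intro conjI; rule reversed_sum_distance[where m = m and w = w and \<psi> = \<psi> and a = a
          and Y = Y and B = B and C = C and P = P]; fact)
    have sqY: "square_integrable M (Y u)" if "u \<in> {a..T}" for u using adapted_L2_sq[OF Y(2)[OF that]] .
    have sqR: "square_integrable M (isum (w (m + 2)) p (\<lambda>j. \<xi> (p j)) l)"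
      if p: "interval_partition a T n p" "l \<le> n" for n p l
      using partition_bounds[OF p(1)] ad
      by (intro adapted_L2_sq[OF isum_integrator(1)[OF w p(1) a(1) order_refl p(2)]]) auto
    have uin: "u \<in> {a..T}" if "interval_partition a T n p" "l < n" "p l \<le> u" "u \<le> p (Suc l)" for n p l u
      using partition_bounds[OF that(1), of l] partition_bounds[OF that(1), of "Suc l"] that by auto
    show ?thesis
    proof (intro conjI allI impI)
      fix n p assume p: "interval_partition a T n p"
      obtain B where B: "0 < B" "\<And>\<tau>. \<tau> \<in> {a..T} \<Longrightarrow> ms_norm M (Y \<tau>) \<le> B" using ms_continuous_bounded[OF Y(4)] by blast
      \<comment> \<open>Any finite positive bound will do here, so the finitely many partial sums
        and the supremum of the norms of \<open>Y\<close> are simply added.\<close>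
      define B' where "B' = (\<Sum>l<n. ms_norm M (isum (w (m + 2)) p (\<lambda>j. \<xi> (p j)) l)) + B"
      have B': "0 < B'" using B(1) by (auto simp: B'_def intro!: add_nonneg_pos sum_nonneg)
      have "ms_dist M (isum (w (m + 2)) p (\<lambda>j. \<xi> (p j)) l) (Y u) \<le> B'"
        if l: "l < n" "p l \<le> u" "u \<le> p (Suc l)" for l u
      proof -
        have "ms_dist M (isum (w (m + 2)) p (\<lambda>j. \<xi> (p j)) l) (Y u) \<le>
            ms_norm M (isum (w (m + 2)) p (\<lambda>j. \<xi> (p j)) l) + ms_norm M (Y u)"
          using ms_norm_triangle_diff[OF sqR[OF p, of l] square_integrable_0 sqY[OF uin[OF p l]]] l(1)
            ms_norm_minus_commute[of M "\<lambda>\<omega>. 0" "Y u"] by simp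
        also have "\<dots> \<le> B'"
          unfolding B'_def using l B(2)[OF uin[OF p l]] by (intro add_mono member_le_sum) auto
        finally show ?thesis .
      qed
      from distance[OF p B' this] show "square_integrable M (reversed_sum (w (Suc k)) \<xi> I n p)"
        by (simp add: Suc)
    next
      fix e :: real assume e: "0 < e"
      \<comment> \<open>The oscillation bound is \<open>2 * e'\<close>, so the final estimate is
        \<open>4 * C * P * e'\<close>, which equals \<open>e / 2\<close>.\<close>
      define e' where "e' = e / (8 * C * P)"
      have e': "0 < e'" using e C(1) P(1) by (simp add: e'_def)
      obtain d1 where d1: "0 < d1" "\<And>n p i. interval_partition a T n p \<Longrightarrow> mesh n p < d1 \<Longrightarrow> i \<le> n \<Longrightarrow>
          ms_dist M (isum (w (m + 2)) p (\<lambda>j. \<xi> (p j)) i) (Y (p i)) < e'"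
        using riemann_sums_uniform[OF w a(1) order_refl \<xi>(2) Y(1) e'] by blast
      obtain d2 where d2: "0 < d2" "\<And>u v. u \<in> {a..T} \<Longrightarrow> v \<in> {a..T} \<Longrightarrow> \<bar>u - v\<bar> < d2 \<Longrightarrow>
          ms_dist M (Y u) (Y v) < e'"
        using ms_continuous_modulus[OF Y(4) e'] by blast
      show "\<exists>d>0. \<forall>n p. interval_partition a T n p \<longrightarrow> mesh n p < d \<longrightarrow>
          ms_dist M (reversed_sum (w (Suc k)) \<xi> I n p) X < e"
      proof (intro exI[of _ "min d1 d2"] conjI allI impI)
        show "0 < min d1 d2" using d1(1) d2(1) by simp
        fix n p assume p: "interval_partition a T n p" and m: "mesh n p < min d1 d2"
        have "ms_dist M (isum (w (m + 2)) p (\<lambda>j. \<xi> (p j)) l) (Y u) \<le> 2 * e'"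
          if l: "l < n" "p l \<le> u" "u \<le> p (Suc l)" for l u
        proof -
          have pl: "p l \<in> {a..T}" using partition_bounds[OF p, of l] l(1) by simp
          have "ms_dist M (isum (w (m + 2)) p (\<lambda>j. \<xi> (p j)) l) (Y u) \<le>
              ms_dist M (isum (w (m + 2)) p (\<lambda>j. \<xi> (p j)) l) (Y (p l)) + ms_dist M (Y (p l)) (Y u)"
            using l(1) by (intro ms_norm_triangle_diff sqR[OF p] sqY pl uin[OF p l]) auto
          moreover have "ms_dist M (isum (w (m + 2)) p (\<lambda>j. \<xi> (p j)) l) (Y (p l)) < e'"
            using d1(2)[OF p] m l(1) by simp
          moreover have "ms_dist M (Y (p l)) (Y u) < e'"
            using d2(2)[OF pl uin[OF p l]] mesh_ge[OF l(1), of p] m l by auto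
          ultimately show ?thesis by linarith
        qed
        from distance[OF p _ this] e'
        have "ms_dist M (reversed_sum (w (Suc k)) \<xi> I n p) X \<le> C * (P * (2 * (2 * e')))"
          by (simp add: Suc)
        also have "\<dots> = e / 2" using C(1) P(1) by (simp add: e'_def)
        also have "\<dots> < e" using e by simp
        finally show "ms_dist M (reversed_sum (w (Suc k)) \<xi> I n p) X < e" .
      qed
    qed
  qed
  then show "interval_partition a T n p \<Longrightarrow> square_integrable M (reversed_sum (w (Suc k)) \<xi> I n p)"
    and "0 < e \<Longrightarrow> \<exists>d>0. \<forall>n p. interval_partition a T n p \<longrightarrow> mesh n p < d \<longrightarrow>
      ms_dist M (reversed_sum (w (Suc k)) \<xi> I n p) X < e"
    by blast+
qed

text \<open>The exchange of order on \<open>[a,T]\<close> for a general integrand. It is used in two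
  roles: with \<phi> for the theorem, and with a deterministic integrand to climb from one inner
  reversed integral to the next.\<close>

lemma is_reversed_limit_iterated_ito:
  assumes W: "\<And>l. l \<in> {1..k+1} \<Longrightarrow> integrator (w l)"
    and g: "\<And>l. l \<in> {1..k} \<Longrightarrow> continuous_on {t..T} (\<psi> l)"
    and a: "t \<le> a" "a \<le> T" and \<xi>: "\<xi> \<in> M2_class M T F f a T" "ms_continuous M a T \<xi>"
    and X: "is_iterated_ito M T F f w \<psi> a k \<xi> X"
    and I: "inner_limit w \<psi> k I"
  shows "is_reversed_limit M T (w (Suc k)) \<xi> I a X"
  unfolding is_reversed_limit_def reversed_sum_def[symmetric]
proof (intro allI impI, elim conjE)
  note conv = reversed_sum_converges[where k = k and w = w and \<psi> = \<psi>, OF W g a \<xi> X I]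
  fix n p assume p: "\<forall>N. interval_partition a T (n N) (p N)" and m: "(\<lambda>N. mesh (n N) (p N)) \<longlonglongrightarrow> 0"
  have "(\<lambda>N. ms_dist M (reversed_sum (w (Suc k)) \<xi> I (n N) (p N)) X) \<longlonglongrightarrow> 0"
  proof (rule order_tendstoI)
    fix e :: real assume "0 < e"
    then obtain d where d: "0 < d" "\<And>n p. interval_partition a T n p \<Longrightarrow> mesh n p < d \<Longrightarrow>
        ms_dist M (reversed_sum (w (Suc k)) \<xi> I n p) X < e"
      using conv(2) by blast
    have "\<forall>\<^sub>F N in sequentially. mesh (n N) (p N) < d" using m d(1) by (intro order_tendstoD)
    then show "\<forall>\<^sub>F N in sequentially. ms_dist M (reversed_sum (w (Suc k)) \<xi> I (n N) (p N)) X < e"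
      by eventually_elim (use d(2) p in blast)
  qed (auto intro!: always_eventually less_le_trans[OF _ ms_norm_nonneg])
  moreover have "square_integrable M (reversed_sum (w (Suc k)) \<xi> I (n N) (p N))" for N
    using conv(1) p by blast
  ultimately show "ms_limit M (\<lambda>N \<omega>. reversed_sum (w (Suc k)) \<xi> I (n N) (p N) \<omega>) X"
    using is_iterated_ito_square_integrable[OF X] by (simp add: ms_limit_iff_ms_norm)
qed

text \<open>The limit is prescribed along every sequence of partitions with vanishing mesh; that at
  least one such sequence exists keeps the condition from being vacuous.\<close>

lemma is_reversed_limit_unique:
  assumes "a \<le> T" "is_reversed_limit M T v \<xi> I a X" "is_reversed_limit M T v \<xi> I a Y"
  shows "AE \<omega> in M. X \<omega> = Y \<omega>"
proof -
  obtain n p where np: "\<And>N. interval_partition a T (n N) (p N)" "(\<lambda>N. mesh (n N) (p N)) \<longlonglongrightarrow> 0"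
    using partition_sequence_exists[OF assms(1)] by blast
  let ?S = "\<lambda>N \<omega>. \<Sum>l<n N. \<xi> (p N l) \<omega> * (v (p N (Suc l)) \<omega> - v (p N l) \<omega>) * I (p N (Suc l)) \<omega>"
  have "ms_limit M ?S X" "ms_limit M ?S Y"
    using assms(2,3) np unfolding is_reversed_limit_def by blast+
  then show ?thesis by (rule ms_limit_unique)
qed

lemma is_reversed_limit_square_integrable:
  assumes "a \<le> T" "is_reversed_limit M T v \<xi> I a X"
  shows "square_integrable M X"
proof -
  obtain n p where np: "\<And>N. interval_partition a T (n N) (p N)" "(\<lambda>N. mesh (n N) (p N)) \<longlonglongrightarrow> 0"
    using partition_sequence_exists[OF assms(1)] by blast
  have "ms_limit M (\<lambda>N \<omega>. \<Sum>l<n N. \<xi> (p N l) \<omega> * (v (p N (Suc l)) \<omega> - v (p N l) \<omega>) * I (p N (Suc l)) \<omega>) X"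
    using assms(2) np unfolding is_reversed_limit_def by blast
  then show ?thesis by (simp add: ms_limit_def)
qed

text \<open>Induction on the order through the theorem itself: given the description of
  \<open>J\<close>, the exchange with the deterministic integrand \<open>\<psi> (Suc k)\<close>
  shows that the iterated integral over \<open>[s,T]\<close> is a limit of the same reversed sums as
  \<open>I s\<close>. The two agree almost surely, so the forward nested sums converge to
  \<open>I s\<close>.\<close>

lemma reversed_inner_limit:
  assumes "\<And>l. l \<in> {1..k} \<Longrightarrow> integrator (w l)" "\<And>l. l \<in> {1..k} \<Longrightarrow> continuous_on {t..T} (\<psi> l)"
    and "is_reversed_inner M T w \<psi> t k I"
  shows "inner_limit w \<psi> k I"
  using assms
proof (induction k arbitrary: I)
  case 0
  then show ?case by (simp add: inner_limit_def)
next
  case (Suc k)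
  obtain J where J: "is_reversed_inner M T w \<psi> t k J"
    and I: "\<And>s. s \<in> {t..T} \<Longrightarrow> is_reversed_limit M T (w (Suc k)) (\<lambda>\<tau> \<omega>. \<psi> (Suc k) \<tau>) J s (I s)"
    using Suc.prems(3) unfolding is_reversed_inner.simps by blast
  have W: "\<And>l. l \<in> {1..k+1} \<Longrightarrow> integrator (w l)" and g: "\<And>l. l \<in> {1..k} \<Longrightarrow> continuous_on {t..T} (\<psi> l)"
    using Suc.prems(1,2) by simp_all
  have Jl: "inner_limit w \<psi> k J" using Suc.IH[OF _ g J] W by simp
  have "square_integrable M (I s) \<and> (\<forall>e>0. \<exists>d>0. \<forall>n p.
       interval_partition s T n p \<longrightarrow> mesh n p < d \<longrightarrow>
       ms_dist M (nested_sum w \<psi> p k (\<lambda>i \<omega>. \<psi> (Suc k) (p i)) n) (I s) < e)" if s: "s \<in> {t..T}" for s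
  proof (intro conjI allI impI)
    have st: "t \<le> s" "s \<le> T" using s by auto
    have "continuous_on {s..T} (\<psi> (Suc k))"
      using Suc.prems(2)[of "Suc k"] st by (auto intro: continuous_on_subset)
    note det = deterministic_integrand[OF st(1) this]
    obtain X where X: "is_iterated_ito M T F f w \<psi> s k (\<lambda>\<tau> \<omega>. \<psi> (Suc k) \<tau>) X"
      using iterated_ito_exists[where k = k and w = w and \<psi> = \<psi>, OF W g st det] by blast
    note Isq = is_reversed_limit_square_integrable[OF st(2) I[OF s]]
    show "square_integrable M (I s)" by (rule Isq)
    note Xsq = is_iterated_ito_square_integrable[OF X]
    have XI: "AE \<omega> in M. X \<omega> = I s \<omega>"
      by (rule is_reversed_limit_unique[OF st(2)
            is_reversed_limit_iterated_ito[where k = k and w = w and \<psi> = \<psi>, OF W g st det X Jl] I[OF s]])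
    fix e :: real assume e: "0 < e"
    obtain d where d: "0 < d" "\<And>n p. interval_partition s T n p \<Longrightarrow> mesh n p < d \<Longrightarrow>
        ms_dist M (nested_sum w \<psi> p k (\<lambda>i \<omega>. \<psi> (Suc k) (p i)) n) X < e"
      using nested_sum_converges[where k = k and w = w and \<psi> = \<psi>, OF W g st det(2) X e] by blast
    have "ms_dist M X (I s) = ms_norm M (\<lambda>\<omega>. 0)"
      using XI Xsq Isq by (intro ms_norm_cong_AE borel_measurable_diff) (auto dest: square_integrable_measurable)
    then have XI0: "ms_dist M X (I s) = 0" by simp
    obtain C where C: "C > 0" "\<And>a b n p Z B. t \<le> a \<Longrightarrow> b \<le> T \<Longrightarrow> interval_partition a b n p \<Longrightarrow>
      \<forall>j<n. adapted_L2 (p j) (Z j) \<and> ms_norm M (Z j) \<le> B \<Longrightarrow> 0 \<le> B \<Longrightarrow>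
      square_integrable M (nested_sum w \<psi> p k Z n) \<and> ms_norm M (nested_sum w \<psi> p k Z n) \<le> C * B"
      using nested_sum_bound[where k = k and w = w and \<psi> = \<psi>, OF W g] by blast
    obtain P where P: "0 < P" "\<And>\<tau>. \<tau> \<in> {s..T} \<Longrightarrow> ms_norm M (\<lambda>\<omega>. \<psi> (Suc k) \<tau>) \<le> P"
      using ms_continuous_bounded[OF det(2)] by blast
    have "ms_dist M (nested_sum w \<psi> p k (\<lambda>i \<omega>. \<psi> (Suc k) (p i)) n) (I s) < e"
      if p: "interval_partition s T n p" "mesh n p < d" for n p
    proof -
      have "\<forall>j<n. adapted_L2 (p j) (\<lambda>\<omega>. \<psi> (Suc k) (p j)) \<and> ms_norm M (\<lambda>\<omega>. \<psi> (Suc k) (p j)) \<le> P"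
        using P(2) partition_bounds[OF p(1)] by simp
      then have "square_integrable M (nested_sum w \<psi> p k (\<lambda>i \<omega>. \<psi> (Suc k) (p i)) n)"
        using C(2)[OF st(1) order_refl p(1)] P(1) by simp
      from ms_norm_triangle_diff[OF this Xsq Isq] d(2)[OF p] XI0 show ?thesis by linarith
    qed
    with d(1) show "\<exists>d>0. \<forall>n p. interval_partition s T n p \<longrightarrow> mesh n p < d \<longrightarrow>
       ms_dist M (nested_sum w \<psi> p k (\<lambda>i \<omega>. \<psi> (Suc k) (p i)) n) (I s) < e" by blast
  qed
  then show ?case by (simp add: inner_limit_def)
qed

text \<open>The iterated integral over \<open>[s,T]\<close> is itself a reversed limit, so its
  existence settles the next level. The versions are chosen for each \<open>s\<close> separately, as
  the definition asks for no joint measurability in \<open>s\<close>.\<close>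

lemma reversed_inner_exists:
  assumes "\<And>l. l \<in> {1..k} \<Longrightarrow> integrator (w l)" "\<And>l. l \<in> {1..k} \<Longrightarrow> continuous_on {t..T} (\<psi> l)"
  shows "\<exists>I. is_reversed_inner M T w \<psi> t k I"
  using assms
proof (induction k)
  case 0
  show ?case by (intro exI[of _ "\<lambda>_ _. 1"]) simp
next
  case (Suc k)
  have W: "\<And>l. l \<in> {1..k+1} \<Longrightarrow> integrator (w l)" and g: "\<And>l. l \<in> {1..k} \<Longrightarrow> continuous_on {t..T} (\<psi> l)"
    using Suc.prems(1,2) by simp_all
  obtain J where J: "is_reversed_inner M T w \<psi> t k J" using Suc.IH[OF _ g] W by auto
  have Jl: "inner_limit w \<psi> k J" using reversed_inner_limit[where k = k and w = w and \<psi> = \<psi>, OF _ g J] W by simp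
  have "\<exists>X. is_reversed_limit M T (w (Suc k)) (\<lambda>\<tau> \<omega>. \<psi> (Suc k) \<tau>) J s X" if s: "s \<in> {t..T}" for s
  proof -
    have st: "t \<le> s" "s \<le> T" using s by auto
    have "continuous_on {s..T} (\<psi> (Suc k))"
      using Suc.prems(2)[of "Suc k"] st by (auto intro: continuous_on_subset)
    note det = deterministic_integrand[OF st(1) this]
    obtain X where X: "is_iterated_ito M T F f w \<psi> s k (\<lambda>\<tau> \<omega>. \<psi> (Suc k) \<tau>) X"
      using iterated_ito_exists[where k = k and w = w and \<psi> = \<psi>, OF W g st det] by blast
    from is_reversed_limit_iterated_ito[where k = k and w = w and \<psi> = \<psi>, OF W g st det X Jl] show ?thesis by blast
  qed
  then obtain I where "\<And>s. s \<in> {t..T} \<Longrightarrow> is_reversed_limit M T (w (Suc k)) (\<lambda>\<tau> \<omega>. \<psi> (Suc k) \<tau>) J s (I s)"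
    by metis
  with J show ?case unfolding is_reversed_inner.simps by blast
qed

end

theorem theorem1:
  fixes M :: "'a measure"
    and F :: "real \<Rightarrow> 'a measure"
    and f :: "real \<Rightarrow> 'a \<Rightarrow> real"
    and \<phi> :: "real \<Rightarrow> 'a \<Rightarrow> real"
    and \<psi> :: "nat \<Rightarrow> real \<Rightarrow> real"
    and w :: "nat \<Rightarrow> real \<Rightarrow> 'a \<Rightarrow> real"
    and t T :: real
    and k :: nat
  assumes "prob_space M" and "complete_measure M"
    and "standard_wiener M T f" and "wiener_filtration M T F f"
    and "0 \<le> t" and "t < T" and "k \<ge> 1"
    and "\<phi> \<in> S2_class M T F f t T"
    and "\<And>l. l \<in> {1..k} \<Longrightarrow> continuous_on {t..T} (\<psi> l)"
    and "\<And>l. l \<in> {1..k+1} \<Longrightarrow>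
      (\<forall>\<tau>\<in>{t..T}. \<forall>\<omega>\<in>space M. w l \<tau> \<omega> = f \<tau> \<omega>) \<or> (\<forall>\<tau>\<in>{t..T}. \<forall>\<omega>\<in>space M. w l \<tau> \<omega> = \<tau>)"
  shows "(\<exists>Y. is_reversed_iterated M T w \<psi> t k \<phi> Y) \<and>
    (\<exists>X. is_iterated_ito M T F f w \<psi> t k \<phi> X) \<and>
    (\<forall>X Y. is_iterated_ito M T F f w \<psi> t k \<phi> X \<and> is_reversed_iterated M T w \<psi> t k \<phi> Y \<longrightarrow>
      (AE \<omega> in M. X \<omega> = Y \<omega>))"
proof -
  interpret prob_space M by fact
  interpret wiener_space M F f t T
    using assms(3-6) by unfold_locales auto
  have W: "integrator (w l)" if "l \<in> {1..k+1}" for l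
    using assms(10)[OF that] unfolding integrator_def .
  have tT: "t \<le> t" "t \<le> T" using assms(6) by auto
  have \<phi>: "\<phi> \<in> M2_class M T F f t T" using assms(8) by (simp add: S2_class_def)
  have \<phi>c: "ms_continuous M t T \<phi>"
    unfolding ms_continuous_def
  proof (intro ballI conjI)
    fix \<tau> assume \<tau>: "\<tau> \<in> {t..T}"
    show "square_integrable M (\<phi> \<tau>)" by (rule adapted_L2_sq[OF M2_class_adapted_L2[OF \<phi> \<tau>]])
    have "((\<lambda>s. \<integral>\<omega>. (\<phi> s \<omega> - \<phi> \<tau> \<omega>)\<^sup>2 \<partial>M) \<longlongrightarrow> 0) (at \<tau> within {t..T})"
      using assms(8) \<tau> by (simp add: S2_class_def)
    from tendsto_real_sqrt[OF this]
    show "((\<lambda>s. ms_dist M (\<phi> s) (\<phi> \<tau>)) \<longlongrightarrow> 0) (at \<tau> within {t..T})"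
      by (simp add: ms_norm_def)
  qed
  have inner: "inner_limit w \<psi> k I" if "is_reversed_inner M T w \<psi> t k I" for I
    using reversed_inner_limit[where k = k and w = w and \<psi> = \<psi>, OF _ assms(9) that] W by simp
  \<comment> \<open>Every version of the iterated integral is the reversed limit with respect to
    every choice of the inner integrals. This gives existence and, since reversed limits are unique
    almost surely, also the equality for arbitrary versions.\<close>
  have limit: "is_reversed_limit M T (w (Suc k)) \<phi> I t X"
    if "is_iterated_ito M T F f w \<psi> t k \<phi> X" "is_reversed_inner M T w \<psi> t k I" for I X
    by (rule is_reversed_limit_iterated_ito[where k = k and w = w and \<psi> = \<psi>,
          OF W assms(9) tT \<phi> \<phi>c that(1) inner[OF that(2)]])
  obtain X where X: "is_iterated_ito M T F f w \<psi> t k \<phi> X"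
    using iterated_ito_exists[where k = k and w = w and \<psi> = \<psi>, OF W assms(9) tT \<phi> \<phi>c] by blast
  obtain I where I: "is_reversed_inner M T w \<psi> t k I"
    using reversed_inner_exists[where k = k and w = w and \<psi> = \<psi>, OF _ assms(9)] W by auto
  show ?thesis
  proof (intro conjI allI impI)
    show "\<exists>Y. is_reversed_iterated M T w \<psi> t k \<phi> Y"
      using limit[OF X I] I unfolding is_reversed_iterated_def by blast
    show "\<exists>X. is_iterated_ito M T F f w \<psi> t k \<phi> X" using X by blast
    fix X Y assume XY: "is_iterated_ito M T F f w \<psi> t k \<phi> X \<and> is_reversed_iterated M T w \<psi> t k \<phi> Y"
    then obtain J where J: "is_reversed_inner M T w \<psi> t k J" "is_reversed_limit M T (w (Suc k)) \<phi> J t Y"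
      unfolding is_reversed_iterated_def by blast
    show "AE \<omega> in M. X \<omega> = Y \<omega>"
      using is_reversed_limit_unique[OF tT(2) limit[OF conjunct1[OF XY] J(1)] J(2)] .
  qed
qed

end
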